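(* Let $[A]\in\mathcal E$ be a verge with set of main conditions $\mathfrak p=\{(i_1,j_1),\ldots,(i_k,j_k)\}$ ($k=|\mathfrak p|$), let $q^a=|\mathcal O_A^r|$ and let $b$ be the number of hook intersections of the hooks centered at positions in $\mathfrak p$. Then $\mathbb C\mathcal O_A^r$ has irreducible constituents of minimal dimension $q^{a-b}$ if and only if $\mathfrak p$ is hook disconnected. In this case the following hold. 1) $\mathbb C\mathcal O_A^r$ has precisely $q^c$ non-isomorphic irreducible constituents of minimal dimension $q^{a-b}$, where $c=|\hat{\mathcal L}^-\setminus I|$, and each of them occurs with multiplicity one in $\mathbb C\mathcal O_A^r$. 2) $\operatorname{End}_{\mathbb C U}(\mathbb C\mathcal O_A^r)$ depends (up to isomorphism) only on $\mathfrak p$ and not on the particular values of $A$ at the positions $(i,j)\in\mathfrak p$. Thus, varying the nonzero values at the positions $(i,j)\in\mathfrak p$ through $\mathbb F_q^*$, one obtains $(q-1)^kq^c$ non-isomorphic irreducible $\mathbb C U$-modules which occur in their right orbit modules with minimal dimension.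
   Context: Let $q$ be a power of a prime, $n$ a natural number, $U=U_n(q)$ the group of lower unitriangular $n\times n$ matrices over $\mathbb F_q$, and $V$ the additive group of strictly lower triangular $n\times n$ matrices over $\mathbb F_q$. Put $\Phi^+=\{(i,j): 1\leqslant j<i\leqslant n\}$. Fix a nontrivial character $\theta:(\mathbb F_q,+)\to\mathbb C^*$, and for $A\in V$ let $\chi_A:V\to\mathbb C^*$, $\chi_A(B)=\theta\big(\sum_{i,j}A_{ij}B_{ij}\big)$. For an $n\times n$ matrix $M$ let $\overline M\in V$ be obtained by setting all entries on and above the diagonal to zero; write $u^{-t}=(u^{-1})^t$. Let $\mathcal E=\{[A]: A\in V\}$ and let $\mathbb C\mathcal E$ be the $\mathbb C$-space with basis $\mathcal E$, made into a $\mathbb C U$-bimodule by $[A]u=\chi_A(1-u^{-1})\,[\overline{Au^{-t}}]$ and $u[A]=\chi_A(1-u^{-1})\,[\overline{u^{-t}A}]$ for $u\in U$. (This bimodule is isomorphic to the regular bimodule $\mathbb C U$ via $[A]\mapsto \frac1{|U|}\sum_{u\in U}\overline{\chi_A(u-1)}\,u$, the bar here being complex conjugation.) Let $\mathcal O_A^r=\{[\overline{Au^{-t}}]:u\in U\}$; its span $\mathbb C\mathcal O_A^r=[A]\mathbb C U$ is a right $\mathbb C U$-module, whose character is an André–Yan supercharacter. $[A]\in\mathcal E$ is a verge if $A$ has at most one nonzero entry in each row and in each column; its main conditions are the positions of the nonzero entries of $A$. For $(i,j)\in\Phi^+$ the hook centered at $(i,j)$ is $h_{ij}=\{(i,k):j<k<i\}\cup\{(l,j):j<l<i\}\cup\{(i,j)\}$.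 A hook intersection is a position in $h_{ij}\cap h_{rs}$ for two distinct main conditions $(i,j),(r,s)$; it occurs exactly when (up to exchanging the two) $j<s<i<r$, and then $h_{ij}\cap h_{rs}=\{(i,s)\}$. One has $|\mathcal O_A^r|=q^a$ with $a=\sum_{\nu}(i_\nu-j_\nu-1)$, and $q^{a-b}$ is a lower bound for the dimensions of irreducible constituents of $\mathbb C\mathcal O_A^r$; an irreducible constituent of $\mathbb C\mathcal O_A^r$ has minimal dimension if its dimension equals $q^{a-b}$. Two main conditions $(i_\nu,j_\nu),(i_\mu,j_\mu)\in\mathfrak p$ are connected in $\mathfrak p$ if both: (i) $j_\nu=i_\mu$ or $j_\mu=i_\nu$; and (ii) there is $\rho\in\{1,\ldots,k\}$ such that $h_{i_\rho j_\rho}$ intersects both $h_{i_\nu j_\nu}$ and $h_{i_\mu j_\mu}$, each in precisely one position of $\Phi^+$. If there is no pair of connected main conditions in $\mathfrak p$, then $\mathfrak p$ is called hook disconnected. Set $\mathcal L=\{(i,j)\in\Phi^+: i\notin\{i_1,\ldots,i_k\}\}\cup\{(i_\nu,l): 1\leqslant\nu\leqslant k,\ 1\leqslant l\leqslant j_\nu\}$, $\mathcal L^\circ=\mathcal L\setminus\mathfrak p$, $\hat{\mathcal L}=\mathcal L\cup\{(r,i)\in\Phi^+:\ \exists\, j,s \text{ with } (i,j),(r,s)\in\mathfrak p,\ 1\leqslant j<s<i<r\leqslant n\}$, and $\hat{\mathcal L}^-=\hat{\mathcal L}\setminus\mathfrak p$. Let $I\subseteq\hat{\mathcal L}^-$ consist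 of $\mathcal L^\circ$ together with all positions $(i,d)\in\hat{\mathcal L}^-$ for which there exists $e$ with $(i,e),(e,d)\in\hat{\mathcal L}^-\setminus\mathcal L^\circ$. *)

theory Defs
  imports
    "HOL-Analysis.Analysis"
    "HOL-Algebra.Module"
    "HOL-Algebra.QuotRing"
begin

text \<open>
  The finite field is a type \<open>'f :: {field, finite}\<close> with \<open>q = CARD('f)\<close> elements.  The index set
  \<open>{1, \<dots>, n}\<close> is a finite linearly ordered type \<open>'n\<close> with \<open>n = CARD('n) \<ge> 1\<close>.
  The synonym \<open>sqmat\<close> is \<open>'f^'n^'n\<close>; the entry of \<open>M\<close> in row \<open>i\<close> and column \<open>j\<close> is \<open>M $ i $ j\<close>.
\<close>

type_synonym ('f, 'n) sqmat = "(('f, 'n) vec, 'n) vec"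

section \<open>Matrices, the group, and characters of the additive group\<close>

definition Phi_pos :: "('n::{finite,linorder} \<times> 'n) set" where
  "Phi_pos = {(i, j). j < i}"

definition strictly_lower :: "('f::{field,finite}, 'n::{finite,linorder}) sqmat set" where
  "strictly_lower = {A. \<forall>i j. (i, j) \<notin> Phi_pos \<longrightarrow> A $ i $ j = 0}"

definition unitri :: "('f::{field,finite}, 'n::{finite,linorder}) sqmat set" where
  "unitri = {u. u - mat 1 \<in> strictly_lower}"

definition trunc :: "('f::{field,finite}, 'n::{finite,linorder}) sqmat \<Rightarrow> ('f, 'n) sqmat" where
  "trunc M = (\<chi> i j. if (i, j) \<in> Phi_pos then M $ i $ j else 0)"

definition nontrivial_add_character :: "('f::{field,finite} \<Rightarrow> complex) \<Rightarrow> bool" where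
  "nontrivial_add_character \<theta> \<longleftrightarrow>
     (\<forall>x y. \<theta> (x + y) = \<theta> x * \<theta> y) \<and> (\<forall>x. \<theta> x \<noteq> 0) \<and> (\<exists>x. \<theta> x \<noteq> 1)"

definition chi :: "('f::{field,finite} \<Rightarrow> complex) \<Rightarrow> ('f, 'n::{finite,linorder}) sqmat \<Rightarrow> ('f, 'n) sqmat \<Rightarrow> complex" where
  "chi \<theta> A B = \<theta> (\<Sum>i\<in>UNIV. \<Sum>j\<in>UNIV. A $ i $ j * B $ i $ j)"

section \<open>The right module \<open>\<complex>\<E>\<close>\<close>

text \<open>
  Vectors live in \<open>complex ^ ('f, 'n) sqmat\<close>, which has a coordinate for every matrix; \<open>\<complex>\<E>\<close> is the
  subspace of the vectors supported on \<open>V\<close>, with basis the \<open>[A]\<close> for \<open>A \<in> V\<close>.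
  Only the right structure of the bimodule enters the statement.
\<close>

type_synonym ('f, 'n) evec = "(complex, ('f, 'n) sqmat) vec"

definition basis_elt :: "('f::{field,finite}, 'n::{finite,linorder}) sqmat \<Rightarrow> ('f, 'n) evec" where
  "basis_elt A = axis A 1"

definition CE :: "('f::{field,finite}, 'n::{finite,linorder}) evec set" where
  "CE = vec.span (basis_elt ` strictly_lower)"

text \<open>
  The linear extension of \<open>[A] u = \<chi>\<^sub>A(1 - u\<^sup>-\<^sup>1) [trunc (A u\<^sup>-\<^sup>t)]\<close>; coordinates outside \<open>V\<close>
  (which vanish on \<open>\<complex>\<E>\<close>) are ignored.
\<close>
definition right_act ::
  "('f::{field,finite} \<Rightarrow> complex) \<Rightarrow> ('f, 'n::{finite,linorder}) evec \<Rightarrow> ('f, 'n) sqmat \<Rightarrow> ('f, 'n) evec" where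
  "right_act \<theta> v u =
     (\<Sum>A\<in>strictly_lower.
        (v $ A * chi \<theta> A (mat 1 - matrix_inv u)) *s
          basis_elt (trunc (A ** transpose (matrix_inv u))))"

definition right_orbit :: "('f::{field,finite}, 'n::{finite,linorder}) sqmat \<Rightarrow> ('f, 'n) evec set" where
  "right_orbit A = {basis_elt (trunc (A ** transpose (matrix_inv u))) | u. u \<in> unitri}"

definition orbit_module :: "('f::{field,finite}, 'n::{finite,linorder}) sqmat \<Rightarrow> ('f, 'n) evec set" where
  "orbit_module A = vec.span (right_orbit A)"

section \<open>Right \<open>\<complex>U\<close>-modules\<close>

text \<open>
  All modules involved are submodules of \<open>\<complex>\<E>\<close>.  As \<open>\<complex>U\<close> is spanned by \<open>U\<close>, the \<open>\<complex>U\<close>-submodules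
  are the \<open>U\<close>-stable complex subspaces, and the \<open>\<complex>U\<close>-homomorphisms are the \<open>\<complex>\<close>-linear maps commuting
  with \<open>U\<close>.  Homomorphisms are extensional functions on the carrier, so that equality of
  homomorphisms is equality of functions.
\<close>

definition submodule_CE ::
  "('f::{field,finite} \<Rightarrow> complex) \<Rightarrow> ('f, 'n::{finite,linorder}) evec set \<Rightarrow> bool" where
  "submodule_CE \<theta> M \<longleftrightarrow> M \<subseteq> CE \<and> vec.subspace M \<and> (\<forall>v\<in>M. \<forall>u\<in>unitri. right_act \<theta> v u \<in> M)"

definition Hom_CU ::
  "('f::{field,finite} \<Rightarrow> complex) \<Rightarrow> ('f, 'n::{finite,linorder}) evec set \<Rightarrow> ('f, 'n) evec set
     \<Rightarrow> (('f, 'n) evec \<Rightarrow> ('f, 'n) evec) set" where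
  "Hom_CU \<theta> M N = {\<phi> \<in> M \<rightarrow>\<^sub>E N.
     (\<forall>x\<in>M. \<forall>y\<in>M. \<phi> (x + y) = \<phi> x + \<phi> y) \<and>
     (\<forall>c. \<forall>x\<in>M. \<phi> (c *s x) = c *s \<phi> x) \<and>
     (\<forall>x\<in>M. \<forall>u\<in>unitri. \<phi> (right_act \<theta> x u) = right_act \<theta> (\<phi> x) u)}"

definition iso_CU ::
  "('f::{field,finite} \<Rightarrow> complex) \<Rightarrow> (('f, 'n::{finite,linorder}) evec set \<times> ('f, 'n) evec set) set" where
  "iso_CU \<theta> = {(M, N). submodule_CE \<theta> M \<and> submodule_CE \<theta> N \<and>
     (\<exists>\<phi> \<in> Hom_CU \<theta> M N. bij_betw \<phi> M N)}"

definition irreducible_CU ::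
  "('f::{field,finite} \<Rightarrow> complex) \<Rightarrow> ('f, 'n::{finite,linorder}) evec set \<Rightarrow> bool" where
  "irreducible_CU \<theta> S \<longleftrightarrow> submodule_CE \<theta> S \<and> S \<noteq> {0} \<and>
     (\<forall>N. submodule_CE \<theta> N \<and> N \<subseteq> S \<longrightarrow> N = {0} \<or> N = S)"

text \<open>
  \<open>\<complex>U\<close> is semisimple, so the irreducible constituents of a module are, up to isomorphism, its
  irreducible submodules.  Different elements of this set may be isomorphic.
\<close>
definition irr_constituents ::
  "('f::{field,finite} \<Rightarrow> complex) \<Rightarrow> ('f, 'n::{finite,linorder}) evec set \<Rightarrow> ('f, 'n) evec set set" where
  "irr_constituents \<theta> M = {S. irreducible_CU \<theta> S \<and> S \<subseteq> M}"

definition constituents_of_dim ::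
  "('f::{field,finite} \<Rightarrow> complex) \<Rightarrow> ('f, 'n::{finite,linorder}) evec set \<Rightarrow> nat \<Rightarrow> ('f, 'n) evec set set" where
  "constituents_of_dim \<theta> M d = {S \<in> irr_constituents \<theta> M. vec.dim S = d}"

definition irr_decomposition ::
  "('f::{field,finite} \<Rightarrow> complex) \<Rightarrow> ('f, 'n::{finite,linorder}) evec set \<Rightarrow> ('f, 'n) evec set set \<Rightarrow> bool" where
  "irr_decomposition \<theta> M \<D> \<longleftrightarrow> finite \<D> \<and> \<D> \<subseteq> irr_constituents \<theta> M \<and>
     (\<forall>x\<in>M. \<exists>!f. f \<in> (\<Pi>\<^sub>E S\<in>\<D>. S) \<and> x = (\<Sum>S\<in>\<D>. f S))"

text \<open>
  The multiplicity is the number of summands isomorphic to \<open>S\<close> in a decomposition into a direct sum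
  of irreducibles; the predicate includes that a decomposition exists and that the number does not
  depend on its choice.
\<close>
definition has_multiplicity ::
  "('f::{field,finite} \<Rightarrow> complex) \<Rightarrow> ('f, 'n::{finite,linorder}) evec set \<Rightarrow> ('f, 'n) evec set \<Rightarrow> nat \<Rightarrow> bool" where
  "has_multiplicity \<theta> S M m \<longleftrightarrow>
     (\<exists>\<D>. irr_decomposition \<theta> M \<D>) \<and>
     (\<forall>\<D>. irr_decomposition \<theta> M \<D> \<longrightarrow> card {T \<in> \<D>. (S, T) \<in> iso_CU \<theta>} = m)"

text \<open>
  The number of non-isomorphic modules in a set of submodules of \<open>\<complex>\<E>\<close>: isomorphism is an
  equivalence relation on all submodules of \<open>\<complex>\<E>\<close>, and we count the classes met by \<open>X\<close>.
\<close>
definition num_iso_classes ::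
  "('f::{field,finite} \<Rightarrow> complex) \<Rightarrow> ('f, 'n::{finite,linorder}) evec set set \<Rightarrow> nat" where
  "num_iso_classes \<theta> X = card (X // iso_CU \<theta>)"

definition End_CU ::
  "('f::{field,finite} \<Rightarrow> complex) \<Rightarrow> ('f, 'n::{finite,linorder}) evec set
     \<Rightarrow> (complex, ('f, 'n) evec \<Rightarrow> ('f, 'n) evec) module" where
  "End_CU \<theta> M =
     \<lparr> carrier = Hom_CU \<theta> M M,
       monoid.mult = compose M,
       one = restrict (\<lambda>x. x) M,
       zero = restrict (\<lambda>x. 0) M,
       add = (\<lambda>\<phi> \<psi>. restrict (\<lambda>x. \<phi> x + \<psi> x) M),
       smult = (\<lambda>c \<phi>. restrict (\<lambda>x. c *s \<phi> x) M) \<rparr>"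

definition algebra_isomorphic :: "('k, 'a) module \<Rightarrow> ('k, 'b) module \<Rightarrow> bool" where
  "algebra_isomorphic R S \<longleftrightarrow>
     (\<exists>h \<in> ring_iso R S. \<forall>c. \<forall>x\<in>carrier R. h (c \<odot>\<^bsub>R\<^esub> x) = c \<odot>\<^bsub>S\<^esub> h x)"

section \<open>Verges and hooks\<close>

text \<open>
  Positions are pairs (row, column).  The functions below take a set \<open>p\<close> of positions; they are
  meant for the set of main conditions of a verge.
\<close>

definition main_conditions :: "('f::{field,finite}, 'n::{finite,linorder}) sqmat \<Rightarrow> ('n \<times> 'n) set" where
  "main_conditions A = {(i, j). A $ i $ j \<noteq> 0}"

definition verge :: "('f::{field,finite}, 'n::{finite,linorder}) sqmat \<Rightarrow> bool" where
  "verge A \<longleftrightarrow> A \<in> strictly_lower \<and>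
     (\<forall>i j j'. A $ i $ j \<noteq> 0 \<and> A $ i $ j' \<noteq> 0 \<longrightarrow> j = j') \<and>
     (\<forall>i i' j. A $ i $ j \<noteq> 0 \<and> A $ i' $ j \<noteq> 0 \<longrightarrow> i = i')"

fun hook :: "'n::{finite,linorder} \<times> 'n \<Rightarrow> ('n \<times> 'n) set" where
  "hook (i, j) = {(i, k) | k. j < k \<and> k < i} \<union> {(l, j) | l. j < l \<and> l < i} \<union> {(i, j)}"

definition hook_intersections :: "('n::{finite,linorder} \<times> 'n) set \<Rightarrow> ('n \<times> 'n) set" where
  "hook_intersections p = (\<Union>x\<in>p. \<Union>y\<in>p - {x}. hook x \<inter> hook y)"

definition connected_in ::
  "('n::{finite,linorder} \<times> 'n) set \<Rightarrow> 'n \<times> 'n \<Rightarrow> 'n \<times> 'n \<Rightarrow> bool" where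
  "connected_in p x y \<longleftrightarrow>
     (snd x = fst y \<or> snd y = fst x) \<and>
     (\<exists>z\<in>p. card (hook z \<inter> hook x) = 1 \<and> card (hook z \<inter> hook y) = 1)"

definition hook_disconnected :: "('n::{finite,linorder} \<times> 'n) set \<Rightarrow> bool" where
  "hook_disconnected p \<longleftrightarrow> \<not> (\<exists>x\<in>p. \<exists>y\<in>p. x \<noteq> y \<and> connected_in p x y)"

definition L_set :: "('n::{finite,linorder} \<times> 'n) set \<Rightarrow> ('n \<times> 'n) set" where
  "L_set p = {(i, j) \<in> Phi_pos. i \<notin> fst ` p} \<union> {(i, l) | i l. \<exists>j. (i, j) \<in> p \<and> l \<le> j}"

definition L_circ :: "('n::{finite,linorder} \<times> 'n) set \<Rightarrow> ('n \<times> 'n) set" where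
  "L_circ p = L_set p - p"

definition L_hat :: "('n::{finite,linorder} \<times> 'n) set \<Rightarrow> ('n \<times> 'n) set" where
  "L_hat p = L_set p \<union>
     {(r, i) \<in> Phi_pos. \<exists>j s. (i, j) \<in> p \<and> (r, s) \<in> p \<and> j < s \<and> s < i \<and> i < r}"

definition L_hat_minus :: "('n::{finite,linorder} \<times> 'n) set \<Rightarrow> ('n \<times> 'n) set" where
  "L_hat_minus p = L_hat p - p"

definition I_set :: "('n::{finite,linorder} \<times> 'n) set \<Rightarrow> ('n \<times> 'n) set" where
  "I_set p = L_circ p \<union>
     {(i, d) \<in> L_hat_minus p.
        \<exists>e. (i, e) \<in> L_hat_minus p - L_circ p \<and> (e, d) \<in> L_hat_minus p - L_circ p}"

end

theory Submission
  imports Defs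
begin

text \<open>
  Replace \<open>u\<close> by \<open>g = u\<^sup>-\<^sup>1\<close> throughout.  An endomorphism of the orbit module of \<open>A\<close> is determined by
  the image of \<open>[A]\<close>, which must be an eigenvector of the stabiliser of \<open>[A]\<close>; comparing characters on
  root subgroups shows that it is supported on the matrices that differ from \<open>A\<close> only at hook
  intersections, and these form the orbit of \<open>A\<close> under the left action of the pattern group \<open>H\<close> of
  \<open>L_hat p\<close>.  So the endomorphism algebra is spanned by \<open>H\<close>, in which the pattern group \<open>K\<close> of \<open>L_set p\<close>
  acts by the linear character \<open>\<lambda>\<close> of \<open>[A]\<close>, and \<open>H / K\<close> permutes the basis freely.  Computing the
  dimension of a submodule as the trace of an orthogonal projection, the submodules of dimension
  \<open>q ^ (a - b)\<close> turn out to be the eigenspaces of the linear characters of \<open>H\<close> that extend \<open>\<lambda>\<close>.  Such an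
  extension exists iff no main condition is a composite of two positions in \<open>L_hat p\<close>, which is
  hook disconnectedness, and the extensions are then parametrised by the values at the positions of
  \<open>L_hat p - L_set p\<close> that are not composite.  Finally, diagonal conjugation acts transitively on the
  verges with main conditions \<open>p\<close> and identifies their endomorphism algebras.
\<close>

section \<open>Hermitian inner product and orthogonal projections\<close>

text \<open>The constant \<open>q ^ (a - b)\<close> comes from double centralisers. Since
  \<open>H / K\<close> has order \<open>q ^ b\<close> and moves the basis of the orbit module
  freely, that module is a sum of \<open>q ^ (a - b)\<close> copies of the representation of
  \<open>H\<close> induced from \<lambda>. An irreducible representation of \<open>H\<close> above
  \<lambda> of dimension \<open>d\<close> therefore belongs to a constituent of dimension
  \<open>q ^ (a - b) * d\<close>, and minimal dimension means \<open>d = 1\<close>. The proof avoids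
  this correspondence. Unitary monomial operators move the basis of the orbit module transitively up
  to phases, so a submodule \<open>S\<close> has dimension \<open>q ^ a\<close> times the squared
  length of the projection of \<open>[A]\<close> to \<open>S\<close>, and dimensions turn into norms
  of a single vector. Unitarity also supplies complements and equivariant projections. The main fact
  used about endomorphisms is that each of them is a scalar on any submodule where \<open>H\<close>
  acts by scalars; irreducibility of the eigenspaces, their inequivalence and multiplicity one rest
  on it.\<close>

definition herm :: "complex ^ 'm::finite \<Rightarrow> complex ^ 'm \<Rightarrow> complex" where
  "herm v w = (\<Sum>i\<in>UNIV. v $ i * cnj (w $ i))"

definition nsq :: "complex ^ 'm::finite \<Rightarrow> real" where
  "nsq v = (\<Sum>i\<in>UNIV. (cmod (v $ i))\<^sup>2)"

lemma herm_add_left: "herm (x + y) z = herm x z + herm y z"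
  by (simp add: herm_def algebra_simps sum.distrib)

lemma herm_add_right: "herm z (x + y) = herm z x + herm z y"
  by (simp add: herm_def algebra_simps sum.distrib)

lemma herm_diff_left: "herm (x - y) z = herm x z - herm y z"
  by (simp add: herm_def algebra_simps sum_subtractf)

lemma herm_diff_right: "herm z (x - y) = herm z x - herm z y"
  by (simp add: herm_def algebra_simps sum_subtractf)

lemma herm_smult_left: "herm (c *s x) z = c * herm x z"
  by (simp add: herm_def algebra_simps sum_distrib_left)

lemma herm_smult_right: "herm z (c *s x) = cnj c * herm z x"
  by (simp add: herm_def algebra_simps sum_distrib_left)

lemma herm_zero [simp]: "herm 0 x = 0" "herm x 0 = 0"
  by (simp_all add: herm_def)

lemma herm_sum_left: "herm (\<Sum>a\<in>S. f a) z = (\<Sum>a\<in>S. herm (f a) z)"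
  by (induction S rule: infinite_finite_induct) (simp_all add: herm_add_left)

lemma herm_commute: "herm y x = cnj (herm x y)"
  by (simp add: herm_def mult.commute)

lemma herm_self: "herm x x = complex_of_real (nsq x)"
  by (simp add: herm_def nsq_def complex_norm_square [symmetric])

lemma nsq_nonneg: "nsq x \<ge> 0"
  by (simp add: nsq_def sum_nonneg)

lemma nsq_eq_0_iff: "nsq x = 0 \<longleftrightarrow> x = 0"
  by (auto simp: nsq_def sum_nonneg_eq_0_iff vec_eq_iff)

lemma herm_self_eq_0_iff: "herm x x = 0 \<longleftrightarrow> x = 0"
  by (simp add: herm_self nsq_eq_0_iff)

lemma nsq_smult: "nsq (c *s x) = (cmod c)\<^sup>2 * nsq x"
  by (simp add: nsq_def norm_mult power_mult_distrib sum_distrib_left)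

lemma nsq_Pythagoras:
  assumes "herm x y = 0" shows "nsq (x + y) = nsq x + nsq y"
proof -
  have "herm y x = 0" using herm_commute[of y x] assms by simp
  then have "complex_of_real (nsq (x + y)) = complex_of_real (nsq x + nsq y)"
    using assms by (simp add: herm_self [symmetric] herm_add_left herm_add_right)
  then show ?thesis using of_real_eq_iff by blast
qed

text \<open>Splitting \<open>x\<close> into its component along \<open>y\<close> and the orthogonal
  remainder turns the inequality into an identity. The remainder term is kept because its vanishing
  is the equality case, \<open>herm_Cauchy_Schwarz_eq\<close>.\<close>

lemma herm_Cauchy_Schwarz_strong:
  assumes "y \<noteq> 0"
  shows "nsq x * nsq y = (cmod (herm x y))\<^sup>2 + nsq y * nsq (x - (herm x y / nsq y) *s y)"
proof -
  define c where "c = herm x y / nsq y"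
  have ny: "nsq y \<noteq> 0" using assms nsq_eq_0_iff by blast
  have "herm y (x - c *s y) = 0"
    using ny by (simp add: herm_diff_right herm_smult_right herm_self c_def herm_commute [of y x])
  then have "herm (c *s y) (x - c *s y) = 0" by (simp add: herm_smult_left)
  from nsq_Pythagoras [OF this] have "nsq x = (cmod c)\<^sup>2 * nsq y + nsq (x - c *s y)"
    using nsq_smult [of c y] by simp
  moreover have "cmod c = cmod (herm x y) / nsq y"
    using nsq_nonneg [of y] by (simp add: c_def norm_divide)
  ultimately show ?thesis using ny by (simp add: field_simps power2_eq_square flip: c_def)
qed

lemma herm_Cauchy_Schwarz: "(cmod (herm x y))\<^sup>2 \<le> nsq x * nsq y"
proof (cases "y = 0")
  case True then show ?thesis by (simp add: nsq_def)
next
  case False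
  show ?thesis
    unfolding herm_Cauchy_Schwarz_strong [OF False] by (simp add: nsq_nonneg)
qed

lemma herm_Cauchy_Schwarz_eq:
  assumes "y \<noteq> 0" "(cmod (herm x y))\<^sup>2 = nsq x * nsq y"
  shows "x = (herm x y / nsq y) *s y"
proof -
  have "nsq y * nsq (x - (herm x y / nsq y) *s y) = 0"
    using herm_Cauchy_Schwarz_strong [OF assms(1), of x] assms(2) by simp
  then show ?thesis using assms(1) by (simp add: nsq_eq_0_iff)
qed

definition orthonormal :: "(complex ^ 'm::finite) set \<Rightarrow> bool" where
  "orthonormal B \<longleftrightarrow> (\<forall>x\<in>B. \<forall>y\<in>B. herm x y = (if x = y then 1 else 0))"

lemma orthonormal_independent:
  assumes "orthonormal B" shows "vec.independent B"
proof
  assume "vec.dependent B"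
  then obtain t u where t: "finite t" "t \<subseteq> B" "(\<Sum>v\<in>t. u v *s v) = 0" "\<exists>v\<in>t. u v \<noteq> 0"
    unfolding vec.dependent_explicit by blast
  then obtain b where b: "b \<in> t" "u b \<noteq> 0" by blast
  have "0 = herm (\<Sum>v\<in>t. u v *s v) b" using t by simp
  also have "\<dots> = (\<Sum>v\<in>t. if v = b then u v else 0)"
    unfolding herm_sum_left herm_smult_left using assms t b
    by (intro sum.cong) (auto simp: orthonormal_def subset_iff)
  also have "\<dots> = u b" using b t by simp
  finally show False using b by simp
qed

text \<open>An orthonormal set of largest size spans: one Gram-Schmidt step applied to a vector
  outside its span would enlarge it.\<close>

lemma orthonormal_basis_exists:
  fixes S :: "(complex ^ 'm::finite) set"
  assumes S: "vec.subspace S"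
  shows "\<exists>B. finite B \<and> B \<subseteq> S \<and> orthonormal B \<and> vec.span B = S \<and> card B = vec.dim S"
proof -
  define P where "P B \<longleftrightarrow> B \<subseteq> S \<and> orthonormal B" for B
  have fin: "finite B" if "P B" for B
    using that unfolding P_def by (intro vec.finiteI_independent orthonormal_independent) simp
  have bnd: "card B \<le> vec.dim S" if "P B" for B
    using that unfolding P_def by (intro vec.independent_card_le_dim orthonormal_independent) simp_all
  have "P {}" by (simp add: P_def orthonormal_def)
  then obtain B where B: "P B" "\<And>B'. P B' \<Longrightarrow> card B' \<le> card B"
    using ex_has_greatest_nat [of P "{}" card "Suc (vec.dim S)"] bnd le_imp_less_Suc by metis
  have "x \<in> vec.span B" if "x \<in> S" for x
  proof (rule ccontr)
    assume x: "x \<notin> vec.span B"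
    define y where "y = x - (\<Sum>b\<in>B. herm x b *s b)"
    have sp: "(\<Sum>b\<in>B. herm x b *s b) \<in> vec.span B"
      by (intro vec.span_sum vec.span_scale vec.span_base)
    then have y0: "y \<noteq> 0" using x by (auto simp: y_def)
    have "vec.span B \<subseteq> S" using B S vec.span_minimal unfolding P_def by blast
    then have yS: "y \<in> S" unfolding y_def using that sp S by (intro vec.subspace_diff) auto
    have orth: "herm y b = 0" if "b \<in> B" for b
    proof -
      have "(\<Sum>a\<in>B. herm x a * herm a b) = (\<Sum>a\<in>B. if a = b then herm x a else 0)"
        using B(1) that by (intro sum.cong) (auto simp: P_def orthonormal_def)
      also have "\<dots> = herm x b" using that fin [OF B(1)] by simp
      finally show ?thesis
        by (simp add: y_def herm_diff_left herm_sum_left herm_smult_left)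
    qed
    define z where "z = complex_of_real (1 / sqrt (nsq y)) *s y"
    have ny: "nsq y > 0" using y0 nsq_eq_0_iff nsq_nonneg by (metis less_eq_real_def)
    have zz: "herm z z = 1"
      using ny by (simp add: herm_self z_def nsq_smult norm_divide power_divide)
    have zb: "herm z b = 0" "herm b z = 0" if "b \<in> B" for b
      using orth [OF that] herm_commute [of b y]
      by (simp_all add: z_def herm_smult_left herm_smult_right)
    have "z \<notin> B" using zb(1) [of z] zz by auto
    moreover have "P (insert z B)"
      using B(1) zz zb yS S unfolding P_def orthonormal_def
      by (auto simp: z_def intro: vec.subspace_scale)
    ultimately show False using B(2) [of "insert z B"] fin [OF B(1)] by simp
  qed
  moreover have "vec.span B \<subseteq> S" using B S vec.span_minimal unfolding P_def by blast
  ultimately have "vec.span B = S" by blast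
  moreover from this have "card B = vec.dim S"
    using vec.dim_span_eq_card_independent [OF orthonormal_independent, of B] B(1) unfolding P_def by simp
  ultimately show ?thesis using B(1) fin unfolding P_def by blast
qed

definition ortho_basis :: "(complex ^ 'm::finite) set \<Rightarrow> (complex ^ 'm) set" where
  "ortho_basis S = (SOME B. finite B \<and> B \<subseteq> S \<and> orthonormal B \<and> vec.span B = S \<and> card B = vec.dim S)"

text \<open>For a subspace \<open>S\<close>, \<open>proj_unique\<close> shows that the value depends
  on \<open>S\<close> alone and not on the chosen basis; this is how \<open>proj\<close> comes to
  commute with unitary operators preserving \<open>S\<close>.\<close>

definition proj :: "(complex ^ 'm::finite) set \<Rightarrow> complex ^ 'm \<Rightarrow> complex ^ 'm" where
  "proj S x = (\<Sum>b\<in>ortho_basis S. herm x b *s b)"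

lemma ortho_basis:
  assumes "vec.subspace S"
  shows "finite (ortho_basis S)" "ortho_basis S \<subseteq> S" "orthonormal (ortho_basis S)"
    "vec.span (ortho_basis S) = S" "card (ortho_basis S) = vec.dim S"
  using someI_ex [OF orthonormal_basis_exists [OF assms]] unfolding ortho_basis_def by blast+

lemma proj_add: "proj S (x + y) = proj S x + proj S y"
  by (simp add: proj_def herm_add_left vec.scale_left_distrib sum.distrib)

lemma proj_smult: "proj S (c *s x) = c *s proj S x"
  by (simp add: proj_def herm_smult_left vec.scale_sum_right)

lemma proj_in:
  assumes "vec.subspace S" shows "proj S x \<in> S"
  unfolding proj_def using assms ortho_basis(2) [OF assms]
  by (intro vec.subspace_sum vec.subspace_scale) auto

lemma proj_orth:
  assumes S: "vec.subspace S" and s: "s \<in> S" shows "herm (x - proj S x) s = 0"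
proof -
  have *: "herm (x - proj S x) b = 0" if "b \<in> ortho_basis S" for b
  proof -
    have "(\<Sum>a\<in>ortho_basis S. herm x a * herm a b) = (\<Sum>a\<in>ortho_basis S. if a = b then herm x a else 0)"
      using ortho_basis(3) [OF S] that by (intro sum.cong) (auto simp: orthonormal_def)
    also have "\<dots> = herm x b" using that ortho_basis(1) [OF S] by simp
    finally show ?thesis by (simp add: proj_def herm_diff_left herm_sum_left herm_smult_left)
  qed
  have "vec.subspace {s. herm (x - proj S x) s = 0}"
    by (rule vec.subspaceI) (auto simp: herm_add_right herm_smult_right)
  then have "vec.span (ortho_basis S) \<subseteq> {s. herm (x - proj S x) s = 0}"
    using * by (intro vec.span_minimal) auto
  then show ?thesis using s ortho_basis(4) [OF S] by blast
qed

lemma proj_unique: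
  assumes S: "vec.subspace S" and "y \<in> S" and "\<And>s. s \<in> S \<Longrightarrow> herm (x - y) s = 0"
  shows "proj S x = y"
proof -
  define d where "d = proj S x - y"
  have "d \<in> S" unfolding d_def using assms proj_in vec.subspace_diff by blast
  then have "herm (x - y) d = 0" "herm (x - proj S x) d = 0"
    using assms proj_orth by blast+
  then have "herm ((x - y) - (x - proj S x)) d = 0" by (simp only: herm_diff_left [of "x - y"]) simp
  moreover have "(x - y) - (x - proj S x) = d" by (simp add: d_def)
  ultimately have "herm d d = 0" by simp
  then show ?thesis by (simp add: herm_self_eq_0_iff d_def)
qed

lemma proj_id: "vec.subspace S \<Longrightarrow> x \<in> S \<Longrightarrow> proj S x = x"
  by (rule proj_unique) auto

lemma herm_proj_proj:
  assumes "vec.subspace S"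
  shows "herm (proj S x) (proj S y) = herm (proj S x) y"
proof -
  have "herm (y - proj S y) (proj S x) = 0" using assms proj_in proj_orth by blast
  then have "herm (proj S x) (y - proj S y) = 0"
    using herm_commute [of "proj S x" "y - proj S y"] by simp
  then show ?thesis by (simp add: herm_diff_right)
qed

lemma nsq_proj:
  assumes "vec.subspace S"
  shows "complex_of_real (nsq (proj S x)) = herm (proj S x) x"
  using herm_proj_proj [OF assms] by (simp add: herm_self [symmetric])

lemma nsq_proj_le:
  assumes "vec.subspace S" shows "nsq x = nsq (proj S x) + nsq (x - proj S x)"
proof -
  have "herm (x - proj S x) (proj S x) = 0" using assms proj_in proj_orth by blast
  from nsq_Pythagoras [OF this] show ?thesis by simp
qed

lemma herm_axis_right: "herm v (axis i 1) = v $ i"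
proof -
  have "herm v (axis i 1) = (\<Sum>j\<in>UNIV. if j = i then v $ j else 0)"
    unfolding herm_def by (intro sum.cong) (auto simp: axis_def)
  then show ?thesis by simp
qed

lemma herm_axis_left: "herm (axis i 1) v = cnj (v $ i)"
  using herm_commute [of "axis i 1" v] by (simp add: herm_axis_right)

text \<open>The trace of an orthogonal projection is its rank.\<close>

lemma dim_eq_sum_nsq_proj:
  fixes S :: "(complex ^ 'm::finite) set"
  assumes S: "vec.subspace S" and supp: "\<And>v i. v \<in> S \<Longrightarrow> i \<notin> X \<Longrightarrow> v $ i = 0"
  shows "real (vec.dim S) = (\<Sum>i\<in>X. nsq (proj S (axis i 1)))"
proof -
  have "complex_of_real (\<Sum>i\<in>X. nsq (proj S (axis i 1))) = (\<Sum>i\<in>X. proj S (axis i 1) $ i)"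
    by (simp add: nsq_proj [OF S] herm_axis_right)
  also have "\<dots> = (\<Sum>i\<in>X. \<Sum>b\<in>ortho_basis S. b $ i * cnj (b $ i))"
    by (intro sum.cong refl) (simp add: proj_def herm_axis_left sum_component mult.commute)
  also have "\<dots> = (\<Sum>b\<in>ortho_basis S. \<Sum>i\<in>X. b $ i * cnj (b $ i))" by (rule sum.swap)
  also have "\<dots> = (\<Sum>b\<in>ortho_basis S. herm b b)"
    unfolding herm_def using ortho_basis(2) [OF S] supp
    by (intro sum.cong refl sum.mono_neutral_left) auto
  also have "\<dots> = (\<Sum>b\<in>ortho_basis S. 1)"
    using ortho_basis(3) [OF S] by (intro sum.cong) (auto simp: orthonormal_def)
  also have "\<dots> = of_nat (vec.dim S)" using ortho_basis(5) [OF S] by simp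
  finally have "complex_of_real (\<Sum>i\<in>X. nsq (proj S (axis i 1))) = complex_of_real (real (vec.dim S))"
    by simp
  then show ?thesis using of_real_eq_iff by metis
qed

section \<open>The bimodule by monomial operators\<close>

definition supported :: "'m set \<Rightarrow> (complex ^ 'm::finite) set" where
  "supported V = {v. \<forall>i. i \<notin> V \<longrightarrow> v $ i = 0}"

text \<open>Sends the basis vector at \<open>i\<close> in \<open>V\<close> to \<open>c i\<close>
  times the one at \<open>f i\<close> and ignores coordinates outside \<open>V\<close>. Both module
  actions are operators of this kind, so composition and unitarity are proved once.\<close>

definition monomial ::
  "'m set \<Rightarrow> ('m \<Rightarrow> 'm) \<Rightarrow> ('m \<Rightarrow> complex) \<Rightarrow> complex ^ 'm::finite \<Rightarrow> complex ^ 'm" where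
  "monomial V f c v = (\<Sum>i\<in>V. (v $ i * c i) *s axis (f i) 1)"

lemma supported_mono: "V \<subseteq> W \<Longrightarrow> supported V \<subseteq> supported W"
  by (auto simp: supported_def)

lemma supported_subspace: "vec.subspace (supported V)"
  by (rule vec.subspaceI) (auto simp: supported_def)

lemma axis_in_supported: "i \<in> V \<Longrightarrow> axis i 1 \<in> supported V"
  by (auto simp: supported_def axis_def)

lemma supported_expand:
  assumes "v \<in> supported V" shows "v = (\<Sum>i\<in>V. v $ i *s axis i 1)"
proof (rule vec_eq_iff [THEN iffD2], rule allI)
  fix j
  have "(\<Sum>i\<in>V. (v $ i *s axis i 1) $ j) = (\<Sum>i\<in>V. if i = j then v $ i else 0)"
    by (intro sum.cong) (auto simp: axis_def)
  also have "\<dots> = v $ j" using assms by (auto simp: supported_def)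
  finally show "v $ j = (\<Sum>i\<in>V. v $ i *s axis i 1) $ j" by (simp add: sum_component)
qed

lemma span_axis: "vec.span ((\<lambda>i. axis i 1) ` V) = supported V"
proof
  show "vec.span ((\<lambda>i. axis i 1) ` V) \<subseteq> supported V"
    using supported_subspace axis_in_supported by (intro vec.span_minimal) auto
  show "supported V \<subseteq> vec.span ((\<lambda>i. axis i 1) ` V)"
  proof
    fix v :: "complex ^ 'a" assume "v \<in> supported V"
    then have "v = (\<Sum>i\<in>V. v $ i *s axis i 1)" by (rule supported_expand)
    also have "\<dots> \<in> vec.span ((\<lambda>i. axis i 1) ` V)"
      by (intro vec.span_sum vec.span_scale vec.span_base) auto
    finally show "v \<in> vec.span ((\<lambda>i. axis i 1) ` V)" .
  qed
qed

lemma monomial_add: "monomial V f c (v + w) = monomial V f c v + monomial V f c w"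
  by (simp add: monomial_def algebra_simps vec.scale_left_distrib sum.distrib)

lemma monomial_smult: "monomial V f c (a *s v) = a *s monomial V f c v"
  by (simp add: monomial_def vec.scale_sum_right algebra_simps)

lemma monomial_zero: "monomial V f c 0 = 0"
  using monomial_smult [of V f c 0 0] by simp

lemma monomial_sum: "monomial V f c (\<Sum>a\<in>S. h a) = (\<Sum>a\<in>S. monomial V f c (h a))"
  by (induction S rule: infinite_finite_induct) (simp_all add: monomial_add monomial_zero)

lemma monomial_diff: "monomial V f c (v - w) = monomial V f c v - monomial V f c w"
  using monomial_add [of V f c "v - w" w] by (simp add: algebra_simps)

lemma monomial_axis:
  assumes "i \<in> V" shows "monomial V f c (axis i 1) = c i *s axis (f i) 1"
proof -
  have "monomial V f c (axis i 1) = (\<Sum>j\<in>V. if j = i then c i *s axis (f i) 1 else 0)"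
    unfolding monomial_def by (intro sum.cong refl) (auto simp: axis_def)
  then show ?thesis using assms by simp
qed

lemma monomial_cong:
  assumes "\<And>i. i \<in> V \<Longrightarrow> f i = f' i" "\<And>i. i \<in> V \<Longrightarrow> c i = c' i"
  shows "monomial V f c v = monomial V f' c' v"
  unfolding monomial_def using assms by (intro sum.cong) auto

lemma monomial_in_supported:
  assumes "f ` V \<subseteq> V" shows "monomial V f c v \<in> supported V"
  unfolding monomial_def using assms
  by (intro vec.subspace_sum vec.subspace_scale supported_subspace axis_in_supported) auto

lemma monomial_comp:
  assumes "f' ` V \<subseteq> V"
  shows "monomial V f c (monomial V f' c' v) = monomial V (\<lambda>i. f (f' i)) (\<lambda>i. c' i * c (f' i)) v"
proof -
  have "monomial V f c (monomial V f' c' v)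
      = (\<Sum>i\<in>V. (v $ i * c' i) *s monomial V f c (axis (f' i) 1))"
    unfolding monomial_def [of V f' c' v] by (simp add: monomial_sum monomial_smult)
  also have "\<dots> = (\<Sum>i\<in>V. (v $ i * (c' i * c (f' i))) *s axis (f (f' i)) 1)"
    using assms by (intro sum.cong refl) (subst monomial_axis, auto simp: mult.assoc)
  finally show ?thesis by (simp add: monomial_def)
qed

lemma monomial_id: "v \<in> supported V \<Longrightarrow> monomial V (\<lambda>i. i) (\<lambda>i. 1) v = v"
  unfolding monomial_def by (simp add: supported_expand [symmetric])

lemma monomial_component:
  assumes "inj_on f V" "i \<in> V" shows "monomial V f c v $ (f i) = v $ i * c i"
proof -
  have "monomial V f c v $ (f i) = (\<Sum>j\<in>V. if j = i then v $ i * c i else 0)"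
    unfolding monomial_def sum_component
    using assms by (intro sum.cong refl) (auto simp: axis_def inj_on_def)
  then show ?thesis using assms by simp
qed

text \<open>An injective self-map of the finite set \<open>V\<close> permutes it and the scalars
  have modulus one, so coordinates are only permuted and rotated. Coordinates of \<open>w\<close>
  outside \<open>V\<close> meet zeros of \<open>v\<close>.\<close>

lemma herm_monomial:
  assumes f: "inj_on f V" "f ` V \<subseteq> V" and c: "\<And>i. i \<in> V \<Longrightarrow> cmod (c i) = 1"
    and w: "v \<in> supported V"
  shows "herm (monomial V f c v) (monomial V f c w) = herm v w"
proof -
  have fV: "f ` V = V" using f by (simp add: endo_inj_surj)
  have "herm (monomial V f c v) (monomial V f c w)
      = (\<Sum>j\<in>V. monomial V f c v $ j * cnj (monomial V f c w $ j))"
    unfolding herm_def using monomial_in_supported [OF f(2), of c v]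
    by (intro sum.mono_neutral_right) (auto simp: supported_def)
  also have "\<dots> = (\<Sum>i\<in>V. monomial V f c v $ f i * cnj (monomial V f c w $ f i))"
    by (subst fV [symmetric], subst sum.reindex [OF f(1)]) simp
  also have "\<dots> = (\<Sum>i\<in>V. v $ i * cnj (w $ i))"
  proof (intro sum.cong refl)
    fix i assume i: "i \<in> V"
    have "c i * cnj (c i) = 1" using c [OF i] by (simp add: complex_norm_square [symmetric])
    then show "monomial V f c v $ f i * cnj (monomial V f c w $ f i) = v $ i * cnj (w $ i)"
      by (simp add: monomial_component [OF f(1) i] algebra_simps)
  qed
  also have "\<dots> = herm v w"
    unfolding herm_def using w by (intro sum.mono_neutral_left) (auto simp: supported_def)
  finally show ?thesis .
qed

section \<open>The unitriangular group inside the square matrices\<close>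

lemma mat1_nth: "mat 1 $ i $ j = (if i = j then 1 else 0)"
  by (simp add: mat_def)

lemma strictly_lower_nth: "A \<in> strictly_lower \<longleftrightarrow> (\<forall>i j. i \<le> j \<longrightarrow> A $ i $ j = 0)"
  unfolding strictly_lower_def Phi_pos_def by (auto simp flip: not_less)

lemma unitri_nth: "u \<in> unitri \<longleftrightarrow> (\<forall>i j. i \<le> j \<longrightarrow> u $ i $ j = (if i = j then 1 else 0))"
  by (simp add: unitri_def strictly_lower_nth mat1_nth)

lemma trunc_nth: "trunc M $ i $ j = (if j < i then M $ i $ j else 0)"
  by (simp add: trunc_def Phi_pos_def)

lemma trunc_strictly_lower: "trunc M \<in> strictly_lower"
  by (auto simp: strictly_lower_nth trunc_nth)

lemma trunc_id: "A \<in> strictly_lower \<Longrightarrow> trunc A = A"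
  by (auto simp: strictly_lower_nth trunc_nth vec_eq_iff not_less)

lemma unitri_one: "mat 1 \<in> unitri"
  by (simp add: unitri_nth mat1_nth)

lemma mult_nth: "(A ** B) $ i $ j = (\<Sum>k\<in>UNIV. A $ i $ k * B $ k $ j)"
  by (simp add: matrix_matrix_mult_def)

lemma unitri_mult:
  assumes "u \<in> unitri" "v \<in> unitri" shows "u ** v \<in> unitri"
  unfolding unitri_nth
proof (intro allI impI)
  fix i j :: 'b assume ij: "i \<le> j"
  have "(u ** v) $ i $ j = (\<Sum>k\<in>UNIV. if k = i then (if i = j then 1 else 0) else 0)"
    unfolding mult_nth
  proof (intro sum.cong refl)
    fix k
    show "u $ i $ k * v $ k $ j = (if k = i then (if i = j then 1 else 0) else 0)"
      using assms ij unfolding unitri_nth by (cases k i rule: linorder_cases) auto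
  qed
  then show "(u ** v) $ i $ j = (if i = j then 1 else 0)" by simp
qed

text \<open>In the first row where \<open>v\<close> and \<open>w\<close> differ, rows above agree
  and rows below do not enter, so the diagonal entry 1 of \<open>u\<close> isolates the
  difference.\<close>

lemma unitri_left_cancel:
  assumes u: "u \<in> unitri" and eq: "u ** v = u ** w" shows "v = w"
proof (rule ccontr)
  assume "v \<noteq> w"
  then obtain i0 j where ij: "v $ i0 $ j \<noteq> w $ i0 $ j" by (auto simp: vec_eq_iff)
  define X where "X = {i. v $ i $ j \<noteq> w $ i $ j}"
  have X: "finite X" "X \<noteq> {}" using ij by (auto simp: X_def)
  define i where "i = Min X"
  have i: "v $ i $ j \<noteq> w $ i $ j" "\<And>k. k < i \<Longrightarrow> v $ k $ j = w $ k $ j"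
    using Min_in [OF X] Min_le [OF X(1)] by (auto simp: i_def X_def not_less [symmetric])
  have "(\<Sum>k\<in>UNIV. u $ i $ k * v $ k $ j - u $ i $ k * w $ k $ j) = 0"
    using eq by (simp add: sum_subtractf mult_nth [symmetric])
  moreover have "(\<Sum>k\<in>UNIV. u $ i $ k * v $ k $ j - u $ i $ k * w $ k $ j)
      = (\<Sum>k\<in>UNIV. if k = i then v $ i $ j - w $ i $ j else 0)"
  proof (intro sum.cong refl)
    fix k show "u $ i $ k * v $ k $ j - u $ i $ k * w $ k $ j
        = (if k = i then v $ i $ j - w $ i $ j else 0)"
      using u i(2) unfolding unitri_nth by (cases k i rule: linorder_cases) auto
  qed
  ultimately show False using i(1) by simp
qed

text \<open>Left multiplication by \<open>g\<close> is injective on the finite set \<open>G\<close>,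
  hence onto, so \<open>mat 1\<close> has a preimage there. Stated for any submonoid so that it
  serves both \<open>unitri\<close> and \<open>H\<close>.\<close>

lemma submonoid_inverse:
  assumes G: "G \<subseteq> unitri" "mat 1 \<in> G" "\<And>g h. g \<in> G \<Longrightarrow> h \<in> G \<Longrightarrow> g ** h \<in> G" and g: "g \<in> G"
  shows "matrix_inv g \<in> G" "g ** matrix_inv g = mat 1" "matrix_inv g ** g = mat 1"
proof -
  have "inj_on ((**) g) G" using unitri_left_cancel G(1) g by (intro inj_onI) blast
  then have "(**) g ` G = G" using G(3) g by (intro endo_inj_surj) auto
  then obtain h where h: "h \<in> G" "g ** h = mat 1" using G(2) by (metis imageE)
  then have hg: "h ** g = mat 1" by (simp add: matrix_left_right_inverse)
  have i: "g ** matrix_inv g = mat 1" "matrix_inv g ** g = mat 1"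
    using someI [of "\<lambda>k. g ** k = mat 1 \<and> k ** g = mat 1" h] h hg unfolding matrix_inv_def by auto
  then have "matrix_inv g = h" using h by (metis matrix_mul_assoc matrix_mul_lid matrix_mul_rid)
  then show "matrix_inv g \<in> G" "g ** matrix_inv g = mat 1" "matrix_inv g ** g = mat 1"
    using h i by auto
qed

lemma unitri_inverse:
  assumes "g \<in> unitri"
  shows "matrix_inv g \<in> unitri" "g ** matrix_inv g = mat 1" "matrix_inv g ** g = mat 1"
  using submonoid_inverse [of unitri g] assms unitri_one unitri_mult by blast+

section \<open>The bilinear pairing behind the characters, and its adjunctions\<close>

definition pairing :: "('f::{field,finite}, 'n::{finite,linorder}) sqmat \<Rightarrow> ('f, 'n) sqmat \<Rightarrow> 'f" where
  "pairing A B = (\<Sum>i\<in>UNIV. \<Sum>j\<in>UNIV. A $ i $ j * B $ i $ j)"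

lemma chi_pairing: "chi \<theta> A B = \<theta> (pairing A B)"
  by (simp add: chi_def pairing_def)

lemma pairing_diff_right: "pairing A (B - C) = pairing A B - pairing A C"
  by (simp add: pairing_def algebra_simps sum_subtractf)

lemma pairing_zero_right [simp]: "pairing A 0 = 0"
  by (simp add: pairing_def)

lemma pairing_trunc:
  assumes "N \<in> strictly_lower" shows "pairing (trunc M) N = pairing M N"
  unfolding pairing_def using assms
  by (intro sum.cong refl) (auto simp: trunc_nth strictly_lower_nth)

lemma pairing_right_mult: "pairing (A ** transpose g) N = pairing A (N ** g)"
proof -
  have "pairing (A ** transpose g) N = (\<Sum>i\<in>UNIV. \<Sum>j\<in>UNIV. \<Sum>k\<in>UNIV. A $ i $ k * (N $ i $ j * g $ j $ k))"
    by (simp add: pairing_def mult_nth transpose_def sum_distrib_right sum_distrib_left ac_simps)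
  also have "\<dots> = (\<Sum>i\<in>UNIV. \<Sum>k\<in>UNIV. \<Sum>j\<in>UNIV. A $ i $ k * (N $ i $ j * g $ j $ k))"
    by (intro sum.cong refl sum.swap)
  finally show ?thesis by (simp add: pairing_def mult_nth sum_distrib_left)
qed

lemma pairing_left_mult: "pairing (transpose g ** A) N = pairing A (g ** N)"
proof -
  have "pairing (transpose g ** A) N = (\<Sum>i\<in>UNIV. \<Sum>j\<in>UNIV. \<Sum>k\<in>UNIV. A $ k $ j * (g $ k $ i * N $ i $ j))"
    by (simp add: pairing_def mult_nth transpose_def sum_distrib_right sum_distrib_left ac_simps)
  also have "\<dots> = (\<Sum>i\<in>UNIV. \<Sum>k\<in>UNIV. \<Sum>j\<in>UNIV. A $ k $ j * (g $ k $ i * N $ i $ j))"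
    by (intro sum.cong refl sum.swap)
  also have "\<dots> = (\<Sum>k\<in>UNIV. \<Sum>i\<in>UNIV. \<Sum>j\<in>UNIV. A $ k $ j * (g $ k $ i * N $ i $ j))"
    by (rule sum.swap)
  also have "\<dots> = (\<Sum>k\<in>UNIV. \<Sum>j\<in>UNIV. \<Sum>i\<in>UNIV. A $ k $ j * (g $ k $ i * N $ i $ j))"
    by (intro sum.cong refl sum.swap)
  finally show ?thesis by (simp add: pairing_def mult_nth sum_distrib_left)
qed

lemma one_minus_unitri: "g \<in> unitri \<Longrightarrow> mat 1 - g \<in> strictly_lower"
  by (simp add: unitri_nth strictly_lower_nth mat1_nth)

text \<open>Entries of \<open>M\<close> on or above the diagonal only feed entries on or above it:
  for \<open>j < i \<le> k\<close> the entry of \<open>M\<close> at \<open>(i, k)\<close> is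
  multiplied by \<open>g $ j $ k\<close>, which vanishes. This is why truncated multiplication is an
  action.\<close>

lemma trunc_right_mult:
  assumes "g \<in> unitri"
  shows "trunc (trunc M ** transpose g) = trunc (M ** transpose g)"
proof -
  have "trunc M $ i $ k * g $ j $ k = M $ i $ k * g $ j $ k" if "j < i" for i j k
    using assms that unfolding unitri_nth trunc_nth by (cases "k < i") auto
  then show ?thesis
    by (auto simp: vec_eq_iff trunc_nth mult_nth transpose_def simp del: mult_cancel_right
        intro!: sum.cong)
qed

lemma trunc_left_mult:
  assumes "g \<in> unitri"
  shows "trunc (transpose g ** trunc M) = trunc (transpose g ** M)"
proof -
  have "g $ k $ i * trunc M $ k $ j = g $ k $ i * M $ k $ j" if "j < i" for i j k
    using assms that unfolding unitri_nth trunc_nth by (cases "j < k") auto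
  then show ?thesis
    by (auto simp: vec_eq_iff trunc_nth mult_nth transpose_def simp del: mult_cancel_left
        intro!: sum.cong)
qed

lemma matrix_diff_rdistrib: "((A - B) ** C :: 'f::field ^ 'n ^ 'n) = A ** C - B ** C"
  by (simp add: vec_eq_iff mult_nth algebra_simps sum_subtractf)

lemma matrix_diff_ldistrib: "(C ** (A - B) :: 'f::field ^ 'n ^ 'n) = C ** A - C ** B"
  by (simp add: vec_eq_iff mult_nth algebra_simps sum_subtractf)

text \<open>With \<open>g\<close> in place of the inverse of \<open>u\<close>, no inverse remains in
  the formula and \<open>act_right\<close> is multiplicative in \<open>g\<close>. Its companion
  \<open>act_left\<close> reverses products, see \<open>act_left_comp\<close>.\<close>

definition act_right ::
  "('f::{field,finite} \<Rightarrow> complex) \<Rightarrow> ('f, 'n::{finite,linorder}) sqmat \<Rightarrow> ('f, 'n) evec \<Rightarrow> ('f, 'n) evec" where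
  "act_right \<theta> g = monomial strictly_lower (\<lambda>C. trunc (C ** transpose g)) (\<lambda>C. chi \<theta> C (mat 1 - g))"

definition act_left ::
  "('f::{field,finite} \<Rightarrow> complex) \<Rightarrow> ('f, 'n::{finite,linorder}) sqmat \<Rightarrow> ('f, 'n) evec \<Rightarrow> ('f, 'n) evec" where
  "act_left \<theta> g = monomial strictly_lower (\<lambda>C. trunc (transpose g ** C)) (\<lambda>C. chi \<theta> C (mat 1 - g))"

lemma right_act_eq: "right_act \<theta> v u = act_right \<theta> (matrix_inv u) v"
  by (simp add: right_act_def act_right_def monomial_def basis_elt_def)

lemma CE_eq: "CE = supported strictly_lower"
  unfolding CE_def basis_elt_def by (rule span_axis)

section \<open>Additive characters of a finite field\<close>

locale add_character =
  fixes \<theta> :: "'f::{field,finite} \<Rightarrow> complex"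
  assumes nontriv: "nontrivial_add_character \<theta>"
begin

lemma theta_add: "\<theta> (x + y) = \<theta> x * \<theta> y" and theta_nz: "\<theta> x \<noteq> 0"
  using nontriv by (auto simp: nontrivial_add_character_def)

lemma theta_0 [simp]: "\<theta> 0 = 1"
  using theta_add [of 0 0] theta_nz [of 0] by simp

lemma theta_minus: "\<theta> (- x) = inverse (\<theta> x)"
  using theta_add [of x "- x"] by (metis theta_0 add.right_inverse inverse_unique)

text \<open>The powers of \<open>\<theta> x\<close> are the values of \<theta> at multiples of
  \<open>x\<close>; the field is finite, so two powers coincide and the value is a root of
  unity.\<close>

lemma norm_theta [simp]: "cmod (\<theta> x) = 1"
proof -
  have pow: "\<theta> (of_nat k * x) = \<theta> x ^ k" for k
    by (induction k) (simp_all add: theta_add algebra_simps)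
  have "finite (range \<theta>)" by simp
  then have "\<not> inj (\<lambda>k::nat. \<theta> x ^ k)"
    using finite_subset [of "range (\<lambda>k::nat. \<theta> x ^ k)" "range \<theta>"] pow
    by (metis (no_types, lifting) finite_imageD image_subset_iff infinite_UNIV_nat rangeI)
  then obtain i j :: nat where ij: "i < j" "\<theta> x ^ i = \<theta> x ^ j"
    unfolding inj_on_def by (metis nat_neq_iff)
  have "\<theta> x ^ i * \<theta> x ^ (j - i) = \<theta> x ^ i"
    using ij power_add [of "\<theta> x" i "j - i"] by simp
  then have "\<theta> x ^ (j - i) = 1" using theta_nz [of x] by simp
  then have "cmod (\<theta> x) ^ (j - i) = 1" by (metis norm_one norm_power)
  then show ?thesis using ij(1) power_eq_1_iff [of "cmod (\<theta> x)" "j - i"] by simp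
qed

lemma theta_detects: "x \<noteq> y \<Longrightarrow> \<exists>t. \<theta> (t * x) \<noteq> \<theta> (t * y)"
proof (rule ccontr)
  assume xy: "x \<noteq> y" and a: "\<nexists>t. \<theta> (t * x) \<noteq> \<theta> (t * y)"
  obtain z where z: "\<theta> z \<noteq> 1" using nontriv by (auto simp: nontrivial_add_character_def)
  have "\<theta> (z / (x - y) * x) = \<theta> (z / (x - y) * y)" using a by blast
  moreover have "z / (x - y) * x = z / (x - y) * y + z" using xy by (simp add: field_simps)
  ultimately show False using z theta_nz by (simp add: theta_add)
qed

text \<open>The double sum of \<open>\<sigma> t * \<theta> (- a * t)\<close> over \<open>a\<close>
  and \<open>t\<close> is computed in two orders. If no \<open>a\<close> works, each sum over
  \<open>t\<close> vanishes; summing over \<open>a\<close> first leaves only \<open>t = 0\<close>,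
  which contributes the order of the field.\<close>

lemma character_eq_theta:
  assumes add: "\<And>x y. \<sigma> (x + y) = \<sigma> x * \<sigma> y" and nz: "\<sigma> 0 \<noteq> 0"
  shows "\<exists>a. \<forall>t. \<sigma> t = \<theta> (a * t)"
proof (rule ccontr)
  assume none: "\<nexists>a. \<forall>t. \<sigma> t = \<theta> (a * t)"
  have s0: "\<sigma> 0 = 1" using add [of 0 0] nz by simp
  have orth: "(\<Sum>t\<in>UNIV. \<sigma> t * \<theta> (- a * t)) = 0" for a
  proof -
    define \<rho> where "\<rho> t = \<sigma> t * \<theta> (- a * t)" for t
    have \<rho>_add: "\<rho> (x + y) = \<rho> x * \<rho> y" for x y
      unfolding \<rho>_def add distrib_left theta_add by (simp add: ac_simps)
    obtain s where "\<sigma> s \<noteq> \<theta> (a * s)" using none by blast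
    then have s: "\<rho> s \<noteq> 1" using theta_nz by (simp add: \<rho>_def theta_minus field_simps)
    have "(\<Sum>t\<in>UNIV. \<rho> t) = (\<Sum>t\<in>UNIV. \<rho> (s + t))"
      by (rule sum.reindex_bij_witness [of _ "\<lambda>t. s + t" "\<lambda>t. t - s"]) auto
    also have "\<dots> = \<rho> s * (\<Sum>t\<in>UNIV. \<rho> t)" by (simp add: \<rho>_add sum_distrib_left)
    finally show ?thesis using s by (simp add: \<rho>_def)
  qed
  have dual: "(\<Sum>a\<in>UNIV. \<theta> (- a * t)) = (if t = 0 then of_nat CARD('f) else 0)" for t
  proof (cases "t = 0")
    case False
    obtain z where z: "\<theta> (z * t) \<noteq> 1" using theta_detects [OF False] by auto
    have "(\<Sum>a\<in>UNIV. \<theta> (- a * t)) = (\<Sum>a\<in>UNIV. \<theta> (z * t + - a * t))"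
      by (rule sum.reindex_bij_witness [of _ "\<lambda>a. a - z" "\<lambda>a. a + z"]) (auto simp: algebra_simps)
    also have "\<dots> = \<theta> (z * t) * (\<Sum>a\<in>UNIV. \<theta> (- a * t))"
      unfolding theta_add sum_distrib_left ..
    finally show ?thesis using z False by simp
  qed simp
  have "0 = (\<Sum>a\<in>UNIV. \<Sum>t\<in>UNIV. \<sigma> t * \<theta> (- a * t))" unfolding orth by simp
  also have "\<dots> = (\<Sum>t\<in>UNIV. \<sigma> t * (\<Sum>a\<in>UNIV. \<theta> (- a * t)))"
    by (subst sum.swap) (simp add: sum_distrib_left)
  also have "\<dots> = (\<Sum>t\<in>(UNIV::'f set). if t = 0 then of_nat CARD('f) else 0)"
    unfolding dual by (rule sum.cong) (simp_all add: s0)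
  finally show False by simp
qed

section \<open>The right and left actions: compatible, commuting and unitary\<close>

lemma norm_chi [simp]: "cmod (chi \<theta> C N) = 1"
  by (simp add: chi_pairing)

text \<open>The scalars form a cocycle because \<open>1 - g h = (1 - h) + (1 - g) h\<close>, and
  right multiplication by \<open>h\<close> moves across the pairing as its transpose.\<close>

lemma act_right_comp:
  assumes "g \<in> unitri" "h \<in> unitri"
  shows "act_right \<theta> g (act_right \<theta> h v) = act_right \<theta> (g ** h) v"
  unfolding act_right_def
proof (subst monomial_comp, force simp: trunc_strictly_lower, rule monomial_cong)
  fix C
  show "trunc (trunc (C ** transpose h) ** transpose g) = trunc (C ** transpose (g ** h))"
    by (simp add: trunc_right_mult assms matrix_transpose_mul matrix_mul_assoc)
  show "chi \<theta> C (mat 1 - h) * chi \<theta> (trunc (C ** transpose h)) (mat 1 - g) = chi \<theta> C (mat 1 - g ** h)"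
  proof -
    have "pairing (trunc (C ** transpose h)) (mat 1 - g) = pairing C (h - g ** h)"
      using one_minus_unitri [OF assms(1)]
      by (simp add: pairing_trunc pairing_right_mult matrix_diff_rdistrib)
    then show ?thesis by (simp add: chi_pairing pairing_diff_right flip: theta_add)
  qed
qed

lemma act_left_comp:
  assumes "g \<in> unitri" "h \<in> unitri"
  shows "act_left \<theta> g (act_left \<theta> h v) = act_left \<theta> (h ** g) v"
  unfolding act_left_def
proof (subst monomial_comp, force simp: trunc_strictly_lower, rule monomial_cong)
  fix C
  show "trunc (transpose g ** trunc (transpose h ** C)) = trunc (transpose (h ** g) ** C)"
    by (simp add: trunc_left_mult assms matrix_transpose_mul matrix_mul_assoc)
  show "chi \<theta> C (mat 1 - h) * chi \<theta> (trunc (transpose h ** C)) (mat 1 - g) = chi \<theta> C (mat 1 - h ** g)"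
  proof -
    have "pairing (trunc (transpose h ** C)) (mat 1 - g) = pairing C (h - h ** g)"
      using one_minus_unitri [OF assms(1)]
      by (simp add: pairing_trunc pairing_left_mult matrix_diff_ldistrib)
    then show ?thesis by (simp add: chi_pairing pairing_diff_right flip: theta_add)
  qed
qed

text \<open>Both orders collect the value of \<theta> at the pairing of \<open>C\<close> with
  \<open>1 - g h\<close>, split once as \<open>(1 - h) + (1 - g) h\<close> and once as
  \<open>(1 - g) + g (1 - h)\<close>.\<close>

lemma act_left_right:
  assumes "g \<in> unitri" "h \<in> unitri"
  shows "act_left \<theta> g (act_right \<theta> h v) = act_right \<theta> h (act_left \<theta> g v)"
  unfolding act_left_def act_right_def
proof (subst monomial_comp, force simp: trunc_strictly_lower,
    subst monomial_comp, force simp: trunc_strictly_lower, rule monomial_cong)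
  fix C
  show "trunc (transpose g ** trunc (C ** transpose h)) = trunc (trunc (transpose g ** C) ** transpose h)"
    by (simp add: trunc_left_mult trunc_right_mult assms matrix_mul_assoc)
  show "chi \<theta> C (mat 1 - h) * chi \<theta> (trunc (C ** transpose h)) (mat 1 - g)
      = chi \<theta> C (mat 1 - g) * chi \<theta> (trunc (transpose g ** C)) (mat 1 - h)"
  proof -
    have "pairing (trunc (C ** transpose h)) (mat 1 - g) = pairing C (h - g ** h)"
      using one_minus_unitri [OF assms(1)]
      by (simp add: pairing_trunc pairing_right_mult matrix_diff_rdistrib)
    moreover have "pairing (trunc (transpose g ** C)) (mat 1 - h) = pairing C (g - g ** h)"
      using one_minus_unitri [OF assms(2)]
      by (simp add: pairing_trunc pairing_left_mult matrix_diff_ldistrib)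
    ultimately show ?thesis by (simp add: chi_pairing pairing_diff_right flip: theta_add)
  qed
qed

lemma act_right_one: "v \<in> CE \<Longrightarrow> act_right \<theta> (mat 1) v = v"
  unfolding act_right_def CE_eq
  by (subst monomial_cong [of _ _ "\<lambda>C. C" _ "\<lambda>C. 1"])
    (auto simp: transpose_mat trunc_id chi_pairing pairing_diff_right monomial_id)

lemma act_left_CE: "act_left \<theta> g v \<in> CE"
  unfolding act_left_def CE_eq by (rule monomial_in_supported) (auto simp: trunc_strictly_lower)

lemma act_right_axis:
  "C \<in> strictly_lower \<Longrightarrow> act_right \<theta> g (axis C 1) = chi \<theta> C (mat 1 - g) *s axis (trunc (C ** transpose g)) 1"
  unfolding act_right_def by (rule monomial_axis)

lemma act_left_axis:
  "C \<in> strictly_lower \<Longrightarrow> act_left \<theta> g (axis C 1) = chi \<theta> C (mat 1 - g) *s axis (trunc (transpose g ** C)) 1"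
  unfolding act_left_def by (rule monomial_axis)

lemmas act_right_linear = monomial_add [of strictly_lower "\<lambda>C. trunc (C ** transpose g)" "\<lambda>C. chi \<theta> C (mat 1 - g)" for g, folded act_right_def]
  monomial_smult [of strictly_lower "\<lambda>C. trunc (C ** transpose g)" "\<lambda>C. chi \<theta> C (mat 1 - g)" for g, folded act_right_def]
  monomial_diff [of strictly_lower "\<lambda>C. trunc (C ** transpose g)" "\<lambda>C. chi \<theta> C (mat 1 - g)" for g, folded act_right_def]
  monomial_sum [of strictly_lower "\<lambda>C. trunc (C ** transpose g)" "\<lambda>C. chi \<theta> C (mat 1 - g)" for g, folded act_right_def]

lemmas act_left_linear = monomial_add [of strictly_lower "\<lambda>C. trunc (transpose g ** C)" "\<lambda>C. chi \<theta> C (mat 1 - g)" for g, folded act_left_def]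
  monomial_smult [of strictly_lower "\<lambda>C. trunc (transpose g ** C)" "\<lambda>C. chi \<theta> C (mat 1 - g)" for g, folded act_left_def]
  monomial_diff [of strictly_lower "\<lambda>C. trunc (transpose g ** C)" "\<lambda>C. chi \<theta> C (mat 1 - g)" for g, folded act_left_def]
  monomial_sum [of strictly_lower "\<lambda>C. trunc (transpose g ** C)" "\<lambda>C. chi \<theta> C (mat 1 - g)" for g, folded act_left_def]

lemma trunc_right_inj:
  fixes g :: "('f, 'n::{finite,linorder}) sqmat"
  assumes "g \<in> unitri" shows "inj_on (\<lambda>C. trunc (C ** transpose g)) strictly_lower"
proof (rule inj_on_inverseI)
  fix C :: "('f, 'n) sqmat" assume "C \<in> strictly_lower"
  then show "trunc (trunc (C ** transpose g) ** transpose (matrix_inv g)) = C"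
    using unitri_inverse [OF assms]
    by (simp add: trunc_right_mult matrix_mul_assoc [symmetric] matrix_transpose_mul [symmetric]
        transpose_mat trunc_id)
qed

lemma trunc_left_inj:
  fixes g :: "('f, 'n::{finite,linorder}) sqmat"
  assumes "g \<in> unitri" shows "inj_on (\<lambda>C. trunc (transpose g ** C)) strictly_lower"
proof (rule inj_on_inverseI)
  fix C :: "('f, 'n) sqmat" assume "C \<in> strictly_lower"
  then show "trunc (transpose (matrix_inv g) ** trunc (transpose g ** C)) = C"
    using unitri_inverse [OF assms]
    by (simp add: trunc_left_mult matrix_mul_assoc matrix_transpose_mul [symmetric]
        transpose_mat trunc_id)
qed

lemma herm_act_right:
  assumes "g \<in> unitri" "v \<in> CE"
  shows "herm (act_right \<theta> g v) (act_right \<theta> g w) = herm v w"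
  unfolding act_right_def using assms
  by (intro herm_monomial trunc_right_inj) (auto simp: trunc_strictly_lower CE_eq)

lemma herm_act_left:
  assumes "g \<in> unitri" "v \<in> CE"
  shows "herm (act_left \<theta> g v) (act_left \<theta> g w) = herm v w"
  unfolding act_left_def using assms
  by (intro herm_monomial trunc_left_inj) (auto simp: trunc_strictly_lower CE_eq)

end

section \<open>Matrices with prescribed support\<close>

text \<open>One notion for three objects: a pattern group when \<open>A\<close> is
  \<open>mat 1\<close>, an orbit of a verge, and the parameter set \<open>patch A indec\<close> of
  linear characters. By \<open>card_patch\<close> each has \<open>q ^ card S\<close>
  elements.\<close>

definition patch :: "('f, 'n) sqmat \<Rightarrow> ('n \<times> 'n) set \<Rightarrow> ('f::{field,finite}, 'n::{finite,linorder}) sqmat set" where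
  "patch A S = {C. \<forall>i l. (i, l) \<notin> S \<longrightarrow> C $ i $ l = A $ i $ l}"

lemma patch_self: "A \<in> patch A S"
  by (simp add: patch_def)

lemma patch_mono: "S \<subseteq> T \<Longrightarrow> patch A S \<subseteq> patch A T"
  by (auto simp: patch_def)

lemma card_patch:
  fixes A :: "('f::{field,finite}, 'n::{finite,linorder}) sqmat"
  shows "card (patch A S) = CARD('f) ^ card S"
proof -
  have "bij_betw (\<lambda>C. restrict (\<lambda>(i, l). C $ i $ l) S) (patch A S) (S \<rightarrow>\<^sub>E (UNIV :: 'f set))"
  proof (rule bij_betw_byWitness [where f' = "\<lambda>f. \<chi> i l. if (i, l) \<in> S then f (i, l) else A $ i $ l"])
    show "\<forall>f\<in>S \<rightarrow>\<^sub>E (UNIV :: 'f set). restrict (\<lambda>(i, l). (\<chi> i l. if (i, l) \<in> S then f (i, l) else A $ i $ l) $ i $ l) S = f"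
      by (auto simp: PiE_def extensional_def fun_eq_iff)
  qed (auto simp: patch_def vec_eq_iff split: if_splits)
  then have "card (patch A S) = card (S \<rightarrow>\<^sub>E (UNIV :: 'f set))" by (rule bij_betw_same_card)
  then show ?thesis by (simp add: card_PiE)
qed

section \<open>Root elements and the pattern groups they generate\<close>

definition root_elt :: "'n \<Rightarrow> 'n \<Rightarrow> 'f \<Rightarrow> ('f::{field,finite}, 'n::{finite,linorder}) sqmat" where
  "root_elt x z t = (\<chi> i j. if i = x \<and> j = z then t else mat 1 $ i $ j)"

lemma root_nth: "x \<noteq> z \<Longrightarrow> root_elt x z t $ i $ j = (if i = j then 1 else if i = x \<and> j = z then t else 0)"
  by (auto simp: root_elt_def mat1_nth)

lemma root_unitri: "z < x \<Longrightarrow> root_elt x z t \<in> unitri"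
  by (auto simp: unitri_nth root_nth)

lemma root_in_patch: "(x, z) \<in> S \<Longrightarrow> root_elt x z t \<in> patch (mat 1) S"
  by (auto simp: patch_def root_elt_def)

lemma root_mult_nth:
  assumes "x \<noteq> z"
  shows "(root_elt x z t ** g) $ i $ j = g $ i $ j + (if i = x then t * g $ z $ j else 0)"
proof -
  have "(root_elt x z t ** g) $ i $ j
      = (\<Sum>k\<in>UNIV. (if k = i then g $ i $ j else 0) + (if k = z then (if i = x then t * g $ z $ j else 0) else 0))"
    unfolding mult_nth using assms by (intro sum.cong refl) (auto simp: root_nth)
  then show ?thesis by (simp add: sum.distrib)
qed

lemma mult_root_nth:
  assumes "x \<noteq> z"
  shows "(C ** transpose (root_elt x z t)) $ i $ j = C $ i $ j + (if j = x then t * C $ i $ z else 0)"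
proof -
  have "(C ** transpose (root_elt x z t)) $ i $ j
      = (\<Sum>k\<in>UNIV. (if k = j then C $ i $ j else 0) + (if k = z then (if j = x then t * C $ i $ z else 0) else 0))"
    unfolding mult_nth using assms by (intro sum.cong refl) (auto simp: root_nth transpose_def)
  then show ?thesis by (simp add: sum.distrib)
qed

lemma root_mult_same:
  "x \<noteq> z \<Longrightarrow> root_elt x z s ** root_elt x z t = root_elt x z (s + t)"
  by (simp add: vec_eq_iff root_mult_nth) (simp add: root_nth)

text \<open>The commutator relation of root subgroups, written without inverses; it will make linear
  characters trivial at composite positions.\<close>

lemma root_commutator:
  assumes "z < y" "y < x"
  shows "root_elt x y s ** root_elt y z t = root_elt x z (s * t) ** (root_elt y z t ** root_elt x y s)"
  using assms by (simp add: vec_eq_iff root_mult_nth) (auto simp: root_nth)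

lemma pairing_one_minus_root:
  assumes "x \<noteq> z" shows "pairing C (mat 1 - root_elt x z t) = - (C $ x $ z * t)"
proof -
  have "pairing C (mat 1 - root_elt x z t)
      = (\<Sum>i\<in>UNIV. \<Sum>j\<in>UNIV. if j = z then (if i = x then - (C $ x $ z * t) else 0) else 0)"
    unfolding pairing_def using assms by (intro sum.cong refl) (auto simp: root_nth mat1_nth)
  also have "\<dots> = - (C $ x $ z * t)" by simp
  finally show ?thesis .
qed

text \<open>Multiplication by the transposed root element adds \<open>t\<close> times column
  \<open>l\<close> to column \<open>i\<close>. Truncation keeps only the rows \<open>x > i\<close>
  of column \<open>i\<close>, and there column \<open>l\<close> vanishes.\<close>

lemma trunc_root_stable:
  assumes "C \<in> strictly_lower" "l < i" "\<And>x. i < x \<Longrightarrow> C $ x $ l = 0"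
  shows "trunc (C ** transpose (root_elt i l t)) = C"
  using assms by (auto simp: vec_eq_iff trunc_nth mult_root_nth strictly_lower_nth not_less)

text \<open>Induction on the number of nonzero entries at positions of \<open>S\<close>: a left
  multiplication by a root element removes one of them.\<close>

lemma root_generated:
  assumes S: "S \<subseteq> Phi_pos" and g: "g \<in> patch (mat 1) S"
    and one: "P (mat 1)"
    and step: "\<And>x z t h. (x, z) \<in> S \<Longrightarrow> h \<in> patch (mat 1) S \<Longrightarrow> P h \<Longrightarrow> P (root_elt x z t ** h)"
  shows "P g"
  using g
proof (induction "card {(x, z) \<in> S. g $ x $ z \<noteq> 0}" arbitrary: g rule: less_induct)
  case less
  define N where "N = {(x, z) \<in> S. g $ x $ z \<noteq> 0}"
  show ?case
  proof (cases "N = {}")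
    case True
    have "g $ i $ j = mat 1 $ i $ j" for i j
    proof (cases "(i, j) \<in> S")
      case True
      then have "i \<noteq> j" "g $ i $ j = 0" using S \<open>N = {}\<close> by (auto simp: Phi_pos_def N_def)
      then show ?thesis by (simp add: mat1_nth)
    next
      case False then show ?thesis using less.prems by (simp add: patch_def)
    qed
    then have "g = mat 1" by (simp add: vec_eq_iff)
    then show ?thesis using one by simp
  next
    case False
    \<comment> \<open>With the topmost row \<open>x\<close> chosen, row \<open>z\<close> of
      \<open>g\<close> is an identity row because \<open>z < x\<close>. So the row operation clears
      the entry at \<open>(x, z)\<close> and touches nothing else.\<close>
    define x where "x = Min (fst ` N)"
    have "x \<in> fst ` N" using False by (simp add: x_def)
    then obtain z where z: "(x, z) \<in> N" by force
    have zx: "z < x" and xz: "(x, z) \<in> S" "g $ x $ z \<noteq> 0"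
      using z S by (auto simp: N_def Phi_pos_def)
    have row: "g $ z $ j = mat 1 $ z $ j" for j
    proof (cases "(z, j) \<in> S")
      case True
      have "(z, j) \<notin> N"
      proof
        assume "(z, j) \<in> N"
        then have "x \<le> z" unfolding x_def by (intro Min_le) force+
        then show False using zx by simp
      qed
      then show ?thesis using True S by (auto simp: N_def mat1_nth Phi_pos_def)
    next
      case False then show ?thesis using less.prems by (simp add: patch_def)
    qed
    define h where "h = root_elt x z (- g $ x $ z) ** g"
    have h_nth: "h $ i $ j = (if i = x \<and> j = z then 0 else g $ i $ j)" for i j
      using zx row by (simp add: h_def root_mult_nth mat1_nth)
    have hP: "h \<in> patch (mat 1) S" using less.prems xz by (auto simp: patch_def h_nth)
    have "{(x, z) \<in> S. h $ x $ z \<noteq> 0} = N - {(x, z)}" by (auto simp: N_def h_nth)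
    then have "card {(x, z) \<in> S. h $ x $ z \<noteq> 0} < card N"
      using z card_Diff1_less [of N "(x, z)"] by simp
    then have "P h" using less.hyps hP by (simp add: N_def)
    then have "P (root_elt x z (g $ x $ z) ** h)" using step xz hP by blast
    moreover have "root_elt x z (g $ x $ z) ** h = g"
      using zx by (simp add: h_def matrix_mul_assoc root_mult_same)
        (simp add: vec_eq_iff root_mult_nth)
    ultimately show ?thesis by simp
  qed
qed

lemma patch_unitri: "S \<subseteq> Phi_pos \<Longrightarrow> patch (mat 1) S \<subseteq> unitri"
  by (auto simp: patch_def unitri_nth Phi_pos_def mat1_nth subset_iff) (meson not_less)+

lemma patch_strictly_lower: "S \<subseteq> Phi_pos \<Longrightarrow> A \<in> strictly_lower \<Longrightarrow> patch A S \<subseteq> strictly_lower"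
proof
  fix C assume "S \<subseteq> Phi_pos" "A \<in> strictly_lower" "C \<in> patch A S"
  moreover from this have "(i, j) \<notin> S" if "(i, j) \<notin> Phi_pos" for i j using that by blast
  ultimately show "C \<in> strictly_lower" by (simp add: strictly_lower_def patch_def)
qed

lemma patch_mult:
  assumes S: "S \<subseteq> Phi_pos" and tr: "\<And>x y z. (x, y) \<in> S \<Longrightarrow> (y, z) \<in> S \<Longrightarrow> (x, z) \<in> S"
    and g: "g \<in> patch (mat 1) S" and h: "h \<in> patch (mat 1) S"
  shows "g ** h \<in> patch (mat 1) S"
  unfolding patch_def
proof (clarify)
  fix x z assume n: "(x, z) \<notin> S"
  have "g $ x $ y * h $ y $ z = (if y = x then mat 1 $ x $ z else 0)" for y
  proof (cases "y = x")
    case True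
    have "(x, x) \<notin> S" using S by (auto simp: Phi_pos_def)
    then show ?thesis using True g h n by (simp add: patch_def mat1_nth)
  next
    case False
    show ?thesis
    proof (cases "(x, y) \<in> S")
      case True
      then have "(y, z) \<notin> S" "y \<noteq> z" using n tr by blast+
      then show ?thesis using False h by (simp add: patch_def mat1_nth)
    next
      case False2: False
      then show ?thesis using g False by (simp add: patch_def mat1_nth)
    qed
  qed
  then show "(g ** h) $ x $ z = mat 1 $ x $ z" by (simp add: mult_nth)
qed

text \<open>At a position that is not a composite of two positions of \<open>S\<close> no cross
  terms occur, so the entry is additive. Composed with \<theta>, such entries are the source of
  linear characters.\<close>

lemma patch_mult_nth:
  assumes S: "S \<subseteq> Phi_pos" and n: "\<And>y. (x, y) \<in> S \<Longrightarrow> (y, z) \<in> S \<Longrightarrow> False" and "x \<noteq> z"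
    and g: "g \<in> patch (mat 1) S" and h: "h \<in> patch (mat 1) S"
  shows "(g ** h) $ x $ z = g $ x $ z + h $ x $ z"
proof -
  have d: "(y, y) \<notin> S" for y using S by (auto simp: Phi_pos_def)
  have "g $ x $ y * h $ y $ z = (if y = x then h $ x $ z else 0) + (if y = z then g $ x $ z else 0)" for y
  proof (cases "y = x \<or> y = z")
    case True then show ?thesis using g h d [of x] d [of z] \<open>x \<noteq> z\<close> by (auto simp: patch_def mat1_nth)
  next
    case False
    have "g $ x $ y = 0 \<or> h $ y $ z = 0"
    proof (cases "(x, y) \<in> S")
      case True
      then have "(y, z) \<notin> S" using n by blast
      then show ?thesis using False h by (simp add: patch_def mat1_nth)
    next
      case f2: False
      then show ?thesis using g False by (auto simp: patch_def mat1_nth)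
    qed
    then show ?thesis using False by auto
  qed
  then show ?thesis by (simp add: mult_nth sum.distrib)
qed

section \<open>Combinatorics of the hooks\<close>

text \<open>The combinatorial part of a verge: a pair \<open>(i, j)\<close> is an arc from
  \<open>i\<close> down to \<open>j\<close>, and each index starts at most one arc and ends at most
  one.\<close>

locale arcs =
  fixes p :: "('n::{finite,linorder} \<times> 'n) set"
  assumes arc_lower: "(i, j) \<in> p \<Longrightarrow> j < i"
    and arc_row: "(i, j) \<in> p \<Longrightarrow> (i, j') \<in> p \<Longrightarrow> j = j'"
    and arc_col: "(i, j) \<in> p \<Longrightarrow> (i', j) \<in> p \<Longrightarrow> i = i'"
begin

definition crossings :: "('n \<times> 'n) set" where
  "crossings = {(i, l). \<exists>j r. (i, j) \<in> p \<and> (r, l) \<in> p \<and> j < l \<and> l < i \<and> i < r}"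

text \<open>The horizontal legs of the hooks without their centres: the positions that the right
  action can alter.\<close>

definition arms :: "('n \<times> 'n) set" where
  "arms = {(i, l). \<exists>j. (i, j) \<in> p \<and> j < l \<and> l < i}"

text \<open>The left action of the root element at \<open>(r, i)\<close> adds a multiple of row
  \<open>r\<close> to row \<open>i\<close> and so copies the main condition \<open>(r, s)\<close> to
  the crossing \<open>(i, s)\<close>. Hence there is one position \<open>(r, i)\<close> for each
  crossing.\<close>

definition extra :: "('n \<times> 'n) set" where
  "extra = {(r, i). \<exists>j s. (i, j) \<in> p \<and> (r, s) \<in> p \<and> j < s \<and> s < i \<and> i < r}"

definition indec :: "('n \<times> 'n) set" where
  "indec = {(x, z) \<in> extra. \<nexists>y. (x, y) \<in> extra \<and> (y, z) \<in> extra}"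

lemma hook_inter_mem:
  assumes "(i, j) \<in> p" "(r, s) \<in> p" "(i, j) \<noteq> (r, s)" "(x, y) \<in> hook (i, j)" "(x, y) \<in> hook (r, s)"
  shows "x = i \<and> y = s \<and> j < s \<and> s < i \<and> i < r \<or> x = r \<and> y = j \<and> s < j \<and> j < r \<and> r < i"
proof -
  have "i \<noteq> r" "j \<noteq> s" using assms(1-3) arc_row arc_col by blast+
  then show ?thesis using assms(4,5) arc_lower [OF assms(1)] arc_lower [OF assms(2)] by auto
qed

lemma crossing_mem_hooks:
  assumes "j < s" "s < i" "i < r"
  shows "(i, s) \<in> hook (i, j)" "(i, s) \<in> hook (r, s)"
  using assms by auto

lemma hook_intersections_eq: "hook_intersections p = crossings"
proof
  show "hook_intersections p \<subseteq> crossings"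
    unfolding hook_intersections_def crossings_def
    using hook_inter_mem by (fastforce simp del: hook.simps)
  show "crossings \<subseteq> hook_intersections p"
    unfolding hook_intersections_def crossings_def
    using crossing_mem_hooks by (fastforce simp del: hook.simps)
qed

lemma card_hook_inter:
  assumes "(i, j) \<in> p" "(r, s) \<in> p" "(i, j) \<noteq> (r, s)"
  shows "card (hook (i, j) \<inter> hook (r, s)) = 1 \<longleftrightarrow>
    j < s \<and> s < i \<and> i < r \<or> s < j \<and> j < r \<and> r < i"
proof
  assume "card (hook (i, j) \<inter> hook (r, s)) = 1"
  then obtain x where "hook (i, j) \<inter> hook (r, s) = {x}" by (rule card_1_singletonE)
  then have "(fst x, snd x) \<in> hook (i, j)" "(fst x, snd x) \<in> hook (r, s)"
    by (simp_all del: hook.simps) blast+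
  from hook_inter_mem [OF assms this] show "j < s \<and> s < i \<and> i < r \<or> s < j \<and> j < r \<and> r < i"
    by blast
next
  assume "j < s \<and> s < i \<and> i < r \<or> s < j \<and> j < r \<and> r < i"
  then have "hook (i, j) \<inter> hook (r, s) = {(i, s)} \<or> hook (i, j) \<inter> hook (r, s) = {(r, j)}"
  proof
    assume *: "j < s \<and> s < i \<and> i < r"
    then have "x = i \<and> y = s" if "(x, y) \<in> hook (i, j)" "(x, y) \<in> hook (r, s)" for x y
      using hook_inter_mem [OF assms that] by auto
    then have "hook (i, j) \<inter> hook (r, s) = {(i, s)}"
      using * crossing_mem_hooks [of j s i r] by fast
    then show ?thesis ..
  next
    assume *: "s < j \<and> j < r \<and> r < i"
    then have "x = r \<and> y = j" if "(x, y) \<in> hook (i, j)" "(x, y) \<in> hook (r, s)" for x y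
      using hook_inter_mem [OF assms that] by auto
    then have "hook (i, j) \<inter> hook (r, s) = {(r, j)}"
      using * crossing_mem_hooks [of s j r i] by fast
    then show ?thesis ..
  qed
  then show "card (hook (i, j) \<inter> hook (r, s)) = 1" by (auto simp del: hook.simps)
qed

lemma L_set_iff: "(r, s) \<in> p \<Longrightarrow> (r, i) \<in> L_set p \<longleftrightarrow> i \<le> s"
proof -
  assume rs: "(r, s) \<in> p"
  then have "r \<in> fst ` p" by force
  then have "(r, i) \<in> L_set p \<longleftrightarrow> (\<exists>j. (r, j) \<in> p \<and> i \<le> j)" by (simp add: L_set_def)
  then show ?thesis using rs arc_row by blast
qed

lemma extra_eq: "L_hat p - L_set p = extra"
proof -
  have "(r, i) \<notin> L_set p" if e: "(r, i) \<in> extra" for r i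
  proof -
    obtain j s where "(i, j) \<in> p" "(r, s) \<in> p" "j < s" "s < i" "i < r"
      using e by (auto simp: extra_def)
    then show ?thesis by (simp add: L_set_iff)
  qed
  then show ?thesis by (auto simp: L_hat_def extra_def Phi_pos_def)
qed

lemma L_hat_eq: "L_hat p = L_set p \<union> extra"
  using extra_eq by (auto simp: L_hat_def)

lemma L_set_extra: "L_set p \<inter> extra = {}"
  using extra_eq by auto

lemma p_L_set: "p \<subseteq> L_set p"
  by (auto simp: L_set_def)

lemma L_hat_Phi: "L_hat p \<subseteq> Phi_pos"
proof -
  have "l < i" if "(i, j) \<in> p" "l \<le> j" for i j l
    using arc_lower [OF that(1)] that(2) by simp
  then show ?thesis by (auto simp: L_hat_def L_set_def Phi_pos_def)
qed

text \<open>Below the diagonal, a row without an arc lies in \<open>L_set p\<close>, and in a row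
  with the arc \<open>(x, s)\<close> the columns up to \<open>s\<close> do; this settles most cases.
  What remains are three mutually crossing arcs starting at \<open>x\<close>, \<open>y\<close> and
  \<open>z\<close>. By the second claim an \<open>extra\<close> position that is composite in
  \<open>L_hat p\<close> is already composite in \<open>extra\<close>, so \<open>indec\<close>
  consists of the positions of \<open>extra\<close> indecomposable in
  \<open>L_hat p\<close>.\<close>

lemma L_hat_trans:
  assumes xy: "(x, y) \<in> L_hat p" and yz: "(y, z) \<in> L_hat p"
  shows "(x, z) \<in> L_hat p" and "(x, z) \<in> extra \<Longrightarrow> (x, y) \<in> extra \<and> (y, z) \<in> extra"
proof -
  have lt: "y < x" "z < y" using xy yz L_hat_Phi by (auto simp: Phi_pos_def)
  have "(x, z) \<in> L_set p \<or> (x, z) \<in> extra \<and> (x, y) \<in> extra \<and> (y, z) \<in> extra"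
  proof (cases "(x, y) \<in> L_set p")
    case True
    show ?thesis
    proof (cases "x \<in> fst ` p")
      case t: True
      then obtain s where s: "(x, s) \<in> p" by force
      have "z \<le> s" using True lt by (simp add: L_set_iff [OF s])
      then show ?thesis by (simp add: L_set_iff [OF s])
    next
      case False
      moreover have "z < x" using lt by simp
      ultimately show ?thesis by (simp add: L_set_def Phi_pos_def)
    qed
  next
    case False
    then have "(x, y) \<in> extra" using xy L_hat_eq by blast
    then obtain j s where js: "(y, j) \<in> p" "(x, s) \<in> p" "j < s" "s < y" "y < x"
      by (auto simp: extra_def)
    show ?thesis
    proof (cases "(y, z) \<in> L_set p")
      case True
      then have "z \<le> s" using js by (simp add: L_set_iff [OF js(1)])
      then show ?thesis by (simp add: L_set_iff [OF js(2)])
    next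
      case f: False
      then have yze: "(y, z) \<in> extra" using yz L_hat_eq by blast
      then obtain m j' where "(z, m) \<in> p" "(y, j') \<in> p" "m < j'" "j' < z" by (auto simp: extra_def)
      then have m: "(z, m) \<in> p" "m < j" "j < z" using arc_row [OF js(1)] by auto
      show ?thesis
      proof (cases "z \<le> s")
        case True then show ?thesis by (simp add: L_set_iff [OF js(2)])
      next
        case ns: False
        then have "m < s" "s < z" "z < x" using m js lt by auto
        then have "(x, z) \<in> extra" using m(1) js(2) unfolding extra_def by blast
        then show ?thesis using yze \<open>(x, y) \<in> extra\<close> by simp
      qed
    qed
  qed
  then show "(x, z) \<in> L_hat p" "(x, z) \<in> extra \<Longrightarrow> (x, y) \<in> extra \<and> (y, z) \<in> extra"
    using L_hat_eq L_set_extra by auto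
qed

lemma indec_eq: "L_hat_minus p - I_set p = indec"
proof -
  have e: "L_hat_minus p - L_circ p = extra"
    using extra_eq p_L_set by (auto simp: L_hat_minus_def L_circ_def)
  have "(x, z) \<in> L_hat_minus p - I_set p \<longleftrightarrow> (x, z) \<in> indec" for x z
  proof -
    have "(x, z) \<in> extra \<longleftrightarrow> (x, z) \<in> L_hat_minus p \<and> (x, z) \<notin> L_circ p" by (simp flip: e)
    then show ?thesis by (simp add: I_set_def indec_def e) argo
  qed
  then show ?thesis by auto
qed

text \<open>The arc \<open>(r, s)\<close> exchanges its two ends: \<open>(r, i)\<close> in
  \<open>extra\<close> corresponds to the crossing \<open>(i, s)\<close>. This is where the index
  \<open>q ^ b\<close> of \<open>K\<close> in \<open>H\<close> comes from.\<close>

lemma card_extra: "card extra = card crossings"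
proof -
  have "bij_betw (\<lambda>(i, l). (THE r. (r, l) \<in> p, i)) crossings extra"
  proof (rule bij_betw_byWitness [where f' = "\<lambda>(r, i). (i, THE s. (r, s) \<in> p)"])
    have c: "(THE r. (r, l) \<in> p) = r" if "(r, l) \<in> p" for r l
    proof (rule the_equality)
      fix x assume "(x, l) \<in> p" then show "x = r" using that by (rule arc_col)
    qed (fact that)
    have r: "(THE l. (r, l) \<in> p) = l" if "(r, l) \<in> p" for r l
    proof (rule the_equality)
      fix x assume "(r, x) \<in> p" then show "x = l" using that by (rule arc_row)
    qed (fact that)
    show "\<forall>a\<in>crossings. (case (case a of (i, l) \<Rightarrow> (THE r. (r, l) \<in> p, i)) of
        (r, i) \<Rightarrow> (i, THE s. (r, s) \<in> p)) = a"
      by (auto simp: crossings_def c r)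
    show "\<forall>a'\<in>extra. (case (case a' of (r, i) \<Rightarrow> (i, THE s. (r, s) \<in> p)) of
        (i, l) \<Rightarrow> (THE r. (r, l) \<in> p, i)) = a'"
      by (auto simp: extra_def c r)
    show "(\<lambda>(i, l). (THE r. (r, l) \<in> p, i)) ` crossings \<subseteq> extra"
      by (auto simp: crossings_def extra_def c) blast
    show "(\<lambda>(r, i). (i, THE s. (r, s) \<in> p)) ` extra \<subseteq> crossings"
      by (auto simp: crossings_def extra_def r) blast
  qed
  then show ?thesis using bij_betw_same_card by metis
qed

lemma card_L_hat: "card (L_hat p) = card (L_set p) + card crossings"
  using card_Un_disjoint [OF _ _ L_set_extra] by (simp add: L_hat_eq card_extra)

text \<open>An arc crossing two consecutive arcs must pass over their common index \<open>j\<close>,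
  from strictly inside \<open>(i, j)\<close> to strictly inside \<open>(j, l)\<close>.\<close>

lemma connected_in_iff:
  assumes "(i, j) \<in> p" "(j, l) \<in> p"
  shows "connected_in p (i, j) (j, l) \<longleftrightarrow> (\<exists>y m. (y, m) \<in> p \<and> l < m \<and> m < j \<and> j < y \<and> y < i)"
proof -
  have lt: "j < i" "l < j" using assms arc_lower by blast+
  \<comment> \<open>\<open>connected_in\<close> lets the third hook be one of the two given ones,
    and a hook of a single position does meet itself in one position. This is harmless, as
    consecutive arcs do not cross each other.\<close>
  have self: "card (hook (a, b) \<inter> hook (a, b)) = 1 \<Longrightarrow> card (hook (a, b) \<inter> hook (c, d)) \<noteq> 1"
    if "(a, b) \<in> p" "(c, d) \<in> p" "(a, b) \<noteq> (c, d)" "d = a \<or> b = c" for a b c d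
    using card_hook_inter [OF that(1-3)] that(4) by auto
  show ?thesis
  proof
    assume "connected_in p (i, j) (j, l)"
    then obtain y m where ym: "(y, m) \<in> p" "card (hook (y, m) \<inter> hook (i, j)) = 1"
        "card (hook (y, m) \<inter> hook (j, l)) = 1"
      unfolding connected_in_def by fastforce
    have ne: "(i, j) \<noteq> (j, l)" using lt by auto
    have "(y, m) \<noteq> (i, j)"
      using self [OF assms ne] ym(2,3) by blast
    moreover have "(y, m) \<noteq> (j, l)"
      using self [OF assms(2,1) ne [symmetric]] ym(2,3) by blast
    ultimately show "\<exists>y m. (y, m) \<in> p \<and> l < m \<and> m < j \<and> j < y \<and> y < i"
      using card_hook_inter [OF ym(1) assms(1)] card_hook_inter [OF ym(1) assms(2)] ym by force
  next
    assume "\<exists>y m. (y, m) \<in> p \<and> l < m \<and> m < j \<and> j < y \<and> y < i"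
    then obtain y m where ym: "(y, m) \<in> p" "l < m" "m < j" "j < y" "y < i" by blast
    have "card (hook (y, m) \<inter> hook (i, j)) = 1"
      using card_hook_inter [OF ym(1) assms(1)] ym by auto
    moreover have "card (hook (y, m) \<inter> hook (j, l)) = 1"
      using card_hook_inter [OF ym(1) assms(2)] ym by auto
    ultimately show "connected_in p (i, j) (j, l)" using ym unfolding connected_in_def by fastforce
  qed
qed

lemma connected_in_sym: "connected_in p x y \<longleftrightarrow> connected_in p y x"
  by (auto simp: connected_in_def)

text \<open>If \<open>(i, j)\<close> and \<open>(j, l)\<close> are connected through \<open>(y, m)\<close>, then \<open>l < m < j < y < i\<close>, and \<open>(i, j)\<close> is the
  composite of \<open>(i, y)\<close> and \<open>(y, j)\<close>.\<close>

lemma hook_disconnected_iff: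
  "hook_disconnected p \<longleftrightarrow> \<not> (\<exists>i j y. (i, j) \<in> p \<and> (i, y) \<in> L_hat p \<and> (y, j) \<in> L_hat p)"
proof -
  have "(\<exists>x\<in>p. \<exists>y\<in>p. x \<noteq> y \<and> connected_in p x y) \<longleftrightarrow>
      (\<exists>i j l. (i, j) \<in> p \<and> (j, l) \<in> p \<and> connected_in p (i, j) (j, l))" (is "?L \<longleftrightarrow> ?M")
  proof
    assume ?L
    then obtain x y where "x \<in> p" "y \<in> p" "connected_in p x y" by blast
    then obtain a b c d where *: "(a, b) \<in> p" "(c, d) \<in> p" "connected_in p (a, b) (c, d)"
      by (cases x; cases y) blast
    then have "b = c \<or> d = a" by (auto simp: connected_in_def)
    then show ?M using * connected_in_sym by blast
  next
    assume ?M
    then obtain i j l where *: "(i, j) \<in> p" "(j, l) \<in> p" "connected_in p (i, j) (j, l)" by blast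
    moreover have "(i, j) \<noteq> (j, l)" using arc_lower [OF *(1)] by auto
    ultimately show ?L by blast
  qed
  also have "\<dots> \<longleftrightarrow> (\<exists>i j l y m. (i, j) \<in> p \<and> (j, l) \<in> p \<and> (y, m) \<in> p \<and> l < m \<and> m < j \<and> j < y \<and> y < i)"
    using connected_in_iff by blast
  also have "\<dots> \<longleftrightarrow> (\<exists>i j y. (i, j) \<in> p \<and> (i, y) \<in> L_hat p \<and> (y, j) \<in> L_hat p)"
  proof
    assume "\<exists>i j l y m. (i, j) \<in> p \<and> (j, l) \<in> p \<and> (y, m) \<in> p \<and> l < m \<and> m < j \<and> j < y \<and> y < i"
    then obtain i j l y m where *: "(i, j) \<in> p" "(j, l) \<in> p" "(y, m) \<in> p" "l < m" "m < j" "j < y" "y < i"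
      by blast
    have "m < y" using * by simp
    then have "(i, y) \<in> extra" "(y, j) \<in> extra" using * unfolding extra_def by blast+
    then show "\<exists>i j y. (i, j) \<in> p \<and> (i, y) \<in> L_hat p \<and> (y, j) \<in> L_hat p"
      using * L_hat_eq by blast
  next
    assume "\<exists>i j y. (i, j) \<in> p \<and> (i, y) \<in> L_hat p \<and> (y, j) \<in> L_hat p"
    then obtain i j y where *: "(i, j) \<in> p" "(i, y) \<in> L_hat p" "(y, j) \<in> L_hat p" by blast
    have "j < y" using *(3) L_hat_Phi by (auto simp: Phi_pos_def)
    then have "(i, y) \<in> extra" using *(2) L_set_iff [OF *(1)] L_hat_eq by auto
    then obtain m where m: "(y, m) \<in> p" "m < j" "y < i" using arc_row [OF *(1)] by (auto simp: extra_def)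
    then have "(y, j) \<in> extra" using *(3) L_set_iff [OF m(1)] L_hat_eq by auto
    then obtain l where "(j, l) \<in> p" "l < m" using arc_row [OF m(1)] by (auto simp: extra_def)
    then show "\<exists>i j l y m. (i, j) \<in> p \<and> (j, l) \<in> p \<and> (y, m) \<in> p \<and> l < m \<and> m < j \<and> j < y \<and> y < i"
      using * m \<open>j < y\<close> by blast
  qed
  finally show ?thesis by (simp only: hook_disconnected_def)
qed

end

section \<open>Orbits and equivariant maps\<close>

lemma unitri_inv_inv:
  assumes "g \<in> unitri" shows "matrix_inv (matrix_inv g) = g"
proof -
  have "g ** (matrix_inv g ** matrix_inv (matrix_inv g)) = g"
    using unitri_inverse [OF unitri_inverse(1) [OF assms]] by simp
  then show ?thesis using unitri_inverse [OF assms] by (simp add: matrix_mul_assoc)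
qed

lemma ball_unitri_inv: "(\<forall>u\<in>unitri. P (matrix_inv u)) \<longleftrightarrow> (\<forall>g\<in>unitri. P g)"
  using unitri_inverse(1) unitri_inv_inv by metis

text \<open>Inversion permutes \<open>unitri\<close>, so stability under all \<open>u\<close> and
  under all \<open>g = matrix_inv u\<close> is the same condition.\<close>

lemma submodule_CE_iff:
  "submodule_CE \<theta> M \<longleftrightarrow> M \<subseteq> CE \<and> vec.subspace M \<and> (\<forall>g\<in>unitri. \<forall>v\<in>M. act_right \<theta> g v \<in> M)"
proof -
  have "(\<forall>v\<in>M. \<forall>u\<in>unitri. right_act \<theta> v u \<in> M) \<longleftrightarrow> (\<forall>u\<in>unitri. \<forall>v\<in>M. act_right \<theta> (matrix_inv u) v \<in> M)"
    unfolding right_act_eq by blast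
  also have "\<dots> \<longleftrightarrow> (\<forall>g\<in>unitri. \<forall>v\<in>M. act_right \<theta> g v \<in> M)"
    by (rule ball_unitri_inv)
  finally show ?thesis by (simp add: submodule_CE_def)
qed

text \<open>Unlike \<open>Hom_CU\<close>, this fixes neither a codomain nor values outside
  \<open>M\<close>, so it applies directly to left multiplications and projections.\<close>

definition CU_linear ::
  "('f::{field,finite} \<Rightarrow> complex) \<Rightarrow> ('f, 'n::{finite,linorder}) evec set \<Rightarrow> (('f, 'n) evec \<Rightarrow> ('f, 'n) evec) \<Rightarrow> bool" where
  "CU_linear \<theta> M \<phi> \<longleftrightarrow> (\<forall>x\<in>M. \<forall>y\<in>M. \<phi> (x + y) = \<phi> x + \<phi> y) \<and>
     (\<forall>c. \<forall>x\<in>M. \<phi> (c *s x) = c *s \<phi> x) \<and>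
     (\<forall>g\<in>unitri. \<forall>x\<in>M. \<phi> (act_right \<theta> g x) = act_right \<theta> g (\<phi> x))"

lemma Hom_CU_iff: "\<phi> \<in> Hom_CU \<theta> M N \<longleftrightarrow> \<phi> \<in> M \<rightarrow>\<^sub>E N \<and> CU_linear \<theta> M \<phi>"
proof -
  have "(\<forall>x\<in>M. \<forall>u\<in>unitri. \<phi> (right_act \<theta> x u) = right_act \<theta> (\<phi> x) u) \<longleftrightarrow>
      (\<forall>u\<in>unitri. \<forall>x\<in>M. \<phi> (act_right \<theta> (matrix_inv u) x) = act_right \<theta> (matrix_inv u) (\<phi> x))"
    unfolding right_act_eq by blast
  also have "\<dots> \<longleftrightarrow> (\<forall>g\<in>unitri. \<forall>x\<in>M. \<phi> (act_right \<theta> g x) = act_right \<theta> g (\<phi> x))"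
    by (rule ball_unitri_inv)
  finally show ?thesis by (simp add: Hom_CU_def CU_linear_def)
qed

lemma CU_linear_sum:
  assumes \<phi>: "CU_linear \<theta> M \<phi>" and M: "vec.subspace M" and f: "\<And>a. a \<in> S \<Longrightarrow> f a \<in> M"
  shows "\<phi> (\<Sum>a\<in>S. f a) = (\<Sum>a\<in>S. \<phi> (f a))"
  using f
proof (induction S rule: infinite_finite_induct)
  case (insert a S)
  then have "(\<Sum>a\<in>S. f a) \<in> M" using M by (intro vec.subspace_sum) auto
  then show ?case using insert \<phi> by (simp add: CU_linear_def)
next
  case empty
  have "\<phi> (0 *s 0) = 0 *s \<phi> 0" using \<phi> vec.subspace_0 [OF M] unfolding CU_linear_def by blast
  then show ?case by simp
next
  case (infinite S)
  have "\<phi> (0 *s 0) = 0 *s \<phi> 0" using \<phi> vec.subspace_0 [OF M] unfolding CU_linear_def by blast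
  then show ?case using infinite by simp
qed

locale orbit_setting = add_character \<theta> + arcs p
  for \<theta> :: "'f::{field,finite} \<Rightarrow> complex" and p :: "('n::{finite,linorder} \<times> 'n) set"
begin

section \<open>The right orbit of a verge\<close>

definition verges :: "('f, 'n) sqmat set" where
  "verges = {B \<in> strictly_lower. main_conditions B = p}"

lemma verges_lower: "A \<in> verges \<Longrightarrow> A \<in> strictly_lower"
  by (simp add: verges_def)

lemma verges_nz: "A \<in> verges \<Longrightarrow> A $ i $ j \<noteq> 0 \<longleftrightarrow> (i, j) \<in> p"
  by (auto simp: verges_def main_conditions_def)

lemma verges_0: "A \<in> verges \<Longrightarrow> (i, j) \<notin> p \<Longrightarrow> A $ i $ j = 0"
  using verges_nz by blast

lemma verge_right_nth:
  assumes A: "A \<in> verges" and ij: "(i, j) \<in> p"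
  shows "(A ** transpose g) $ i $ l = A $ i $ j * g $ l $ j"
proof -
  have "(A ** transpose g) $ i $ l = (\<Sum>k\<in>UNIV. if k = j then A $ i $ j * g $ l $ j else 0)"
    unfolding mult_nth
  proof (intro sum.cong refl)
    fix k
    have "(i, k) \<notin> p" if "k \<noteq> j" using arc_row [OF ij, of k] that by blast
    then show "A $ i $ k * transpose g $ k $ l = (if k = j then A $ i $ j * g $ l $ j else 0)"
      by (simp add: verges_0 [OF A] transpose_def)
  qed
  then show ?thesis by simp
qed

lemma verge_right_nth0:
  assumes A: "A \<in> verges" and i: "i \<notin> fst ` p"
  shows "(A ** transpose g) $ i $ l = 0"
proof -
  have "A $ i $ k = 0" for k using verges_0 [OF A] i by force
  then show ?thesis by (simp add: mult_nth)
qed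

lemma verge_left_nth:
  assumes A: "A \<in> verges" and rl: "(r, l) \<in> p"
  shows "(transpose g ** A) $ i $ l = g $ r $ i * A $ r $ l"
proof -
  have "(transpose g ** A) $ i $ l = (\<Sum>k\<in>UNIV. if k = r then g $ r $ i * A $ r $ l else 0)"
    unfolding mult_nth
  proof (intro sum.cong refl)
    fix k
    have "(k, l) \<notin> p" if "k \<noteq> r" using arc_col [OF rl, of k] that by blast
    then show "transpose g $ i $ k * A $ k $ l = (if k = r then g $ r $ i * A $ r $ l else 0)"
      by (simp add: verges_0 [OF A] transpose_def)
  qed
  then show ?thesis by simp
qed

lemma verge_left_nth0:
  assumes A: "A \<in> verges" and i: "l \<notin> snd ` p"
  shows "(transpose g ** A) $ i $ l = 0"
proof -
  have "A $ k $ l = 0" for k using verges_0 [OF A] i by force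
  then show ?thesis by (simp add: mult_nth)
qed

lemma arms_Phi: "arms \<subseteq> Phi_pos"
  by (auto simp: arms_def Phi_pos_def)

lemma crossings_arms: "crossings \<subseteq> arms"
  by (auto simp: arms_def crossings_def)

lemma patch_arms_lower: "A \<in> verges \<Longrightarrow> patch A arms \<subseteq> strictly_lower"
  by (intro patch_strictly_lower arms_Phi verges_lower)

lemma the_row: "(i, j) \<in> p \<Longrightarrow> (THE j. (i, j) \<in> p) = j"
proof (rule the_equality)
  fix x assume "(i, j) \<in> p" "(i, x) \<in> p" then show "x = j" by (rule arc_row [symmetric])
qed

lemma the_col: "(i, j) \<in> p \<Longrightarrow> (THE i. (i, j) \<in> p) = i"
proof (rule the_equality)
  fix x assume "(i, j) \<in> p" "(x, j) \<in> p" then show "x = i" by (rule arc_col [symmetric])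
qed

text \<open>For an arc \<open>(i, j)\<close>, row \<open>i\<close> of the product is
  \<open>A $ i $ j\<close> times column \<open>j\<close> of \<open>g\<close>: zero left of
  \<open>j\<close> and unchanged at \<open>j\<close>, while truncation cuts it off before
  \<open>i\<close>. Only the positions in \<open>arms\<close> are free.\<close>

lemma right_orbit_subset:
  assumes A: "A \<in> verges" and g: "g \<in> unitri"
  shows "trunc (A ** transpose g) \<in> patch A arms"
  unfolding patch_def
proof (clarify)
  fix i l assume n: "(i, l) \<notin> arms"
  show "trunc (A ** transpose g) $ i $ l = A $ i $ l"
  proof (cases "l < i")
    case False
    then show ?thesis using verges_lower [OF A] by (simp add: trunc_nth strictly_lower_nth)
  next
    case li: True
    show ?thesis
    proof (cases "i \<in> fst ` p")
      case False
      then have "(i, l) \<notin> p" by force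
      then show ?thesis by (simp add: trunc_nth verges_0 [OF A] verge_right_nth0 [OF A False])
    next
      case True
      then obtain j where ij: "(i, j) \<in> p" by force
      then have "l \<le> j" using n li by (auto simp: arms_def)
      then have "g $ l $ j = (if l = j then 1 else 0)" using g by (simp add: unitri_nth)
      moreover have "A $ i $ l = 0" if "l \<noteq> j" using verges_0 [OF A] arc_row [OF ij] that by blast
      ultimately show ?thesis using li by (simp add: trunc_nth verge_right_nth [OF A ij])
    qed
  qed
qed

text \<open>Each arc \<open>(i, j)\<close> reads its own column \<open>j\<close> of
  \<open>g\<close>, so the entries prescribed in different rows never interfere.\<close>

lemma right_orbit_transitive:
  assumes A: "A \<in> verges" and C: "C \<in> patch A arms"
  shows "\<exists>g\<in>unitri. trunc (A ** transpose g) = C"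
proof -
  define g :: "('f, 'n) sqmat" where "g = (\<chi> l j. if \<exists>i. (i, j) \<in> p \<and> j < l \<and> l < i
     then C $ (THE i. (i, j) \<in> p) $ l / A $ (THE i. (i, j) \<in> p) $ j else mat 1 $ l $ j)"
  have g1: "g $ l $ j = C $ i $ l / A $ i $ j" if "(i, j) \<in> p" "j < l" "l < i" for i j l
    using that by (auto simp: g_def the_col [OF that(1)])
  have gu: "g \<in> unitri" by (auto simp: unitri_nth g_def mat1_nth)
  have "trunc (A ** transpose g) $ i $ l = C $ i $ l" for i l
  proof (cases "(i, l) \<in> arms")
    case True
    then obtain j where j: "(i, j) \<in> p" "j < l" "l < i" by (auto simp: arms_def)
    then show ?thesis using verges_nz [OF A] by (simp add: trunc_nth verge_right_nth [OF A j(1)] g1)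
  next
    case False
    then have "C $ i $ l = A $ i $ l" using C by (simp add: patch_def)
    moreover have "trunc (A ** transpose g) $ i $ l = A $ i $ l"
      using right_orbit_subset [OF A gu] False by (simp add: patch_def)
    ultimately show ?thesis by simp
  qed
  then have "trunc (A ** transpose g) = C" by (simp add: vec_eq_iff)
  then show ?thesis using gu by blast
qed

lemma right_orbit_eq:
  assumes "A \<in> verges" shows "right_orbit A = (\<lambda>C. axis C 1) ` patch A arms"
proof -
  have "right_orbit A = (\<lambda>u. basis_elt (trunc (A ** transpose (matrix_inv u)))) ` unitri"
    by (auto simp: right_orbit_def)
  also have "\<dots> = (\<lambda>C. axis C 1) ` ((\<lambda>g. trunc (A ** transpose g)) ` (matrix_inv ` unitri))"
    by (simp add: image_image basis_elt_def)
  also have "matrix_inv ` unitri = (unitri :: ('f, 'n) sqmat set)"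
  proof (intro subset_antisym subsetI)
    fix g :: "('f, 'n) sqmat" assume "g \<in> unitri"
    then show "g \<in> matrix_inv ` unitri"
      using unitri_inv_inv [of g] unitri_inverse(1) [of g] by (metis imageI)
  qed (auto simp: unitri_inverse(1))
  also have "(\<lambda>g. trunc (A ** transpose g)) ` unitri = patch A arms"
    using right_orbit_subset [OF assms] right_orbit_transitive [OF assms] by blast
  finally show ?thesis .
qed

lemma orbit_module_eq: "A \<in> verges \<Longrightarrow> orbit_module A = supported (patch A arms)"
  by (simp add: orbit_module_def right_orbit_eq span_axis)

lemma card_right_orbit: "A \<in> verges \<Longrightarrow> card (right_orbit A) = CARD('f) ^ card arms"
  by (simp add: right_orbit_eq card_image inj_on_def axis_eq_axis card_patch)

section \<open>The two pattern groups and the left orbit of a verge\<close>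

definition H :: "('f, 'n) sqmat set" where "H = patch (mat 1) (L_hat p)"

definition K :: "('f, 'n) sqmat set" where "K = patch (mat 1) (L_set p)"

lemma H_unitri: "H \<subseteq> unitri"
  unfolding H_def by (intro patch_unitri L_hat_Phi)

lemma K_H: "K \<subseteq> H"
  unfolding K_def H_def by (intro patch_mono) (auto simp: L_hat_eq)

lemma H_mult: "g \<in> H \<Longrightarrow> h \<in> H \<Longrightarrow> g ** h \<in> H"
  unfolding H_def by (rule patch_mult [OF L_hat_Phi L_hat_trans(1)])

lemma H_one: "mat 1 \<in> H" and K_one: "mat 1 \<in> K"
  by (simp_all add: H_def K_def patch_self)

lemma H_inverse:
  assumes "g \<in> H"
  shows "matrix_inv g \<in> H" "g ** matrix_inv g = mat 1" "matrix_inv g ** g = mat 1"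
  using submonoid_inverse [OF H_unitri H_one H_mult assms] by blast+

lemma card_H: "card H = card K * CARD('f) ^ card crossings"
  by (simp add: H_def K_def card_patch card_L_hat power_add)

text \<open>For an arc \<open>(r, l)\<close> the product has the entry
  \<open>g $ r $ i * A $ r $ l\<close> at \<open>(i, l)\<close>. Since \<open>l < i\<close>, the
  position \<open>(r, i)\<close> is not in \<open>L_set p\<close>; a nonzero
  \<open>g $ r $ i\<close> with \<open>r \<noteq> i\<close> thus puts it into \<open>extra\<close>,
  which means a crossing at \<open>(i, l)\<close>.\<close>

lemma left_nth_extra:
  assumes A: "A \<in> verges" and g: "g \<in> H" and n: "(i, l) \<notin> crossings"
  shows "trunc (transpose g ** A) $ i $ l = A $ i $ l"
proof (cases "l < i")
  case False
  then show ?thesis using verges_lower [OF A] by (simp add: trunc_nth strictly_lower_nth)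
next
  case li: True
  show ?thesis
  proof (cases "l \<in> snd ` p")
    case False
    then have "(i, l) \<notin> p" by force
    then show ?thesis by (simp add: trunc_nth verges_0 [OF A] verge_left_nth0 [OF A False])
  next
    case True
    then obtain r where rl: "(r, l) \<in> p" by force
    have "g $ r $ i = 0" if "r \<noteq> i"
    proof (rule ccontr)
      assume "g $ r $ i \<noteq> 0"
      moreover have "g $ r $ i = 0" if "(r, i) \<notin> L_hat p"
        using g that \<open>r \<noteq> i\<close> by (simp add: H_def patch_def mat1_nth)
      ultimately have "(r, i) \<in> L_hat p" by blast
      then have "(r, i) \<in> extra" using L_set_iff [OF rl, of i] li L_hat_eq by auto
      then obtain j s where js: "(i, j) \<in> p" "(r, s) \<in> p" "j < s" "s < i" "i < r" by (auto simp: extra_def)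
      moreover have "s = l" using arc_row js rl by blast
      ultimately have "(i, l) \<in> crossings" using rl by (auto simp: crossings_def)
      then show False using n by blast
    qed
    moreover have "g $ i $ i = 1" using g H_unitri by (auto simp: unitri_nth)
    moreover have "A $ i $ l = 0" if "r \<noteq> i" using verges_0 [OF A] arc_col [OF rl] that by blast
    ultimately show ?thesis using li by (cases "r = i") (simp_all add: trunc_nth verge_left_nth [OF A rl])
  qed
qed

lemma left_orbit_subset: "A \<in> verges \<Longrightarrow> g \<in> H \<Longrightarrow> trunc (transpose g ** A) \<in> patch A crossings"
  using left_nth_extra by (simp add: patch_def)

lemma left_nth_crossing:
  assumes A: "A \<in> verges" and js: "(i, j) \<in> p" "(r, s) \<in> p" "j < s" "s < i" "i < r"
  shows "trunc (transpose g ** A) $ i $ s = g $ r $ i * A $ r $ s"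
  using js by (simp add: trunc_nth verge_left_nth [OF A js(2)])

lemma left_orbit_transitive:
  assumes A: "A \<in> verges" and C: "C \<in> patch A crossings"
  shows "\<exists>g\<in>H. trunc (transpose g ** A) = C"
proof -
  define g :: "('f, 'n) sqmat" where "g = (\<chi> r i. if (r, i) \<in> extra
     then C $ i $ (THE s. (r, s) \<in> p) / A $ r $ (THE s. (r, s) \<in> p) else mat 1 $ r $ i)"
  have gH: "g \<in> H" by (auto simp: H_def patch_def g_def L_hat_eq)
  have "trunc (transpose g ** A) $ i $ l = C $ i $ l" for i l
  proof (cases "(i, l) \<in> crossings")
    case True
    then obtain j r where j: "(i, j) \<in> p" "(r, l) \<in> p" "j < l" "l < i" "i < r"
      by (auto simp: crossings_def)
    then have "(r, i) \<in> extra" by (auto simp: extra_def)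
    then show ?thesis using verges_nz [OF A] j
      by (simp add: left_nth_crossing [OF A j] g_def the_row [OF j(2)])
  next
    case False
    then show ?thesis using C left_nth_extra [OF A gH] by (simp add: patch_def)
  qed
  then have "trunc (transpose g ** A) = C" by (simp add: vec_eq_iff)
  then show ?thesis using gH by blast
qed

text \<open>At the crossing belonging to a position \<open>(r, i)\<close> of \<open>extra\<close>,
  the translate of \<open>A\<close> shows \<open>g $ r $ i\<close> up to a nonzero factor. So fixing
  \<open>A\<close> kills exactly the entries of \<open>g\<close> in \<open>extra\<close>.\<close>

lemma left_stabiliser:
  assumes A: "A \<in> verges" and g: "g \<in> H"
  shows "trunc (transpose g ** A) = A \<longleftrightarrow> g \<in> K"
proof
  assume eq: "trunc (transpose g ** A) = A"
  have "g $ r $ i = 0" if "(r, i) \<in> extra" for r i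
  proof -
    obtain j s where js: "(i, j) \<in> p" "(r, s) \<in> p" "j < s" "s < i" "i < r"
      using \<open>(r, i) \<in> extra\<close> by (auto simp: extra_def)
    have "(i, s) \<notin> p" using arc_row [OF js(1), of s] js(3) by blast
    then have "A $ i $ s = 0" by (rule verges_0 [OF A])
    then show ?thesis using left_nth_crossing [OF A js, of g] verges_nz [OF A, of r s] js(2) by (simp add: eq)
  qed
  note extra0 = this
  have "g $ i $ l = mat 1 $ i $ l" if "(i, l) \<notin> L_set p" for i l
  proof (cases "(i, l) \<in> extra")
    case True
    then have "i \<noteq> l" by (auto simp: extra_def)
    then show ?thesis using extra0 [OF True] by (simp add: mat1_nth)
  next
    case False
    then show ?thesis using g that by (simp add: H_def patch_def L_hat_eq)
  qed
  then show "g \<in> K" by (simp add: K_def patch_def)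
next
  assume k: "g \<in> K"
  have "trunc (transpose g ** A) $ i $ s = A $ i $ s" for i s
  proof (cases "(i, s) \<in> crossings")
    case True
    then obtain j r where js: "(i, j) \<in> p" "(r, s) \<in> p" "j < s" "s < i" "i < r"
      by (auto simp: crossings_def)
    then have "(r, i) \<in> extra" by (auto simp: extra_def)
    then have "(r, i) \<notin> L_set p" using L_set_extra by blast
    then have "g $ r $ i = 0" using k js(5) by (simp add: K_def patch_def mat1_nth)
    moreover have "(i, s) \<notin> p" using arc_row [OF js(1), of s] js(3) by blast
    then have "A $ i $ s = 0" by (rule verges_0 [OF A])
    ultimately show ?thesis using left_nth_crossing [OF A js, of g] by simp
  qed (simp add: left_nth_extra [OF A g])
  then show "trunc (transpose g ** A) = A" by (simp add: vec_eq_iff)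
qed

section \<open>The orbit module as a cyclic module, and its endomorphisms\<close>

lemma orbit_module_CE: "A \<in> verges \<Longrightarrow> orbit_module A \<subseteq> CE"
  unfolding CE_eq by (simp add: orbit_module_eq supported_mono patch_arms_lower)

lemma axis_in_orbit_module: "A \<in> verges \<Longrightarrow> C \<in> patch A arms \<Longrightarrow> axis C 1 \<in> orbit_module A"
  by (simp add: orbit_module_eq axis_in_supported)

lemma orbit_module_subspace: "A \<in> verges \<Longrightarrow> vec.subspace (orbit_module A)"
  by (simp add: orbit_module_eq supported_subspace)

text \<open>That the scalar has modulus one is what later equates the lengths of the projections of
  all basis elements.\<close>

lemma orbit_generated:
  assumes A: "A \<in> verges" and C: "C \<in> patch A arms"
  shows "\<exists>g\<in>unitri. \<exists>c. cmod c = 1 \<and> axis C 1 = c *s act_right \<theta> g (axis A 1)"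
proof -
  obtain g where g: "g \<in> unitri" "trunc (A ** transpose g) = C"
    using right_orbit_transitive [OF A C] by blast
  have nz: "chi \<theta> A (mat 1 - g) \<noteq> 0" using norm_chi [of A "mat 1 - g"] by (metis norm_zero zero_neq_one)
  have "axis C 1 = inverse (chi \<theta> A (mat 1 - g)) *s act_right \<theta> g (axis A 1)"
    using g nz by (simp add: act_right_axis verges_lower [OF A])
  moreover have "cmod (inverse (chi \<theta> A (mat 1 - g))) = 1" by (simp add: norm_inverse)
  ultimately show ?thesis using g by blast
qed

lemma orbit_module_submodule:
  assumes A: "A \<in> verges" shows "submodule_CE \<theta> (orbit_module A)"
proof -
  have "act_right \<theta> g v \<in> orbit_module A" if g: "g \<in> unitri" and v: "v \<in> orbit_module A" for g v
  proof -
    have ax: "act_right \<theta> g (axis C 1) \<in> orbit_module A" if C: "C \<in> patch A arms" for C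
    proof -
      obtain h where h: "h \<in> unitri" "trunc (A ** transpose h) = C"
        using right_orbit_transitive [OF A C] by blast
      have "trunc (C ** transpose g) = trunc (A ** transpose (g ** h))"
        using g h by (simp flip: h(2) add: trunc_right_mult matrix_transpose_mul matrix_mul_assoc)
      then have "trunc (C ** transpose g) \<in> patch A arms"
        using right_orbit_subset [OF A unitri_mult] g h by simp
      then show ?thesis
        using C patch_arms_lower [OF A] axis_in_orbit_module [OF A]
        by (subst act_right_axis) (auto intro: vec.subspace_scale [OF orbit_module_subspace [OF A]])
    qed
    have "v = (\<Sum>C\<in>patch A arms. v $ C *s axis C 1)"
      using v A by (intro supported_expand) (simp add: orbit_module_eq)
    then have "act_right \<theta> g v = (\<Sum>C\<in>patch A arms. v $ C *s act_right \<theta> g (axis C 1))"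
      by (metis (no_types, lifting) act_right_linear(2,4) sum.cong)
    also have "\<dots> \<in> orbit_module A"
      by (intro vec.subspace_sum vec.subspace_scale orbit_module_subspace A ax)
    finally show ?thesis .
  qed
  then show ?thesis
    by (simp add: submodule_CE_iff orbit_module_CE orbit_module_subspace A)
qed

lemma CU_linear_expand:
  assumes A: "A \<in> verges" and \<phi>: "CU_linear \<theta> (orbit_module A) \<phi>" and v: "v \<in> orbit_module A"
  shows "\<phi> v = (\<Sum>C\<in>patch A arms. v $ C *s \<phi> (axis C 1))"
proof -
  have "v = (\<Sum>C\<in>patch A arms. v $ C *s axis C 1)"
    using v A by (intro supported_expand) (simp add: orbit_module_eq)
  then have "\<phi> v = \<phi> (\<Sum>C\<in>patch A arms. v $ C *s axis C 1)" by simp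
  also have "\<dots> = (\<Sum>C\<in>patch A arms. \<phi> (v $ C *s axis C 1))"
    by (intro CU_linear_sum [OF \<phi>] orbit_module_subspace A vec.subspace_scale axis_in_orbit_module)
  also have "\<dots> = (\<Sum>C\<in>patch A arms. v $ C *s \<phi> (axis C 1))"
    using \<phi> axis_in_orbit_module [OF A] by (intro sum.cong refl) (simp add: CU_linear_def)
  finally show ?thesis .
qed

lemma CU_linear_axis:
  assumes A: "A \<in> verges" and \<phi>: "CU_linear \<theta> (orbit_module A) \<phi>" and g: "g \<in> unitri"
  shows "\<phi> (c *s act_right \<theta> g (axis A 1)) = c *s act_right \<theta> g (\<phi> (axis A 1))"
  using axis_in_orbit_module [OF A patch_self] orbit_module_submodule [OF A] \<phi> g
  by (simp add: submodule_CE_iff CU_linear_def)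

text \<open>The orbit module is cyclic with generator \<open>[A]\<close>, and equivariance carries
  agreement at \<open>[A]\<close> along the orbit.\<close>

lemma CU_linear_eqI:
  assumes A: "A \<in> verges" and \<phi>: "CU_linear \<theta> (orbit_module A) \<phi>" and \<psi>: "CU_linear \<theta> (orbit_module A) \<psi>"
    and eq: "\<phi> (axis A 1) = \<psi> (axis A 1)" and v: "v \<in> orbit_module A"
  shows "\<phi> v = \<psi> v"
proof -
  have "\<phi> (axis C 1) = \<psi> (axis C 1)" if C: "C \<in> patch A arms" for C
  proof -
    obtain g c where g: "g \<in> unitri" and e: "axis C 1 = c *s act_right \<theta> g (axis A 1)"
      using orbit_generated [OF A C] by blast
    show ?thesis unfolding e CU_linear_axis [OF A \<phi> g] CU_linear_axis [OF A \<psi> g] eq ..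
  qed
  then show ?thesis
    unfolding CU_linear_expand [OF A \<phi> v] CU_linear_expand [OF A \<psi> v] by (intro sum.cong) auto
qed

lemma CU_linear_into:
  assumes A: "A \<in> verges" and \<phi>: "CU_linear \<theta> (orbit_module A) \<phi>" and M: "submodule_CE \<theta> M"
    and im: "\<phi> (axis A 1) \<in> M" and v: "v \<in> orbit_module A"
  shows "\<phi> v \<in> M"
proof -
  have sub: "vec.subspace M" using M by (simp add: submodule_CE_iff)
  have "\<phi> (axis C 1) \<in> M" if C: "C \<in> patch A arms" for C
  proof -
    obtain g c where g: "g \<in> unitri" and e: "axis C 1 = c *s act_right \<theta> g (axis A 1)"
      using orbit_generated [OF A C] by blast
    show ?thesis unfolding e CU_linear_axis [OF A \<phi> g]
      using g im M by (intro vec.subspace_scale sub) (simp add: submodule_CE_iff)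
  qed
  then show ?thesis
    unfolding CU_linear_expand [OF A \<phi> v] by (intro vec.subspace_sum vec.subspace_scale sub)
qed

text \<open>Comparing the linear characters by which the root elements stabilising both \<open>[A]\<close> and \<open>[C]\<close>
  act on them; at a position where \<open>A\<close> and \<open>C\<close> differ, chosen as low as possible in its column,
  the root element does stabilise both.\<close>

lemma support_of_eigenvector:
  assumes A: "A \<in> verges" and v: "v \<in> CE" and nz: "v $ C \<noteq> 0"
    and eig: "\<And>g. g \<in> unitri \<Longrightarrow> trunc (A ** transpose g) = A \<Longrightarrow> act_right \<theta> g v = chi \<theta> A (mat 1 - g) *s v"
    and ne: "C $ i $ l \<noteq> A $ i $ l"
  shows "\<exists>y. i < y \<and> (y, l) \<in> p"
proof (rule ccontr)
  assume none: "\<nexists>y. i < y \<and> (y, l) \<in> p"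
  have C: "C \<in> strictly_lower" using v nz by (auto simp: CE_eq supported_def)
  define X where "X = {i. C $ i $ l \<noteq> A $ i $ l \<and> (\<nexists>y. i < y \<and> (y, l) \<in> p)}"
  have X: "finite X" "X \<noteq> {}" using none ne by (auto simp: X_def)
  define m where "m = Max X"
  have mX: "m \<in> X" and max: "\<And>x. m < x \<Longrightarrow> x \<notin> X"
    using Max_in [OF X] Max_ge [OF X(1)] by (auto simp: m_def not_less [symmetric])
  have m: "C $ m $ l \<noteq> A $ m $ l" "\<And>y. m < y \<Longrightarrow> (y, l) \<notin> p" using mX by (auto simp: X_def)
  have lm: "l < m" using m(1) C verges_lower [OF A] by (force simp: strictly_lower_nth not_less [symmetric])
  have A0: "A $ x $ l = 0" if "m < x" for x using m(2) [OF that] verges_0 [OF A] by blast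
  have C0: "C $ x $ l = 0" if "m < x" for x
    using max [OF that] A0 [OF that] m(2) that by (auto simp: X_def intro: less_trans)
  obtain t where t: "\<theta> (t * - (C $ m $ l)) \<noteq> \<theta> (t * - (A $ m $ l))"
    using theta_detects [of "- (C $ m $ l)" "- (A $ m $ l)"] m(1) by auto
  define g where "g = root_elt m l t"
  have g: "g \<in> unitri" using root_unitri [OF lm] by (simp add: g_def)
  have gA: "trunc (A ** transpose g) = A"
    unfolding g_def by (rule trunc_root_stable [OF verges_lower [OF A] lm A0])
  have gC: "trunc (C ** transpose g) = C"
    unfolding g_def by (rule trunc_root_stable [OF C lm C0])
  have "act_right \<theta> g v $ C = v $ C * chi \<theta> C (mat 1 - g)"
    using monomial_component [OF trunc_right_inj [OF g] C, of "\<lambda>C. chi \<theta> C (mat 1 - g)" v] gC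
    by (simp add: act_right_def)
  then have "chi \<theta> C (mat 1 - g) = chi \<theta> A (mat 1 - g)" using eig [OF g gA] nz by simp
  then show False using t lm
    by (simp add: chi_pairing g_def pairing_one_minus_root mult.commute)
qed

text \<open>The group elements that fix \<open>A\<close> act on \<open>[A]\<close> by scalars, and
  an equivariant map hands this property on to the image of \<open>[A]\<close>.\<close>

lemma CU_linear_support:
  assumes A: "A \<in> verges" and \<phi>: "CU_linear \<theta> (orbit_module A) \<phi>" and im: "\<phi> (axis A 1) \<in> CE"
    and nz: "\<phi> (axis A 1) $ C \<noteq> 0" and ne: "C $ i $ l \<noteq> A $ i $ l"
  shows "\<exists>y. i < y \<and> (y, l) \<in> p"
proof (rule support_of_eigenvector [OF A im nz _ ne])
  fix g assume g: "g \<in> unitri" "trunc (A ** transpose g) = A"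
  have ax: "axis A 1 \<in> orbit_module A" using axis_in_orbit_module [OF A patch_self] .
  have "act_right \<theta> g (\<phi> (axis A 1)) = \<phi> (act_right \<theta> g (axis A 1))"
    using \<phi> g ax by (simp add: CU_linear_def)
  also have "\<dots> = \<phi> (chi \<theta> A (mat 1 - g) *s axis A 1)"
    using g by (simp add: act_right_axis verges_lower [OF A])
  also have "\<dots> = chi \<theta> A (mat 1 - g) *s \<phi> (axis A 1)"
    using \<phi> ax by (simp add: CU_linear_def)
  finally show "act_right \<theta> g (\<phi> (axis A 1)) = chi \<theta> A (mat 1 - g) *s \<phi> (axis A 1)" .
qed

text \<open>A change at a main condition \<open>(i, j)\<close> would need a second arc in column
  \<open>j\<close>, so \<open>C\<close> has there both the values of \<open>A\<close> and those of
  \<open>B\<close>. A change in \<open>arms\<close> at \<open>(i, l)\<close> needs an arc in column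
  \<open>l\<close> from an index larger than \<open>i\<close>, which makes a crossing. Thus distinct
  verges with the same main conditions admit no nonzero homomorphism.\<close>

lemma CU_linear_end_support:
  assumes A: "A \<in> verges" and B: "B \<in> verges" and \<phi>: "CU_linear \<theta> (orbit_module A) \<phi>"
    and im: "\<phi> (axis A 1) \<in> orbit_module B" and nz: "\<phi> (axis A 1) $ C \<noteq> 0"
  shows "A = B" "C \<in> patch A crossings"
proof -
  have CB: "C \<in> patch B arms" using im nz B by (auto simp: orbit_module_eq supported_def)
  have CE: "\<phi> (axis A 1) \<in> CE" using orbit_module_CE [OF B] im by blast
  note supp = CU_linear_support [OF A \<phi> CE nz]
  have "A $ i $ j = B $ i $ j" for i j
  proof (cases "(i, j) \<in> p")
    case False then show ?thesis using verges_0 A B by metis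
  next
    case True
    then have "(i, j) \<notin> arms" using arc_row by (force simp: arms_def)
    then have "C $ i $ j = B $ i $ j" using CB by (simp add: patch_def)
    moreover have "C $ i $ j = A $ i $ j"
    proof (rule ccontr)
      assume "C $ i $ j \<noteq> A $ i $ j"
      then obtain y where "i < y" "(y, j) \<in> p" using supp by blast
      then show False using arc_col [OF True] by auto
    qed
    ultimately show ?thesis by simp
  qed
  then show AB: "A = B" by (simp add: vec_eq_iff)
  have "C $ i $ l = A $ i $ l" if n: "(i, l) \<notin> crossings" for i l
  proof (rule ccontr)
    assume ne: "C $ i $ l \<noteq> A $ i $ l"
    then have "(i, l) \<in> arms" using CB AB by (auto simp: patch_def)
    then obtain j where "(i, j) \<in> p" "j < l" "l < i" by (auto simp: arms_def)
    moreover obtain y where "i < y" "(y, l) \<in> p" using supp ne by blast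
    ultimately show False using n by (auto simp: crossings_def)
  qed
  then show "C \<in> patch A crossings" by (simp add: patch_def)
qed

lemma act_left_CU_linear: "g \<in> unitri \<Longrightarrow> CU_linear \<theta> M (act_left \<theta> g)"
  by (simp add: CU_linear_def act_left_linear act_left_right)

lemma act_left_orbit_module:
  assumes A: "A \<in> verges" and g: "g \<in> H" and v: "v \<in> orbit_module A"
  shows "act_left \<theta> g v \<in> orbit_module A"
proof (rule CU_linear_into [OF A act_left_CU_linear orbit_module_submodule [OF A] _ v])
  show "g \<in> unitri" using g H_unitri by blast
  have "trunc (transpose g ** A) \<in> patch A arms"
    using left_orbit_subset [OF A g] patch_mono [OF crossings_arms] by blast
  then show "act_left \<theta> g (axis A 1) \<in> orbit_module A"
    using axis_in_orbit_module [OF A] orbit_module_subspace [OF A]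
    by (simp add: act_left_axis verges_lower [OF A] vec.subspace_scale)
qed

text \<open>\<open>K\<close> fixes \<open>[A]\<close> up to this scalar, and left and right actions
  commute, so the same scalar occurs on the whole cyclic module.\<close>

lemma act_left_K:
  assumes A: "A \<in> verges" and g: "g \<in> K" and v: "v \<in> orbit_module A"
  shows "act_left \<theta> g v = chi \<theta> A (mat 1 - g) *s v"
proof (rule CU_linear_eqI [OF A act_left_CU_linear _ _ v])
  show "g \<in> unitri" using g K_H H_unitri by blast
  show "CU_linear \<theta> (orbit_module A) (\<lambda>v. chi \<theta> A (mat 1 - g) *s v)"
    by (simp add: CU_linear_def act_right_linear vec.scale_right_distrib mult.commute)
  show "act_left \<theta> g (axis A 1) = chi \<theta> A (mat 1 - g) *s axis A 1"
  proof -
    have "g \<in> H" using g K_H by blast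
    then have "trunc (transpose g ** A) = A" using left_stabiliser [OF A, of g] g by simp
    then show ?thesis by (simp add: act_left_axis verges_lower [OF A])
  qed
qed

text \<open>The image of \<open>[A]\<close> is supported on \<open>patch A crossings\<close>, the
  orbit of \<open>A\<close> under \<open>H\<close>. Hence at the generator, and so everywhere,
  \<phi> is a linear combination of left multiplications by elements of \<open>H\<close>, and these
  are scalars on \<open>S\<close>.\<close>

lemma CU_endomorphism_scalar:
  assumes A: "A \<in> verges" and \<phi>: "CU_linear \<theta> (orbit_module A) \<phi>"
    and im: "\<phi> (axis A 1) \<in> orbit_module A"
    and S: "S \<subseteq> orbit_module A" and sc: "\<And>g s. g \<in> H \<Longrightarrow> s \<in> S \<Longrightarrow> act_left \<theta> g s = \<psi> g *s s"
  shows "\<exists>c. \<forall>s\<in>S. \<phi> s = c *s s"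
proof -
  let ?w = "\<phi> (axis A 1)"
  define h where "h C = (SOME g. g \<in> H \<and> trunc (transpose g ** A) = C)" for C
  have h: "h C \<in> H" "trunc (transpose (h C) ** A) = C" if "C \<in> patch A crossings" for C
    using someI_ex [of "\<lambda>g. g \<in> H \<and> trunc (transpose g ** A) = C"] left_orbit_transitive [OF A that]
    unfolding h_def by blast+
  \<comment> \<open>Left multiplication by \<open>h C\<close> carries \<open>[A]\<close> to
    \<open>[C]\<close> times the character value in the denominator.\<close>
  define b where "b C = ?w $ C / chi \<theta> A (mat 1 - h C)" for C
  define \<Phi> where "\<Phi> v = (\<Sum>C\<in>patch A crossings. b C *s act_left \<theta> (h C) v)" for v
  have nz: "chi \<theta> A N \<noteq> 0" for N using norm_chi [of A N] by (metis norm_zero zero_neq_one)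
  have "?w \<in> supported (patch A crossings)"
    using CU_linear_end_support(2) [OF A A \<phi> im] by (auto simp: supported_def)
  then have "?w = (\<Sum>C\<in>patch A crossings. ?w $ C *s axis C 1)" by (rule supported_expand)
  also have "\<dots> = \<Phi> (axis A 1)"
    unfolding \<Phi>_def using h nz by (intro sum.cong refl) (simp add: b_def act_left_axis verges_lower [OF A])
  finally have eq: "\<phi> (axis A 1) = \<Phi> (axis A 1)" .
  have lin: "CU_linear \<theta> (orbit_module A) \<Phi>"
  proof -
    have "\<Phi> (act_right \<theta> g x) = act_right \<theta> g (\<Phi> x)" if "g \<in> unitri" for g x
      unfolding \<Phi>_def act_right_linear using h(1) H_unitri that
      by (intro sum.cong refl) (subst act_left_right, auto)
    moreover have "\<Phi> (c *s x) = c *s \<Phi> x" for c x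
      unfolding \<Phi>_def act_left_linear vec.scale_sum_right by (simp add: mult.commute)
    ultimately show ?thesis
      by (simp add: CU_linear_def) (simp add: \<Phi>_def act_left_linear vec.scale_right_distrib sum.distrib)
  qed
  have "\<phi> s = (\<Sum>C\<in>patch A crossings. b C * \<psi> (h C)) *s s" if "s \<in> S" for s
  proof -
    have "\<phi> s = \<Phi> s" using CU_linear_eqI [OF A \<phi> lin eq] S that by blast
    also have "\<dots> = (\<Sum>C\<in>patch A crossings. (b C * \<psi> (h C)) *s s)"
      unfolding \<Phi>_def using sc h that by (intro sum.cong refl) simp
    also have "\<dots> = (\<Sum>C\<in>patch A crossings. b C * \<psi> (h C)) *s s"
      by (simp add: vec.scale_sum_left)
    finally show ?thesis .
  qed
  then show ?thesis by blast
qed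

end

section \<open>Irreducible submodules\<close>

context add_character begin

lemma nsq_act_right: "g \<in> unitri \<Longrightarrow> v \<in> CE \<Longrightarrow> nsq (act_right \<theta> g v) = nsq v"
  using herm_act_right [of g v v] by (metis herm_self of_real_eq_iff)

lemma nsq_act_left: "g \<in> unitri \<Longrightarrow> v \<in> CE \<Longrightarrow> nsq (act_left \<theta> g v) = nsq v"
  using herm_act_left [of g v v] by (metis herm_self of_real_eq_iff)

lemma act_right_zero [simp]: "act_right \<theta> g 0 = 0"
  unfolding act_right_def by (rule monomial_zero)

lemma submodule_act_surj:
  assumes S: "submodule_CE \<theta> S" and g: "g \<in> unitri" and s: "s \<in> S"
  obtains s' where "s' \<in> S" "s = act_right \<theta> g s'"
proof
  show "act_right \<theta> (matrix_inv g) s \<in> S"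
    using S s unitri_inverse(1) [OF g] by (simp add: submodule_CE_iff)
  have "s \<in> CE" using S s by (auto simp: submodule_CE_iff)
  then show "s = act_right \<theta> g (act_right \<theta> (matrix_inv g) s)"
    using unitri_inverse [OF g] g by (simp add: act_right_comp act_right_one)
qed

text \<open>A unitary operator mapping \<open>S\<close> onto itself also preserves orthogonality to
  \<open>S\<close>.\<close>

lemma proj_act_right:
  assumes S: "submodule_CE \<theta> S" and g: "g \<in> unitri" and x: "x \<in> CE"
  shows "proj S (act_right \<theta> g x) = act_right \<theta> g (proj S x)"
proof (rule proj_unique)
  show sub: "vec.subspace S" using S by (simp add: submodule_CE_iff)
  show "act_right \<theta> g (proj S x) \<in> S" using S g proj_in [OF sub] by (simp add: submodule_CE_iff)
  have d: "x - proj S x \<in> CE"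
    using x S proj_in [OF sub, of x] vec.subspace_diff supported_subspace
    unfolding CE_eq submodule_CE_iff by blast
  fix s assume "s \<in> S"
  then obtain s' where s': "s' \<in> S" "s = act_right \<theta> g s'" using submodule_act_surj [OF S g] by blast
  have "herm (act_right \<theta> g x - act_right \<theta> g (proj S x)) s
      = herm (act_right \<theta> g (x - proj S x)) (act_right \<theta> g s')"
    by (simp add: s' act_right_linear)
  also have "\<dots> = herm (x - proj S x) s'" by (rule herm_act_right [OF g d])
  also have "\<dots> = 0" using proj_orth [OF sub s'(1)] .
  finally show "herm (act_right \<theta> g x - act_right \<theta> g (proj S x)) s = 0" .
qed

lemma proj_CU_linear:
  assumes "submodule_CE \<theta> S" "M \<subseteq> CE" shows "CU_linear \<theta> M (proj S)"
  using assms proj_act_right by (auto simp: CU_linear_def proj_add proj_smult)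

section \<open>Complete reducibility from the invariant inner product\<close>

lemma exists_irreducible_submodule:
  assumes M: "submodule_CE \<theta> M" and "M \<noteq> {0}"
  shows "\<exists>S. irreducible_CU \<theta> S \<and> S \<subseteq> M"
proof -
  define P where "P S \<longleftrightarrow> submodule_CE \<theta> S \<and> S \<noteq> {0} \<and> S \<subseteq> M" for S
  have "P M" using assms by (simp add: P_def)
  then obtain S where S: "P S" "\<And>N. P N \<Longrightarrow> vec.dim S \<le> vec.dim N"
    using ex_has_least_nat [of P M vec.dim] by blast
  have "N = {0} \<or> N = S" if "submodule_CE \<theta> N" "N \<subseteq> S" for N
  proof (cases "N = {0}")
    case False
    then have "P N" using that S(1) by (auto simp: P_def)
    then have "vec.dim S \<le> vec.dim N" using S(2) by blast
    then show ?thesis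
      using vec.subspace_dim_equal [of N S] that S(1) by (simp add: P_def submodule_CE_iff)
  qed simp
  then have "irreducible_CU \<theta> S" using S(1) unfolding irreducible_CU_def P_def by blast
  then show ?thesis using S(1) unfolding P_def by blast
qed

text \<open>Split off an irreducible submodule and continue in its orthogonal complement, a
  submodule because the action is unitary. Orthogonality is recorded so that components are simply
  projections.\<close>

lemma orthogonal_decomposition:
  assumes "submodule_CE \<theta> M"
  shows "\<exists>\<D>. finite \<D> \<and> \<D> \<subseteq> irr_constituents \<theta> M \<and>
    (\<forall>S\<in>\<D>. \<forall>T\<in>\<D>. S \<noteq> T \<longrightarrow> (\<forall>x\<in>S. \<forall>y\<in>T. herm x y = 0)) \<and>
    (\<forall>x\<in>M. x = (\<Sum>S\<in>\<D>. proj S x))"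
  using assms
proof (induction "vec.dim M" arbitrary: M rule: less_induct)
  case less
  show ?case
  proof (cases "M = {0}")
    case True then show ?thesis by (intro exI [of _ "{}"]) simp
  next
    case False
    then obtain S where S: "irreducible_CU \<theta> S" "S \<subseteq> M"
      using exists_irreducible_submodule less.prems by blast
    then have Ssub: "submodule_CE \<theta> S" "vec.subspace S" "S \<noteq> {0}"
      by (auto simp: irreducible_CU_def submodule_CE_iff)
    have Msub: "vec.subspace M" "M \<subseteq> CE" using less.prems by (auto simp: submodule_CE_iff)
    define N where "N = {x \<in> M. \<forall>s\<in>S. herm x s = 0}"
    have Nsub: "vec.subspace N"
      using Msub vec.subspace_0 [OF Msub(1)] vec.subspace_add [OF Msub(1)] vec.subspace_scale [OF Msub(1)]
      by (intro vec.subspaceI) (auto simp: N_def herm_add_left herm_smult_left)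
    have "act_right \<theta> g x \<in> N" if g: "g \<in> unitri" and x: "x \<in> N" for g x
    proof -
      have "herm (act_right \<theta> g x) s = 0" if s: "s \<in> S" for s
      proof -
        obtain s' where "s' \<in> S" "s = act_right \<theta> g s'"
          using submodule_act_surj [OF Ssub(1) g s] by blast
        then show ?thesis using x Msub herm_act_right [OF g, of x s'] by (auto simp: N_def)
      qed
      moreover have "act_right \<theta> g x \<in> M" using g x less.prems by (simp add: N_def submodule_CE_iff)
      ultimately show ?thesis by (simp add: N_def)
    qed
    then have N: "submodule_CE \<theta> N" using Nsub Msub by (auto simp: submodule_CE_iff N_def)
    have NM: "N \<subseteq> M" by (auto simp: N_def)
    have "N \<noteq> M"
    proof
      assume "N = M"
      then have "herm x x = 0" if "x \<in> S" for x using that S(2) by (auto simp: N_def)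
      then show False using Ssub(2,3) vec.subspace_0 by (auto simp: herm_self_eq_0_iff)
    qed
    then have "vec.dim N < vec.dim M"
      using vec.subspace_dim_equal [OF Nsub Msub(1) NM] by force
    then obtain \<D> where D: "finite \<D>" "\<D> \<subseteq> irr_constituents \<theta> N"
      "\<And>S T x y. S \<in> \<D> \<Longrightarrow> T \<in> \<D> \<Longrightarrow> S \<noteq> T \<Longrightarrow> x \<in> S \<Longrightarrow> y \<in> T \<Longrightarrow> herm x y = 0"
      "\<And>x. x \<in> N \<Longrightarrow> x = (\<Sum>T\<in>\<D>. proj T x)"
      using less.hyps [OF _ N] by metis
    have DN: "T \<subseteq> N" "submodule_CE \<theta> T" "vec.subspace T" "T \<noteq> {0}" if "T \<in> \<D>" for T
      using that D(2) by (auto simp: irr_constituents_def irreducible_CU_def submodule_CE_iff)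
    have orth: "herm x s = 0" "herm s x = 0" if "T \<in> \<D>" "x \<in> T" "s \<in> S" for T x s
      using DN(1) [OF that(1)] that herm_commute [of s x] by (auto simp: N_def)
    have SD: "S \<notin> \<D>"
    proof
      assume "S \<in> \<D>"
      then have "herm x x = 0" if "x \<in> S" for x using orth that by blast
      then show False using Ssub(2,3) vec.subspace_0 by (auto simp: herm_self_eq_0_iff)
    qed
    have "x = (\<Sum>T\<in>insert S \<D>. proj T x)" if x: "x \<in> M" for x
    proof -
      define y where "y = x - proj S x"
      have "y \<in> M" unfolding y_def using x S(2) proj_in [OF Ssub(2)]
        by (intro vec.subspace_diff [OF Msub(1)]) auto
      then have yN: "y \<in> N" using proj_orth [OF Ssub(2)] by (simp add: N_def y_def)
      \<comment> \<open>The part of \<open>x\<close> removed in passing to \<open>y\<close> lies in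
        \<open>S\<close>, which is orthogonal to \<open>T\<close>.\<close>
      have "proj T y = proj T x" if T: "T \<in> \<D>" for T
      proof (rule proj_unique [OF DN(3) [OF T] proj_in [OF DN(3) [OF T]]])
        fix t assume t: "t \<in> T"
        have "herm (proj S x) t = 0" using orth T t proj_in [OF Ssub(2)] by blast
        then show "herm (y - proj T x) t = 0"
          using proj_orth [OF DN(3) [OF T] t, of x] by (simp add: y_def herm_diff_left)
      qed
      then have "y = (\<Sum>T\<in>\<D>. proj T x)" using D(4) [OF yN] by simp
      then show ?thesis using D(1) SD by (simp add: y_def algebra_simps)
    qed
    moreover have "insert S \<D> \<subseteq> irr_constituents \<theta> M"
      using S D(2) NM by (auto simp: irr_constituents_def)
    moreover have "\<forall>S'\<in>insert S \<D>. \<forall>T\<in>insert S \<D>. S' \<noteq> T \<longrightarrow> (\<forall>x\<in>S'. \<forall>y\<in>T. herm x y = 0)"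
      using D(3) orth by blast
    ultimately show ?thesis using D(1) by (intro exI [of _ "insert S \<D>"]) auto
  qed
qed

lemma irr_decomposition_exists:
  assumes "submodule_CE \<theta> M" shows "\<exists>\<D>. irr_decomposition \<theta> M \<D>"
proof -
  obtain \<D> where D: "finite \<D>" "\<D> \<subseteq> irr_constituents \<theta> M"
      "\<And>S T x y. S \<in> \<D> \<Longrightarrow> T \<in> \<D> \<Longrightarrow> S \<noteq> T \<Longrightarrow> x \<in> S \<Longrightarrow> y \<in> T \<Longrightarrow> herm x y = 0"
      "\<And>x. x \<in> M \<Longrightarrow> x = (\<Sum>T\<in>\<D>. proj T x)"
    using orthogonal_decomposition [OF assms] by metis
  have sub: "vec.subspace T" if "T \<in> \<D>" for T
    using that D(2) by (auto simp: irr_constituents_def irreducible_CU_def submodule_CE_iff)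
  have "\<exists>!f. f \<in> (\<Pi>\<^sub>E S\<in>\<D>. S) \<and> x = (\<Sum>S\<in>\<D>. f S)" if x: "x \<in> M" for x
  proof (rule ex1I [of _ "restrict (\<lambda>S. proj S x) \<D>"])
    show "restrict (\<lambda>S. proj S x) \<D> \<in> (\<Pi>\<^sub>E S\<in>\<D>. S) \<and> x = (\<Sum>S\<in>\<D>. restrict (\<lambda>S. proj S x) \<D> S)"
      using D(4) [OF x] proj_in [OF sub] by simp
  next
    fix f assume f: "f \<in> (\<Pi>\<^sub>E S\<in>\<D>. S) \<and> x = (\<Sum>S\<in>\<D>. f S)"
    show "f = restrict (\<lambda>S. proj S x) \<D>"
    proof (rule PiE_ext [where k = \<D> and s = "\<lambda>S. S"])
      fix T assume T: "T \<in> \<D>"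
      have "proj T x = f T"
      proof (rule proj_unique [OF sub [OF T]])
        show "f T \<in> T" using f T by auto
        fix t assume t: "t \<in> T"
        have "x - f T = (\<Sum>S\<in>\<D> - {T}. f S)"
          using f sum.remove [OF D(1) T, of f] by simp
        moreover have "herm (\<Sum>S\<in>\<D> - {T}. f S) t = 0"
          unfolding herm_sum_left using D(3) [OF _ T _ _ t] f by (intro sum.neutral) auto
        ultimately show "herm (x - f T) t = 0" by simp
      qed
      then show "f T = restrict (\<lambda>S. proj S x) \<D> T" using T by simp
    next
      show "f \<in> (\<Pi>\<^sub>E S\<in>\<D>. S)" using f by blast
      show "restrict (\<lambda>S. proj S x) \<D> \<in> (\<Pi>\<^sub>E S\<in>\<D>. S)" by (intro restrict_PiE_iff [THEN iffD2] ballI proj_in sub)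
    qed
  qed
  then have "\<forall>x\<in>M. \<exists>!f. f \<in> (\<Pi>\<^sub>E S\<in>\<D>. S) \<and> x = (\<Sum>S\<in>\<D>. f S)" by (intro ballI)
  then have "irr_decomposition \<theta> M \<D>" unfolding irr_decomposition_def using D(1,2) by (intro conjI)
  then show ?thesis by (rule exI)
qed

lemma iso_CU_refl:
  assumes "submodule_CE \<theta> S" shows "(S, S) \<in> iso_CU \<theta>"
proof -
  have "restrict (\<lambda>x. x) S \<in> Hom_CU \<theta> S S"
    using assms by (auto simp: Hom_CU_iff CU_linear_def submodule_CE_iff vec.subspace_add vec.subspace_scale)
  moreover have "bij_betw (restrict (\<lambda>x. x) S) S S" by (simp add: bij_betw_def inj_on_def)
  ultimately show ?thesis using assms unfolding iso_CU_def by blast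
qed

text \<open>A given decomposition may fail to be orthogonal, so its component maps are taken from
  the uniqueness of the expansion and not from \<open>proj\<close>. Uniqueness also makes them
  linear and equivariant.\<close>

lemma irr_decomposition_components:
  fixes M :: "('f, 'n::{finite,linorder}) evec set"
  assumes D: "irr_decomposition \<theta> M \<D>" and M: "submodule_CE \<theta> M"
  obtains F where "\<And>x. x \<in> M \<Longrightarrow> x = (\<Sum>T\<in>\<D>. F x T)" "\<And>x T. x \<in> M \<Longrightarrow> T \<in> \<D> \<Longrightarrow> F x T \<in> T"
    "\<And>T. T \<in> \<D> \<Longrightarrow> CU_linear \<theta> M (\<lambda>x. F x T)"
proof -
  have sub: "vec.subspace T" "submodule_CE \<theta> T" if "T \<in> \<D>" for T
    using that D by (auto simp: irr_decomposition_def irr_constituents_def irreducible_CU_def submodule_CE_iff)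
  have Msub: "vec.subspace M" using M by (simp add: submodule_CE_iff)
  have ex: "\<exists>!f. f \<in> (\<Pi>\<^sub>E S\<in>\<D>. S) \<and> x = (\<Sum>S\<in>\<D>. f S)" if "x \<in> M" for x
    using D that by (simp add: irr_decomposition_def)
  define F where "F x = (THE f. f \<in> (\<Pi>\<^sub>E S\<in>\<D>. S) \<and> x = (\<Sum>S\<in>\<D>. f S))" for x
  have F: "F x \<in> (\<Pi>\<^sub>E S\<in>\<D>. S)" "x = (\<Sum>S\<in>\<D>. F x S)" if "x \<in> M" for x
    using theI' [OF ex [OF that]] by (simp_all add: F_def)
  have uniq: "F x T = f T" if "x \<in> M" "T \<in> \<D>" "\<And>T. T \<in> \<D> \<Longrightarrow> f T \<in> T" "x = (\<Sum>S\<in>\<D>. f S)" for x T f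
  proof -
    have "restrict f \<D> \<in> (\<Pi>\<^sub>E S\<in>\<D>. S) \<and> x = (\<Sum>S\<in>\<D>. restrict f \<D> S)" using that by simp
    then have "F x = restrict f \<D>" unfolding F_def by (rule the1_equality [OF ex [OF that(1)]])
    then show ?thesis using that(2) by simp
  qed
  have FT: "F x T \<in> T" if "x \<in> M" "T \<in> \<D>" for x T using F(1) [OF that(1)] that(2) by auto
  show thesis
  proof (rule that [of F])
    show "x = (\<Sum>T\<in>\<D>. F x T)" if "x \<in> M" for x using F(2) [OF that] .
    show "F x T \<in> T" if "x \<in> M" "T \<in> \<D>" for x T using FT that .
    show "CU_linear \<theta> M (\<lambda>x. F x T)" if T: "T \<in> \<D>" for T
      unfolding CU_linear_def
    proof (intro conjI ballI allI)
      fix x y assume xy: "x \<in> M" "y \<in> M"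
      show "F (x + y) T = F x T + F y T"
      proof (rule uniq [OF vec.subspace_add [OF Msub xy] T])
        show "x + y = (\<Sum>T\<in>\<D>. F x T + F y T)"
          using F(2) [OF xy(1)] F(2) [OF xy(2)] by (simp add: sum.distrib)
      qed (intro vec.subspace_add sub FT xy)
    next
      fix c x assume x: "x \<in> M"
      show "F (c *s x) T = c *s F x T"
      proof (rule uniq [OF vec.subspace_scale [OF Msub x] T])
        show "c *s x = (\<Sum>T\<in>\<D>. c *s F x T)"
          using F(2) [OF x] by (metis vec.scale_sum_right)
      qed (intro vec.subspace_scale sub FT x)
    next
      fix g :: "('f, 'n) sqmat" and x assume g: "g \<in> unitri" and x: "x \<in> M"
      show "F (act_right \<theta> g x) T = act_right \<theta> g (F x T)"
      proof (rule uniq [OF _ T])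
        show "act_right \<theta> g x \<in> M" using g x M by (simp add: submodule_CE_iff)
        show "act_right \<theta> g x = (\<Sum>T\<in>\<D>. act_right \<theta> g (F x T))"
          using F(2) [OF x] by (metis act_right_linear(4))
        show "act_right \<theta> g (F x T) \<in> T" if "T \<in> \<D>" for T
          using sub(2) [OF that] FT [OF x that] g by (simp add: submodule_CE_iff)
      qed
    qed
  qed
qed

end

section \<open>Eigenspaces of linear characters and the submodules of minimal dimension\<close>

context orbit_setting begin

text \<open>The unitary linear characters of \<open>H\<close> extending the character \<lambda> of
  \<open>K\<close>. Values outside \<open>H\<close> are arbitrary, so such functions are compared on
  \<open>H\<close> only.\<close>

definition hchar :: "('f, 'n) sqmat \<Rightarrow> (('f, 'n) sqmat \<Rightarrow> complex) \<Rightarrow> bool" where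
  "hchar A \<psi> \<longleftrightarrow> (\<forall>g\<in>H. \<forall>h\<in>H. \<psi> (g ** h) = \<psi> g * \<psi> h) \<and> (\<forall>g\<in>H. cmod (\<psi> g) = 1) \<and>
     (\<forall>g\<in>K. \<psi> g = chi \<theta> A (mat 1 - g))"

definition eigenspace :: "('f, 'n) sqmat \<Rightarrow> (('f, 'n) sqmat \<Rightarrow> complex) \<Rightarrow> ('f, 'n) evec set" where
  "eigenspace A \<psi> = {v \<in> orbit_module A. \<forall>g\<in>H. act_left \<theta> g v = \<psi> g *s v}"

lemma eigenspace_submodule:
  assumes A: "A \<in> verges" shows "submodule_CE \<theta> (eigenspace A \<psi>)"
proof -
  have M: "submodule_CE \<theta> (orbit_module A)" by (rule orbit_module_submodule [OF A])
  then have Msub: "vec.subspace (orbit_module A)" by (simp add: submodule_CE_iff)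
  have z: "act_left \<theta> g 0 = 0" for g using act_left_linear(2) [of g 0 0] by simp
  have "vec.subspace (eigenspace A \<psi>)"
    using vec.subspace_0 [OF Msub] vec.subspace_add [OF Msub] vec.subspace_scale [OF Msub]
    by (intro vec.subspaceI)
      (auto simp: eigenspace_def act_left_linear vec.scale_right_distrib mult.commute z)
  moreover have "act_right \<theta> g v \<in> eigenspace A \<psi>" if g: "g \<in> unitri" and v: "v \<in> eigenspace A \<psi>" for g v
  proof -
    have "act_left \<theta> h (act_right \<theta> g v) = \<psi> h *s act_right \<theta> g v" if h: "h \<in> H" for h
    proof -
      have "h \<in> unitri" using h H_unitri by blast
      then show ?thesis using v h g by (simp add: act_left_right eigenspace_def act_right_linear)
    qed
    then show ?thesis using v g M by (simp add: eigenspace_def submodule_CE_iff)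
  qed
  ultimately show ?thesis using orbit_module_CE [OF A]
    by (auto simp: submodule_CE_iff eigenspace_def)
qed

text \<open>Up to a phase \<open>[C]\<close> is a translate of \<open>[A]\<close>, and the
  projection commutes with the unitary translations.\<close>

lemma nsq_proj_orbit:
  assumes A: "A \<in> verges" and S: "submodule_CE \<theta> S" and C: "C \<in> patch A arms"
  shows "nsq (proj S (axis C 1)) = nsq (proj S (axis A 1))"
proof -
  obtain g c where g: "g \<in> unitri" "cmod c = 1" and e: "axis C 1 = c *s act_right \<theta> g (axis A 1)"
    using orbit_generated [OF A C] by blast
  have ax: "axis A 1 \<in> CE" using verges_lower [OF A] by (simp add: CE_eq axis_in_supported)
  have "proj S (axis A 1) \<in> CE" using S proj_in by (auto simp: submodule_CE_iff)
  then show ?thesis unfolding e proj_smult proj_act_right [OF S g(1) ax]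
    using g by (simp add: nsq_smult nsq_act_right)
qed

lemma dim_submodule:
  assumes A: "A \<in> verges" and S: "submodule_CE \<theta> S" and sub: "S \<subseteq> orbit_module A"
  shows "real (vec.dim S) = real (CARD('f) ^ card arms) * nsq (proj S (axis A 1))"
proof -
  have "real (vec.dim S) = (\<Sum>C\<in>patch A arms. nsq (proj S (axis C 1)))"
    using S sub A by (intro dim_eq_sum_nsq_proj) (auto simp: submodule_CE_iff orbit_module_eq supported_def)
  also have "\<dots> = (\<Sum>C\<in>patch A arms. nsq (proj S (axis A 1)))"
    by (intro sum.cong refl nsq_proj_orbit A S)
  finally show ?thesis by (simp add: card_patch)
qed

lemma hchar_one: "hchar A \<psi> \<Longrightarrow> \<psi> (mat 1) = 1"
  using K_one by (simp add: hchar_def chi_pairing)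

lemma hchar_nz: "hchar A \<psi> \<Longrightarrow> g \<in> H \<Longrightarrow> \<psi> g \<noteq> 0"
  unfolding hchar_def by (metis norm_zero zero_neq_one)

text \<open>The right-hand side is the averaging idempotent of \<psi>. It is an orthogonal
  projection because \<psi> has modulus one and the left action is unitary.\<close>

lemma proj_eigenspace:
  assumes A: "A \<in> verges" and \<psi>: "hchar A \<psi>" and x: "x \<in> orbit_module A"
  shows "proj (eigenspace A \<psi>) x = (1 / of_nat (card H)) *s (\<Sum>g\<in>H. inverse (\<psi> g) *s act_left \<theta> g x)"
    (is "_ = ?y")
proof (rule proj_unique)
  let ?s = "\<Sum>g\<in>H. inverse (\<psi> g) *s act_left \<theta> g x"
  have Msub: "vec.subspace (orbit_module A)" by (rule orbit_module_subspace [OF A])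
  show "vec.subspace (eigenspace A \<psi>)" using eigenspace_submodule [OF A] by (simp add: submodule_CE_iff)
  have Hne: "card H \<noteq> 0" using H_one by (auto simp: card_eq_0_iff)
  have "act_left \<theta> h ?s = \<psi> h *s ?s" if h: "h \<in> H" for h
  proof -
    have "act_left \<theta> h ?s = (\<Sum>g\<in>H. inverse (\<psi> g) *s act_left \<theta> (g ** h) x)"
      unfolding act_left_linear using H_unitri h
      by (intro sum.cong refl) (subst act_left_comp, auto)
    also have "\<dots> = (\<Sum>g\<in>H. \<psi> h *s (inverse (\<psi> (g ** h)) *s act_left \<theta> (g ** h) x))"
      using \<psi> h hchar_nz [OF \<psi>] by (intro sum.cong refl) (simp add: hchar_def)
    \<comment> \<open>The left action reverses products, so the summation index is shifted by right
      multiplication with \<open>h\<close>.\<close>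
    also have "\<dots> = (\<Sum>g\<in>H. \<psi> h *s (inverse (\<psi> g) *s act_left \<theta> g x))"
      using H_inverse [OF h] h H_mult
      by (intro sum.reindex_bij_witness [of _ "\<lambda>g. g ** matrix_inv h" "\<lambda>g. g ** h"])
        (auto simp: matrix_mul_assoc [symmetric])
    finally show ?thesis by (simp add: vec.scale_sum_right)
  qed
  moreover have "?s \<in> orbit_module A"
    by (intro vec.subspace_sum vec.subspace_scale Msub act_left_orbit_module [OF A] x)
  ultimately show "?y \<in> eigenspace A \<psi>"
    using vec.subspace_scale [OF Msub] by (simp add: eigenspace_def act_left_linear mult.commute)
  fix s assume s: "s \<in> eigenspace A \<psi>"
  have "herm (inverse (\<psi> g) *s act_left \<theta> g x) s = herm x s" if g: "g \<in> H" for g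
  proof -
    have gu: "g \<in> unitri" using g H_unitri by blast
    have "s = inverse (\<psi> g) *s act_left \<theta> g s" using s g hchar_nz [OF \<psi> g] by (simp add: eigenspace_def)
    then have "herm (inverse (\<psi> g) *s act_left \<theta> g x) s
        = herm (inverse (\<psi> g) *s act_left \<theta> g x) (inverse (\<psi> g) *s act_left \<theta> g s)" by simp
    also have "\<dots> = inverse (\<psi> g) * cnj (inverse (\<psi> g)) * herm x s"
      using x orbit_module_CE [OF A] gu
      by (simp only: herm_smult_left herm_smult_right) (subst herm_act_left, auto)
    also have "inverse (\<psi> g) * cnj (inverse (\<psi> g)) = 1"
      using \<psi> g by (simp add: complex_norm_square [symmetric] hchar_def norm_inverse del: complex_cnj_inverse)
    finally show ?thesis by simp
  qed
  then have "herm ?s s = of_nat (card H) * herm x s" by (simp add: herm_sum_left)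
  then show "herm (x - ?y) s = 0" using Hne by (simp add: herm_diff_left herm_smult_left)
qed

text \<open>The squared length is the coefficient at \<open>A\<close> of the projection of
  \<open>[A]\<close>. In the average over \<open>H\<close> only the elements of \<open>K\<close>
  return to \<open>A\<close>, each contributing 1, so the value is
  \<open>card K / card H\<close>.\<close>

lemma nsq_proj_eigenspace:
  assumes A: "A \<in> verges" and \<psi>: "hchar A \<psi>"
  shows "nsq (proj (eigenspace A \<psi>) (axis A 1)) = 1 / real (CARD('f) ^ card crossings)"
proof -
  have sub: "vec.subspace (eigenspace A \<psi>)" using eigenspace_submodule [OF A] by (simp add: submodule_CE_iff)
  have val: "inverse (\<psi> g) * act_left \<theta> g (axis A 1) $ A = (if g \<in> K then 1 else 0)" if g: "g \<in> H" for g
  proof (cases "g \<in> K")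
    case True
    then have "act_left \<theta> g (axis A 1) = \<psi> g *s axis A 1"
      using act_left_K [OF A True axis_in_orbit_module [OF A patch_self]] \<psi> by (simp add: hchar_def)
    then show ?thesis using True hchar_nz [OF \<psi> g] by simp
  next
    case False
    then have "trunc (transpose g ** A) \<noteq> A" using left_stabiliser [OF A g] by simp
    then show ?thesis using False
      by (simp add: act_left_axis verges_lower [OF A]) (simp add: axis_def)
  qed
  have "complex_of_real (nsq (proj (eigenspace A \<psi>) (axis A 1))) = proj (eigenspace A \<psi>) (axis A 1) $ A"
    using nsq_proj [OF sub] by (simp add: herm_axis_right)
  also have "\<dots> = (1 / of_nat (card H)) * (\<Sum>g\<in>H. inverse (\<psi> g) * act_left \<theta> g (axis A 1) $ A)"
    using proj_eigenspace [OF A \<psi> axis_in_orbit_module [OF A patch_self]] by (simp add: sum_component)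
  also have "(\<Sum>g\<in>H. inverse (\<psi> g) * act_left \<theta> g (axis A 1) $ A) = (\<Sum>g\<in>H. if g \<in> K then 1 else 0)"
    using val by (intro sum.cong refl) simp
  also have "\<dots> = of_nat (card K)" using K_H by (simp add: sum.If_cases Int_absorb1)
  also have "(1 / of_nat (card H)) * of_nat (card K) = complex_of_real (1 / real (CARD('f) ^ card crossings))"
  proof -
    have "card K \<noteq> 0" using K_one by (auto simp: card_eq_0_iff)
    then show ?thesis by (simp add: card_H)
  qed
  finally show ?thesis using of_real_eq_iff by blast
qed

lemma card_crossings_le: "card crossings \<le> card arms"
  by (simp add: card_mono crossings_arms)

lemma dim_eq_iff:
  assumes A: "A \<in> verges" and S: "submodule_CE \<theta> S" and sub: "S \<subseteq> orbit_module A"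
  shows "vec.dim S = CARD('f) ^ (card arms - card crossings)
    \<longleftrightarrow> nsq (proj S (axis A 1)) = 1 / real (CARD('f) ^ card crossings)"
proof -
  have "real (CARD('f) ^ card arms)
      = real (CARD('f) ^ (card arms - card crossings)) * real (CARD('f) ^ card crossings)"
    using card_crossings_le by (simp flip: power_add of_nat_mult)
  then have "real (vec.dim S) = real (CARD('f) ^ (card arms - card crossings)) *
      (real (CARD('f) ^ card crossings) * nsq (proj S (axis A 1)))"
    using dim_submodule [OF assms] by simp
  moreover have "real (CARD('f) ^ k) > 0" for k by simp
  ultimately have "real (vec.dim S) = real (CARD('f) ^ (card arms - card crossings)) \<longleftrightarrow>
      real (CARD('f) ^ card crossings) * nsq (proj S (axis A 1)) = 1" by simp
  then show ?thesis by (simp only: of_nat_eq_iff) (simp add: field_simps)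
qed

lemma eigenspace_nontrivial:
  assumes A: "A \<in> verges" and \<psi>: "hchar A \<psi>"
  obtains s where "s \<in> eigenspace A \<psi>" "s \<noteq> 0"
proof
  show "proj (eigenspace A \<psi>) (axis A 1) \<in> eigenspace A \<psi>"
    using eigenspace_submodule [OF A, of \<psi>] by (simp add: submodule_CE_iff proj_in)
  show "proj (eigenspace A \<psi>) (axis A 1) \<noteq> 0"
    using nsq_proj_eigenspace [OF A \<psi>] nsq_eq_0_iff [of "proj (eigenspace A \<psi>) (axis A 1)"] by auto
qed

text \<open>The projection to a submodule \<open>N\<close> is a scalar on the eigenspace; it fixes a
  nonzero vector of \<open>N\<close>, so the scalar is 1 and \<open>N\<close> is everything.\<close>

lemma eigenspace_irreducible:
  assumes A: "A \<in> verges" and \<psi>: "hchar A \<psi>"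
  shows "irreducible_CU \<theta> (eigenspace A \<psi>)"
proof -
  have "N = {0} \<or> N = eigenspace A \<psi>" if N: "submodule_CE \<theta> N" "N \<subseteq> eigenspace A \<psi>" for N
  proof (cases "N = {0}")
    case False
    have Nsub: "vec.subspace N" using N by (simp add: submodule_CE_iff)
    then obtain s where s: "s \<in> N" "s \<noteq> 0" using False vec.subspace_0 by blast
    have E: "eigenspace A \<psi> \<subseteq> orbit_module A" by (auto simp: eigenspace_def)
    obtain c where c: "\<And>s. s \<in> eigenspace A \<psi> \<Longrightarrow> proj N s = c *s s"
      using CU_endomorphism_scalar [OF A proj_CU_linear [OF N(1) orbit_module_CE [OF A]] _ E, of \<psi>]
        proj_in [OF Nsub] N(2) E by (auto simp: eigenspace_def subset_iff)
    have "c *s s = s" using c [of s] proj_id [OF Nsub s(1)] s(1) N(2) by auto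
    then have "c = 1" using s(2) by (metis vec.scale_right_imp_eq vec.scale_one)
    then have "eigenspace A \<psi> \<subseteq> N" using c proj_in [OF Nsub] by (metis subsetI vec.scale_one)
    then show ?thesis using N(2) by blast
  qed simp
  moreover obtain s where "s \<in> eigenspace A \<psi>" "s \<noteq> 0" using eigenspace_nontrivial [OF A \<psi>] .
  ultimately show ?thesis using eigenspace_submodule [OF A] by (auto simp: irreducible_CU_def)
qed

text \<open>If \<open>w\<close> is the projection of \<open>[A]\<close> to \<open>S\<close>, the Cauchy--Schwarz inequality bounds each of the
  \<open>q ^ b\<close> coordinates of \<open>w\<close> by the square of its norm, which is \<open>q ^ (- b)\<close>.  Hence equality holds
  everywhere, and the projections of the \<open>H\<close>-translates of \<open>[A]\<close> are all proportional to \<open>w\<close>.\<close>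

lemma minimal_submodule_scalar:
  assumes A: "A \<in> verges" and S: "submodule_CE \<theta> S" "S \<subseteq> orbit_module A"
    and dim: "vec.dim S = CARD('f) ^ (card arms - card crossings)" and g: "g \<in> H"
  shows "\<exists>k. cmod k = 1 \<and> (\<forall>s\<in>S. act_left \<theta> g s = k *s s)"
proof -
  define \<epsilon> where "\<epsilon> = 1 / real (CARD('f) ^ card crossings)"
  define w where "w = proj S (axis A 1)"
  have sub: "vec.subspace S" using S by (simp add: submodule_CE_iff)
  have eps: "\<epsilon> > 0" by (simp add: \<epsilon>_def)
  have nw: "nsq w = \<epsilon>" using dim_eq_iff [OF A S] dim by (simp add: w_def \<epsilon>_def)
  have nC: "nsq (proj S (axis C 1)) = \<epsilon>" if "C \<in> patch A arms" for C
    using nsq_proj_orbit [OF A S(1) that] nw by (simp add: w_def)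
  have cr: "C \<in> patch A arms" if "C \<in> patch A crossings" for C
    using that patch_mono [OF crossings_arms] by blast
  have lin: "CU_linear \<theta> (orbit_module A) (proj S)"
    by (rule proj_CU_linear [OF S(1) orbit_module_CE [OF A]])
  have im: "proj S (axis A 1) \<in> orbit_module A" using proj_in [OF sub] S(2) by blast
  have wC: "herm w (proj S (axis C 1)) = w $ C" for C
    by (simp add: w_def herm_proj_proj [OF sub] herm_axis_right)
  have le: "(cmod (w $ C))\<^sup>2 \<le> \<epsilon> * \<epsilon>" if "C \<in> patch A crossings" for C
    using herm_Cauchy_Schwarz [of w "proj S (axis C 1)"] nC [OF cr [OF that]] nw by (simp add: wC)
  have "\<epsilon> = (\<Sum>C\<in>patch A crossings. (cmod (w $ C))\<^sup>2)"
    unfolding nw [symmetric] nsq_def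
    using CU_linear_end_support(2) [OF A A lin im] by (intro sum.mono_neutral_right) (auto simp: w_def)
  moreover have "\<epsilon> = (\<Sum>C\<in>patch A crossings. \<epsilon> * \<epsilon>)" by (simp add: card_patch \<epsilon>_def)
  ultimately have "(\<Sum>C\<in>patch A crossings. \<epsilon> * \<epsilon> - (cmod (w $ C))\<^sup>2) = 0"
    by (simp only: sum_subtractf)
  then have eq: "(cmod (w $ C))\<^sup>2 = \<epsilon> * \<epsilon>" if "C \<in> patch A crossings" for C
    using le that by (subst (asm) sum_nonneg_eq_0_iff) auto
  define C where "C = trunc (transpose g ** A)"
  have C: "C \<in> patch A crossings" using left_orbit_subset [OF A g] by (simp add: C_def)
  define z where "z = proj S (axis C 1)"
  have nz: "nsq z = \<epsilon>" using nC [OF cr [OF C]] by (simp add: z_def)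
  then have z0: "z \<noteq> 0" using eps nsq_eq_0_iff [of z] by auto
  have "(cmod (herm w z))\<^sup>2 = nsq w * nsq z" using eq [OF C] nw nz by (simp add: wC z_def)
  then obtain c where c: "w = c *s z" using herm_Cauchy_Schwarz_eq [OF z0] by blast
  have c0: "c \<noteq> 0" using c nw eps by (auto simp: nsq_def)
  define k where "k = chi \<theta> A (mat 1 - g) * inverse c"
  have zc: "z = inverse c *s w" using c c0 by simp
  have gA: "proj S (act_left \<theta> g (axis A 1)) = k *s w"
    using zc by (simp add: act_left_axis verges_lower [OF A] C_def [symmetric] proj_smult z_def [symmetric] k_def)
  have "cmod c = 1" using c nw nz eps by (simp add: nsq_smult power2_eq_1_iff)
    (smt (verit) norm_ge_zero)
  then have k1: "cmod k = 1" by (simp add: k_def norm_mult norm_inverse)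
  have gu: "g \<in> unitri" using g H_unitri by blast
  have P: "proj S (act_left \<theta> g s) = k *s proj S s" if s: "s \<in> orbit_module A" for s
  proof (rule CU_linear_eqI [OF A _ _ _ s, of "\<lambda>s. proj S (act_left \<theta> g s)" "\<lambda>s. k *s proj S s"])
    show "CU_linear \<theta> (orbit_module A) (\<lambda>s. proj S (act_left \<theta> g s))"
      by (simp add: CU_linear_def act_left_linear proj_add proj_smult proj_act_right [OF S(1)]
          act_left_CE act_left_right [OF gu])
    show "CU_linear \<theta> (orbit_module A) (\<lambda>s. k *s proj S s)"
      using lin by (simp add: CU_linear_def vec.scale_right_distrib act_right_linear mult.commute)
    show "proj S (act_left \<theta> g (axis A 1)) = k *s proj S (axis A 1)" using gA by (simp add: w_def)
  qed
  have "act_left \<theta> g s = k *s s" if s: "s \<in> S" for s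
  proof -
    have sM: "s \<in> orbit_module A" using s S(2) by blast
    have Ps: "proj S (act_left \<theta> g s) = k *s s" using P [OF sM] proj_id [OF sub s] by simp
    \<comment> \<open>The translate of \<open>s\<close> is as long as its projection
      \<open>k *s s\<close> to \<open>S\<close>, so by Pythagoras it has no component orthogonal to
      \<open>S\<close>.\<close>
    have "nsq (act_left \<theta> g s) = nsq s" using nsq_act_left [OF gu] sM orbit_module_CE [OF A] by blast
    then have "nsq (act_left \<theta> g s - k *s s) = 0"
      using nsq_proj_le [OF sub, of "act_left \<theta> g s"] by (simp add: Ps nsq_smult k1)
    then show ?thesis by (simp add: nsq_eq_0_iff)
  qed
  then show ?thesis using k1 by blast
qed

text \<open>The scalars by which \<open>H\<close> acts on \<open>S\<close> are multiplicative and
  extend \<lambda>, as is read off at the nonzero projection of \<open>[A]\<close>.\<close>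

lemma minimal_submodule:
  assumes A: "A \<in> verges" and S: "submodule_CE \<theta> S" "S \<subseteq> orbit_module A"
    and dim: "vec.dim S = CARD('f) ^ (card arms - card crossings)"
  shows "\<exists>\<psi>. hchar A \<psi> \<and> S \<subseteq> eigenspace A \<psi>"
proof -
  obtain \<psi> where \<psi>: "\<And>g. g \<in> H \<Longrightarrow> cmod (\<psi> g) = 1" "\<And>g s. g \<in> H \<Longrightarrow> s \<in> S \<Longrightarrow> act_left \<theta> g s = \<psi> g *s s"
    using minimal_submodule_scalar [OF assms] by metis
  define w where "w = proj S (axis A 1)"
  have wS: "w \<in> S" using S by (simp add: w_def submodule_CE_iff proj_in)
  have "nsq w \<noteq> 0" using dim_eq_iff [OF A S] dim by (simp add: w_def)
  then have w0: "w \<noteq> 0" by (auto simp: nsq_def)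
  have "\<psi> (g ** h) = \<psi> g * \<psi> h" if gh: "g \<in> H" "h \<in> H" for g h
  proof -
    have "\<psi> (g ** h) *s w = act_left \<theta> (g ** h) w" using \<psi>(2) H_mult gh wS by simp
    also have "\<dots> = act_left \<theta> h (act_left \<theta> g w)" using gh H_unitri by (subst act_left_comp) auto
    also have "\<dots> = (\<psi> g * \<psi> h) *s w" using \<psi>(2) gh wS by (simp add: act_left_linear)
    finally show ?thesis using w0 vec.scale_right_imp_eq by blast
  qed
  moreover have "\<psi> g = chi \<theta> A (mat 1 - g)" if "g \<in> K" for g
  proof -
    have "\<psi> g *s w = act_left \<theta> g w" using \<psi>(2) K_H that wS by auto
    also have "\<dots> = chi \<theta> A (mat 1 - g) *s w" using act_left_K [OF A that] wS S(2) by blast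
    finally show ?thesis using w0 vec.scale_right_imp_eq by blast
  qed
  ultimately have "hchar A \<psi>" using \<psi>(1) by (simp add: hchar_def)
  moreover have "S \<subseteq> eigenspace A \<psi>" using \<psi>(2) S(2) by (auto simp: eigenspace_def)
  ultimately show ?thesis by blast
qed

text \<open>This is an equality of sets of subspaces, not just up to isomorphism: a constituent of
  this dimension lies in an eigenspace, and the eigenspace is irreducible.\<close>

lemma constituents_eq:
  assumes A: "A \<in> verges"
  shows "constituents_of_dim \<theta> (orbit_module A) (CARD('f) ^ (card arms - card crossings))
    = {eigenspace A \<psi> | \<psi>. hchar A \<psi>}"
proof (intro subset_antisym subsetI)
  fix S assume "S \<in> constituents_of_dim \<theta> (orbit_module A) (CARD('f) ^ (card arms - card crossings))"
  then have S: "irreducible_CU \<theta> S" "S \<subseteq> orbit_module A" "vec.dim S = CARD('f) ^ (card arms - card crossings)"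
    by (auto simp: constituents_of_dim_def irr_constituents_def)
  then obtain \<psi> where \<psi>: "hchar A \<psi>" "S \<subseteq> eigenspace A \<psi>"
    using minimal_submodule [OF A] unfolding irreducible_CU_def by blast
  then have "S = eigenspace A \<psi>"
    using eigenspace_irreducible [OF A \<psi>(1)] S(1) unfolding irreducible_CU_def by blast
  then show "S \<in> {eigenspace A \<psi> | \<psi>. hchar A \<psi>}" using \<psi>(1) by blast
next
  fix S assume "S \<in> {eigenspace A \<psi> | \<psi>. hchar A \<psi>}"
  then obtain \<psi> where \<psi>: "hchar A \<psi>" "S = eigenspace A \<psi>" by blast
  have sub: "eigenspace A \<psi> \<subseteq> orbit_module A" by (auto simp: eigenspace_def)
  then show "S \<in> constituents_of_dim \<theta> (orbit_module A) (CARD('f) ^ (card arms - card crossings))"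
    using eigenspace_irreducible [OF A \<psi>(1)] dim_eq_iff [OF A eigenspace_submodule [OF A] sub]
      nsq_proj_eigenspace [OF A \<psi>(1)]
    by (simp add: constituents_of_dim_def irr_constituents_def \<psi>(2))
qed

text \<open>Composing with the projection to the eigenspace extends the isomorphism to the whole
  orbit module of \<open>A\<close>, where the support of the image of \<open>[A]\<close> can be
  examined. That image is nonzero, which forces \<open>A = B\<close>; the extension is then a
  nonzero scalar on the eigenspace.\<close>

lemma eigenspace_iso:
  assumes A: "A \<in> verges" and B: "B \<in> verges" and \<psi>: "hchar A \<psi>"
    and iso: "(eigenspace A \<psi>, T) \<in> iso_CU \<theta>" and T: "T \<subseteq> orbit_module B"
  shows "A = B" "T = eigenspace A \<psi>"
proof -
  let ?E = "eigenspace A \<psi>"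
  obtain \<phi> where \<phi>: "\<phi> \<in> ?E \<rightarrow>\<^sub>E T" "CU_linear \<theta> ?E \<phi>" "bij_betw \<phi> ?E T"
    and Tsub: "submodule_CE \<theta> T" using iso by (auto simp: iso_CU_def Hom_CU_iff)
  have E: "submodule_CE \<theta> ?E" "vec.subspace ?E" "?E \<subseteq> orbit_module A"
    using eigenspace_submodule [OF A] by (auto simp: submodule_CE_iff eigenspace_def)
  define \<Phi> where "\<Phi> x = \<phi> (proj ?E x)" for x
  have pE: "proj ?E x \<in> ?E" for x by (rule proj_in [OF E(2)])
  have lin: "CU_linear \<theta> (orbit_module A) \<Phi>"
    using \<phi>(2) pE proj_act_right [OF E(1)] orbit_module_CE [OF A]
    by (simp add: CU_linear_def \<Phi>_def proj_add proj_smult subset_iff)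
  have im: "\<Phi> (axis A 1) \<in> orbit_module B" using \<phi>(1) pE T by (auto simp: \<Phi>_def)
  obtain s where s: "s \<in> ?E" "s \<noteq> 0" using eigenspace_nontrivial [OF A \<psi>] .
  have "\<phi> (0 *s 0) = 0 *s \<phi> 0" using \<phi>(2) vec.subspace_0 [OF E(2)] unfolding CU_linear_def by blast
  then have "\<phi> 0 = 0" by simp
  then have s1: "\<phi> s \<noteq> 0" using \<phi>(3) s vec.subspace_0 [OF E(2)] by (auto simp: bij_betw_def inj_on_def)
  have \<Phi>E: "\<Phi> x = \<phi> x" if "x \<in> ?E" for x using proj_id [OF E(2) that] by (simp add: \<Phi>_def)
  have "\<Phi> (axis A 1) \<noteq> 0"
  proof
    assume 0: "\<Phi> (axis A 1) = 0"
    have "CU_linear \<theta> (orbit_module A) (\<lambda>x. 0)"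
      by (simp add: CU_linear_def)
    then have "\<Phi> s = 0" using CU_linear_eqI [OF A lin _ 0] s E(3) by auto
    then show False using \<Phi>E s s1 by simp
  qed
  then obtain C where "\<Phi> (axis A 1) $ C \<noteq> 0" by (auto simp: vec_eq_iff)
  then show AB: "A = B" using CU_linear_end_support(1) [OF A B lin im] by blast
  then obtain c where c: "\<And>x. x \<in> ?E \<Longrightarrow> \<Phi> x = c *s x"
    using CU_endomorphism_scalar [OF A lin _ E(3), of \<psi>] im by (auto simp: eigenspace_def)
  have c0: "c \<noteq> 0" using c [OF s(1)] \<Phi>E [OF s(1)] s1 by auto
  have "T = (\<lambda>x. c *s x) ` ?E" using \<phi>(3) c \<Phi>E by (simp add: bij_betw_def image_def)
  also have "\<dots> = ?E"
  proof (intro subset_antisym subsetI)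
    fix x assume "x \<in> ?E"
    then have "inverse c *s x \<in> ?E" "x = c *s (inverse c *s x)" using c0 vec.subspace_scale [OF E(2)] by simp_all
    then show "x \<in> (\<lambda>x. c *s x) ` ?E" by blast
  qed (auto intro: vec.subspace_scale [OF E(2)])
  finally show "T = ?E" .
qed

lemma eigenspace_inj:
  assumes A: "A \<in> verges" and \<psi>: "hchar A \<psi>" and eq: "eigenspace A \<psi> = eigenspace A \<psi>'" and g: "g \<in> H"
  shows "\<psi> g = \<psi>' g"
proof -
  obtain s where s: "s \<in> eigenspace A \<psi>" "s \<noteq> 0" using eigenspace_nontrivial [OF A \<psi>] .
  then have "s \<in> eigenspace A \<psi>'" using eq by simp
  with s have "act_left \<theta> g s = \<psi> g *s s" "act_left \<theta> g s = \<psi>' g *s s"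
    using g unfolding eigenspace_def by blast+
  then have "\<psi> g *s s = \<psi>' g *s s" by metis
  then show ?thesis using s(2) vec.scale_right_imp_eq by blast
qed

text \<open>Some component of a nonzero eigenvector is nonzero, and the component map is a scalar on
  the eigenspace. So the eigenspace lies in that summand and equals it, and any summand isomorphic
  to it is again the same subspace.\<close>

lemma eigenspace_multiplicity:
  assumes A: "A \<in> verges" and \<psi>: "hchar A \<psi>"
  shows "has_multiplicity \<theta> (eigenspace A \<psi>) (orbit_module A) 1"
proof -
  let ?E = "eigenspace A \<psi>"
  have M: "submodule_CE \<theta> (orbit_module A)" by (rule orbit_module_submodule [OF A])
  have E: "submodule_CE \<theta> ?E" "?E \<subseteq> orbit_module A"
    using eigenspace_submodule [OF A] by (auto simp: eigenspace_def)
  obtain s where s: "s \<in> ?E" "s \<noteq> 0" using eigenspace_nontrivial [OF A \<psi>] .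
  have "card {T \<in> \<D>. (?E, T) \<in> iso_CU \<theta>} = 1" if D: "irr_decomposition \<theta> (orbit_module A) \<D>" for \<D>
  proof -
    obtain F where F: "\<And>x. x \<in> orbit_module A \<Longrightarrow> x = (\<Sum>T\<in>\<D>. F x T)"
      "\<And>x T. x \<in> orbit_module A \<Longrightarrow> T \<in> \<D> \<Longrightarrow> F x T \<in> T"
      "\<And>T. T \<in> \<D> \<Longrightarrow> CU_linear \<theta> (orbit_module A) (\<lambda>x. F x T)"
      using irr_decomposition_components [OF D M] by metis
    have TD: "irreducible_CU \<theta> T" "T \<subseteq> orbit_module A" if "T \<in> \<D>" for T
      using D that by (auto simp: irr_decomposition_def irr_constituents_def)
    have "\<exists>T\<in>\<D>. F s T \<noteq> 0"
    proof (rule ccontr)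
      assume "\<not> (\<exists>T\<in>\<D>. F s T \<noteq> 0)"
      then have "s = 0" using F(1) [of s] s(1) E(2) by auto
      then show False using s(2) by simp
    qed
    then obtain T where T: "T \<in> \<D>" "F s T \<noteq> 0" by blast
    have "F (axis A 1) T \<in> orbit_module A"
      using F(2) [OF axis_in_orbit_module [OF A patch_self] T(1)] TD(2) [OF T(1)] by blast
    then obtain c where c: "\<And>x. x \<in> ?E \<Longrightarrow> F x T = c *s x"
      using CU_endomorphism_scalar [OF A F(3) [OF T(1)] _ E(2), of \<psi>] by (auto simp: eigenspace_def)
    have c0: "c \<noteq> 0" using c [OF s(1)] T(2) by auto
    have Tsub: "vec.subspace T" using TD(1) [OF T(1)] by (simp add: irreducible_CU_def submodule_CE_iff)
    have "x \<in> T" if x: "x \<in> ?E" for x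
    proof -
      have "c *s x \<in> T" using F(2) [OF _ T(1), of x] c [OF x] x E(2) by auto
      then have "inverse c *s (c *s x) \<in> T" by (rule vec.subspace_scale [OF Tsub])
      then show ?thesis using c0 by simp
    qed
    then have "?E = T" using TD(1) [OF T(1)] E(1) s by (auto simp: irreducible_CU_def)
    then have "?E \<in> \<D>" using T(1) by simp
    moreover have "T' = ?E" if "T' \<in> \<D>" "(?E, T') \<in> iso_CU \<theta>" for T'
      using eigenspace_iso(2) [OF A A \<psi> that(2) TD(2) [OF that(1)]] .
    ultimately have "{T \<in> \<D>. (?E, T) \<in> iso_CU \<theta>} = {?E}" using iso_CU_refl [OF E(1)] by blast
    then show ?thesis by simp
  qed
  then show ?thesis using irr_decomposition_exists [OF M] by (simp add: has_multiplicity_def)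
qed

end

section \<open>Linear characters of the pattern group\<close>

context orbit_setting begin

lemma indec_extra: "indec \<subseteq> extra" and extra_L_hat: "extra \<subseteq> L_hat p"
  by (auto simp: indec_def L_hat_eq)

lemma L_hat_neq: "(x, z) \<in> L_hat p \<Longrightarrow> z < x"
  using L_hat_Phi by (auto simp: Phi_pos_def)

lemma root_H: "(x, z) \<in> L_hat p \<Longrightarrow> root_elt x z t \<in> H"
  by (simp add: H_def root_in_patch)

lemma root_K: "(x, z) \<in> L_set p \<Longrightarrow> root_elt x z t \<in> K"
  by (simp add: K_def root_in_patch)

text \<open>Linear characters kill commutators, and \<open>root_elt x z t\<close> is the commutator
  of \<open>root_elt x y t\<close> and \<open>root_elt y z 1\<close>.\<close>

lemma hchar_composite:
  assumes \<psi>: "hchar A \<psi>" and xy: "(x, y) \<in> L_hat p" and yz: "(y, z) \<in> L_hat p"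
  shows "\<psi> (root_elt x z t) = 1"
proof -
  note lt = L_hat_neq [OF xy] L_hat_neq [OF yz]
  have mem: "root_elt x y t \<in> H" "root_elt y z 1 \<in> H" "root_elt x z t \<in> H"
    using root_H xy yz L_hat_trans(1) [OF xy yz] by blast+
  have "\<psi> (root_elt x y t) * \<psi> (root_elt y z 1) = \<psi> (root_elt x y t ** root_elt y z 1)"
    using \<psi> mem by (simp add: hchar_def)
  also have "\<dots> = \<psi> (root_elt x z t ** (root_elt y z 1 ** root_elt x y t))"
    using root_commutator [OF lt(2,1), of t 1] by simp
  also have "\<dots> = \<psi> (root_elt x z t) * (\<psi> (root_elt y z 1) * \<psi> (root_elt x y t))"
    using \<psi> mem H_mult by (simp add: hchar_def)
  finally show ?thesis using hchar_nz [OF \<psi>] mem by (simp add: mult.commute)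
qed

text \<open>A composite main condition would make \<psi> trivial on its root subgroup, whereas there
  \<psi> is given by \<theta> and the nonzero entry of \<open>A\<close>.\<close>

lemma hchar_hook_disconnected:
  assumes A: "A \<in> verges" and \<psi>: "hchar A \<psi>" shows "hook_disconnected p"
  unfolding hook_disconnected_iff
proof
  assume "\<exists>i j y. (i, j) \<in> p \<and> (i, y) \<in> L_hat p \<and> (y, j) \<in> L_hat p"
  then obtain i j y where ij: "(i, j) \<in> p" and y: "(i, y) \<in> L_hat p" "(y, j) \<in> L_hat p" by blast
  obtain t where t: "\<theta> (t * A $ i $ j) \<noteq> 1"
    using theta_detects [of "A $ i $ j" 0] verges_nz [OF A, of i j] ij by auto
  have "root_elt i j (- t) \<in> K" using root_K p_L_set ij by blast
  then have "\<psi> (root_elt i j (- t)) = chi \<theta> A (mat 1 - root_elt i j (- t))" using \<psi> by (simp add: hchar_def)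
  also have "\<dots> = \<theta> (t * A $ i $ j)"
    using arc_lower [OF ij] by (simp add: chi_pairing pairing_one_minus_root mult.commute)
  finally show False using hchar_composite [OF \<psi> y] t by simp
qed

definition chi_char :: "('f, 'n) sqmat \<Rightarrow> ('f, 'n) sqmat \<Rightarrow> complex" where
  "chi_char C g = chi \<theta> C (mat 1 - g)"

lemma chi_char_root: "z < x \<Longrightarrow> chi_char C (root_elt x z t) = \<theta> (- (C $ x $ z * t))"
  by (simp add: chi_char_def chi_pairing pairing_one_minus_root)

text \<open>All nonzero entries of \<open>C\<close> sit at positions that are not composite in
  \<open>L_hat p\<close>: those in \<open>indec\<close> by \<open>L_hat_trans\<close>, the main
  conditions by hook disconnectedness. There matrix entries add under multiplication.\<close>

lemma chi_char_hchar:
  assumes A: "A \<in> verges" and dc: "hook_disconnected p" and C: "C \<in> patch A indec"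
  shows "hchar A (chi_char C)"
proof -
  have noncomp: False if "C $ i $ j \<noteq> 0" "(i, y) \<in> L_hat p" "(y, j) \<in> L_hat p" for i j y
  proof (cases "(i, j) \<in> indec")
    case True
    then have "(i, j) \<in> extra" using indec_extra by blast
    then show False using L_hat_trans(2) [OF that(2,3)] True by (auto simp: indec_def)
  next
    case False
    then have "C $ i $ j = A $ i $ j" using C by (simp add: patch_def)
    then have "(i, j) \<in> p" using that(1) verges_nz [OF A] by simp
    then show False using dc that(2,3) unfolding hook_disconnected_iff by blast
  qed
  have low: "C $ i $ j = 0" if "i \<le> j" for i j
  proof -
    have "(i, j) \<notin> indec" using that indec_extra extra_L_hat L_hat_neq by (meson leD subsetD)
    then have "C $ i $ j = A $ i $ j" using C by (simp add: patch_def)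
    then show ?thesis using verges_lower [OF A] that by (simp add: strictly_lower_nth)
  qed
  have "pairing C (mat 1 - g ** h) = pairing C (mat 1 - g) + pairing C (mat 1 - h)"
    if g: "g \<in> H" and h: "h \<in> H" for g h
    unfolding pairing_def sum.distrib [symmetric]
  proof (intro sum.cong refl)
    fix i j
    show "C $ i $ j * (mat 1 - g ** h) $ i $ j
        = C $ i $ j * (mat 1 - g) $ i $ j + C $ i $ j * (mat 1 - h) $ i $ j"
    proof (cases "C $ i $ j = 0")
      case False
      then have ne: "i \<noteq> j" using low by auto
      have "(g ** h) $ i $ j = g $ i $ j + h $ i $ j"
        using patch_mult_nth [OF L_hat_Phi noncomp [OF False] ne] g h by (simp add: H_def)
      then show ?thesis using ne by (simp add: mat1_nth algebra_simps)
    qed simp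
  qed
  moreover have "pairing C (mat 1 - g) = pairing A (mat 1 - g)" if g: "g \<in> K" for g
    unfolding pairing_def
  proof (intro sum.cong refl)
    fix i j
    show "C $ i $ j * (mat 1 - g) $ i $ j = A $ i $ j * (mat 1 - g) $ i $ j"
    proof (cases "(i, j) \<in> indec")
      case True
      then have "(i, j) \<notin> L_set p" using indec_extra L_set_extra by blast
      then show ?thesis using g by (simp add: K_def patch_def)
    next
      case False then show ?thesis using C by (simp add: patch_def)
    qed
  qed
  ultimately show ?thesis by (simp add: hchar_def chi_char_def chi_pairing theta_add)
qed

text \<open>Root elements generate \<open>H\<close>, so agreement is checked on them: inside
  \<open>K\<close> both characters are \<lambda>, at positions of \<open>indec\<close> the matrix
  \<open>C\<close> is chosen to fit, and at the remaining positions, which are composite, both are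
  trivial.\<close>

lemma hchar_chi_char:
  assumes A: "A \<in> verges" and \<psi>: "hchar A \<psi>"
  shows "\<exists>C\<in>patch A indec. \<forall>g\<in>H. \<psi> g = chi_char C g"
proof -
  have dc: "hook_disconnected p" by (rule hchar_hook_disconnected [OF A \<psi>])
  have "\<exists>c. \<forall>t. \<psi> (root_elt x z t) = \<theta> (c * t)" if xz: "(x, z) \<in> indec" for x z
  proof (rule character_eq_theta)
    have xz': "(x, z) \<in> L_hat p" using xz indec_extra extra_L_hat by blast
    then have ne: "x \<noteq> z" using L_hat_neq by blast
    show "\<psi> (root_elt x z (s + t)) = \<psi> (root_elt x z s) * \<psi> (root_elt x z t)" for s t
      using \<psi> root_H [OF xz'] by (simp add: hchar_def flip: root_mult_same [OF ne])
    show "\<psi> (root_elt x z 0) \<noteq> 0" by (rule hchar_nz [OF \<psi> root_H [OF xz']])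
  qed
  then obtain c where c: "\<And>x z t. (x, z) \<in> indec \<Longrightarrow> \<psi> (root_elt x z t) = \<theta> (c x z * t)" by metis
  \<comment> \<open>The minus sign cancels the one from \<open>mat 1 - g\<close> in
    \<open>chi_char\<close>.\<close>
  define C :: "('f, 'n) sqmat" where "C = (\<chi> x z. if (x, z) \<in> indec then - c x z else A $ x $ z)"
  have C: "C \<in> patch A indec" by (simp add: patch_def C_def)
  have C\<psi>: "hchar A (chi_char C)" by (rule chi_char_hchar [OF A dc C])
  have root_elt: "\<psi> (root_elt x z t) = chi_char C (root_elt x z t)" if xz: "(x, z) \<in> L_hat p" for x z t
  proof (cases "(x, z) \<in> L_set p")
    case True
    then have "root_elt x z t \<in> K" by (rule root_K)
    then show ?thesis using \<psi> C\<psi> by (simp add: hchar_def)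
  next
    case False
    then have ex: "(x, z) \<in> extra" using xz L_hat_eq by blast
    show ?thesis
    proof (cases "(x, z) \<in> indec")
      case True
      then show ?thesis using c [OF True] chi_char_root [OF L_hat_neq [OF xz]] by (simp add: C_def)
    next
      case False
      then obtain y where "(x, y) \<in> L_hat p" "(y, z) \<in> L_hat p"
        using ex extra_L_hat by (auto simp: indec_def)
      then show ?thesis using hchar_composite [OF \<psi>] hchar_composite [OF C\<psi>] by metis
    qed
  qed
  have "\<psi> g = chi_char C g" if "g \<in> H" for g
  proof (rule root_generated [OF L_hat_Phi that [unfolded H_def]])
    show "\<psi> (mat 1) = chi_char C (mat 1)" using hchar_one [OF \<psi>] hchar_one [OF C\<psi>] by simp
    fix x z t h
    assume xz: "(x, z) \<in> L_hat p" and h: "h \<in> patch (mat 1) (L_hat p)" and eq: "\<psi> h = chi_char C h"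
    have "h \<in> H" using h by (simp add: H_def)
    then show "\<psi> (root_elt x z t ** h) = chi_char C (root_elt x z t ** h)"
      using \<psi> C\<psi> root_H [OF xz] root_elt [OF xz] eq by (simp add: hchar_def)
  qed
  then show ?thesis using C by blast
qed

lemma chi_char_inj:
  assumes C: "C \<in> patch A indec" and C': "C' \<in> patch A indec"
    and eq: "\<And>g. g \<in> H \<Longrightarrow> chi_char C g = chi_char C' g"
  shows "C = C'"
proof -
  have "C $ x $ z = C' $ x $ z" for x z
  proof (cases "(x, z) \<in> indec")
    case True
    then have xz: "(x, z) \<in> L_hat p" using indec_extra extra_L_hat by blast
    show ?thesis
    proof (rule ccontr)
      assume "C $ x $ z \<noteq> C' $ x $ z"
      then obtain t where "\<theta> (t * C $ x $ z) \<noteq> \<theta> (t * C' $ x $ z)" using theta_detects by blast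
      moreover have "chi_char C (root_elt x z (- t)) = chi_char C' (root_elt x z (- t))"
        by (rule eq [OF root_H [OF xz]])
      ultimately show False by (simp add: chi_char_root [OF L_hat_neq [OF xz]] mult.commute)
    qed
  next
    case False then show ?thesis using C C' by (simp add: patch_def)
  qed
  then show ?thesis by (simp add: vec_eq_iff)
qed

section \<open>Counting the constituents of minimal dimension\<close>

abbreviation min_constituents :: "('f, 'n) sqmat \<Rightarrow> ('f, 'n) evec set set" where
  "min_constituents A \<equiv> constituents_of_dim \<theta> (orbit_module A) (CARD('f) ^ (card arms - card crossings))"

lemma min_constituents_eq:
  assumes A: "A \<in> verges" and dc: "hook_disconnected p"
  shows "min_constituents A = (\<lambda>C. eigenspace A (chi_char C)) ` patch A indec"
proof -
  have "eigenspace A \<psi> \<in> (\<lambda>C. eigenspace A (chi_char C)) ` patch A indec" if \<psi>: "hchar A \<psi>" for \<psi>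
  proof -
    obtain C where C: "C \<in> patch A indec" "\<forall>g\<in>H. \<psi> g = chi_char C g"
      using hchar_chi_char [OF A \<psi>] by blast
    then have "eigenspace A \<psi> = eigenspace A (chi_char C)" by (auto simp: eigenspace_def)
    then show ?thesis using C(1) by blast
  qed
  then show ?thesis unfolding constituents_eq [OF A] using chi_char_hchar [OF A dc] by blast
qed

lemma card_min_constituents:
  assumes A: "A \<in> verges" and dc: "hook_disconnected p"
  shows "card (min_constituents A) = CARD('f) ^ card indec"
proof -
  have "inj_on (\<lambda>C. eigenspace A (chi_char C)) (patch A indec)"
  proof (rule inj_onI)
    fix C C' assume C: "C \<in> patch A indec" "C' \<in> patch A indec"
      and eq: "eigenspace A (chi_char C) = eigenspace A (chi_char C')"
    show "C = C'"
      by (rule chi_char_inj [OF C]) (rule eigenspace_inj [OF A chi_char_hchar [OF A dc C(1)] eq])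
  qed
  then show ?thesis by (simp add: min_constituents_eq [OF A dc] card_image card_patch)
qed

lemma min_constituents_nonempty_iff:
  assumes A: "A \<in> verges"
  shows "min_constituents A \<noteq> {} \<longleftrightarrow> hook_disconnected p"
proof
  assume "min_constituents A \<noteq> {}"
  then show "hook_disconnected p" using hchar_hook_disconnected [OF A] by (auto simp: constituents_eq [OF A])
next
  assume dc: "hook_disconnected p"
  then show "min_constituents A \<noteq> {}" using patch_self by (auto simp: min_constituents_eq [OF A])
qed

lemma min_constituents_iso:
  assumes A: "A \<in> verges" and B: "B \<in> verges" and S: "S \<in> min_constituents A" and T: "T \<in> min_constituents B"
    and iso: "(S, T) \<in> iso_CU \<theta>"
  shows "A = B" "S = T"
proof -
  obtain \<psi> where \<psi>: "hchar A \<psi>" "S = eigenspace A \<psi>" using S by (auto simp: constituents_eq [OF A])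
  have "T \<subseteq> orbit_module B" using T by (simp add: constituents_of_dim_def irr_constituents_def)
  then show "A = B" "S = T" using eigenspace_iso [OF A B \<psi>(1)] iso \<psi>(2) by auto
qed

lemma min_constituents_submodule: "S \<in> min_constituents A \<Longrightarrow> submodule_CE \<theta> S"
  by (simp add: constituents_of_dim_def irr_constituents_def irreducible_CU_def)

text \<open>If \<open>S\<close> and \<open>T\<close> have equal classes, then the class of
  \<open>S\<close> contains \<open>T\<close>, so they are isomorphic and hence equal; distinct
  members of \<open>X\<close> thus meet distinct classes.\<close>

lemma card_quotient_iso_CU:
  assumes "\<And>S. S \<in> X \<Longrightarrow> submodule_CE \<theta> S"
    and "\<And>S T. S \<in> X \<Longrightarrow> T \<in> X \<Longrightarrow> (S, T) \<in> iso_CU \<theta> \<Longrightarrow> S = T"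
  shows "num_iso_classes \<theta> X = card X"
proof -
  have "inj_on (\<lambda>S. iso_CU \<theta> `` {S}) X"
  proof (rule inj_onI)
    fix S T assume ST: "S \<in> X" "T \<in> X" "iso_CU \<theta> `` {S} = iso_CU \<theta> `` {T}"
    have "(T, T) \<in> iso_CU \<theta>" by (rule iso_CU_refl [OF assms(1) [OF ST(2)]])
    then have "(S, T) \<in> iso_CU \<theta>" using ST(3) by blast
    then show "S = T" by (rule assms(2) [OF ST(1,2)])
  qed
  moreover have "X // iso_CU \<theta> = (\<lambda>S. iso_CU \<theta> `` {S}) ` X" by (auto simp: quotient_def)
  ultimately show ?thesis by (simp add: num_iso_classes_def card_image)
qed

lemma card_verges: "card verges = (CARD('f) - 1) ^ card p"
proof -
  have low: "(i, j) \<in> p \<Longrightarrow> \<not> i \<le> j" for i j using arc_lower [of i j] by auto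
  have "bij_betw (\<lambda>B. restrict (\<lambda>(i, j). B $ i $ j) p) verges (p \<rightarrow>\<^sub>E (UNIV - {0 :: 'f}))"
  proof (rule bij_betw_byWitness [where f' = "\<lambda>f. \<chi> i j. if (i, j) \<in> p then f (i, j) else 0"])
    show "\<forall>B\<in>verges. (\<chi> i j. if (i, j) \<in> p then restrict (\<lambda>(i, j). B $ i $ j) p (i, j) else 0) = B"
      by (auto simp: vec_eq_iff verges_def main_conditions_def)
    show "\<forall>f\<in>p \<rightarrow>\<^sub>E (UNIV - {0 :: 'f}).
        restrict (\<lambda>(i, j). (\<chi> i j. if (i, j) \<in> p then f (i, j) else 0) $ i $ j) p = f"
      by (auto simp: PiE_def extensional_def fun_eq_iff)
    show "(\<lambda>B. restrict (\<lambda>(i, j). B $ i $ j) p) ` verges \<subseteq> p \<rightarrow>\<^sub>E (UNIV - {0 :: 'f})"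
      by (auto simp: verges_def main_conditions_def)
    show "(\<lambda>f. \<chi> i j. if (i, j) \<in> p then f (i, j) else 0) ` (p \<rightarrow>\<^sub>E (UNIV - {0 :: 'f})) \<subseteq> verges"
      using low by (auto simp: verges_def main_conditions_def strictly_lower_nth PiE_def Pi_def
          split: if_splits)
  qed
  then have "card (verges :: ('f, 'n) sqmat set) = card (p \<rightarrow>\<^sub>E (UNIV - {0 :: 'f}))"
    by (rule bij_betw_same_card)
  then show ?thesis by (simp add: card_PiE card_Diff_singleton)
qed

text \<open>A constituent of minimal dimension determines the verge it comes from, even up to
  isomorphism, so the union over the verges is disjoint.\<close>

lemma card_all_min_constituents:
  assumes dc: "hook_disconnected p"
  shows "num_iso_classes \<theta> (\<Union>B\<in>verges. min_constituents B)
    = (CARD('f) - 1) ^ card p * CARD('f) ^ card indec"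
proof -
  have "num_iso_classes \<theta> (\<Union>B\<in>verges. min_constituents B) = card (\<Union>B\<in>verges. min_constituents B)"
    using min_constituents_submodule min_constituents_iso(2) by (intro card_quotient_iso_CU) blast+
  also have "\<dots> = (\<Sum>B\<in>verges. card (min_constituents B))"
  proof (rule card_UN_disjoint)
    show "\<forall>B\<in>verges. finite (min_constituents B)" by (simp add: min_constituents_eq dc)
    show "\<forall>B\<in>verges. \<forall>B'\<in>verges. B \<noteq> B' \<longrightarrow> min_constituents B \<inter> min_constituents B' = {}"
    proof (intro ballI impI equals0I)
      fix B B' S
      assume B: "B \<in> verges" "B' \<in> verges" "B \<noteq> B'" and S: "S \<in> min_constituents B \<inter> min_constituents B'"
      then have "(S, S) \<in> iso_CU \<theta>" using iso_CU_refl min_constituents_submodule by blast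
      then show False using min_constituents_iso(1) [OF B(1,2)] S B(3) by blast
    qed
  qed simp
  also have "\<dots> = (\<Sum>B\<in>verges. CARD('f) ^ card indec)"
    by (intro sum.cong refl card_min_constituents dc)
  finally show ?thesis by (simp add: card_verges)
qed

end

section \<open>Independence of the endomorphism algebra of the values of the verge\<close>

text \<open>Conjugation by the linear bijection \<open>F\<close>. It is equivariant only up to the
  bijection \<tau> of the group, but commuting with all group elements is insensitive to such a
  relabelling.\<close>

lemma End_CU_isomorphic:
  fixes M N :: "('f::{field,finite}, 'n::{finite,linorder}) evec set"
  assumes M: "submodule_CE \<theta> M" and N: "submodule_CE \<theta> N"
    and MN: "\<And>x. x \<in> M \<Longrightarrow> F x \<in> N" "\<And>y. y \<in> N \<Longrightarrow> G y \<in> M"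
    and inv: "\<And>x. x \<in> M \<Longrightarrow> G (F x) = x" "\<And>y. y \<in> N \<Longrightarrow> F (G y) = y"
    and lin: "\<And>x y. F (x + y) = F x + F y" "\<And>c x. F (c *s x) = c *s F x"
      "\<And>x y. G (x + y) = G x + G y" "\<And>c x. G (c *s x) = c *s G x"
    and tau: "\<And>g. g \<in> unitri \<Longrightarrow> \<tau> g \<in> unitri" "\<And>g. g \<in> unitri \<Longrightarrow> \<sigma> g \<in> unitri"
      "\<And>g. g \<in> unitri \<Longrightarrow> \<sigma> (\<tau> g) = g" "\<And>g. g \<in> unitri \<Longrightarrow> \<tau> (\<sigma> g) = g"
    and eqv: "\<And>g x. g \<in> unitri \<Longrightarrow> x \<in> M \<Longrightarrow> F (act_right \<theta> g x) = act_right \<theta> (\<tau> g) (F x)"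
      "\<And>g y. g \<in> unitri \<Longrightarrow> y \<in> N \<Longrightarrow> G (act_right \<theta> g y) = act_right \<theta> (\<sigma> g) (G y)"
  shows "algebra_isomorphic (End_CU \<theta> M) (End_CU \<theta> N)"
proof -
  \<comment> \<open>Stated with fresh parameters because it is used in both directions, with
    \<open>F\<close>, \<open>G\<close> and \<tau>, \<sigma> exchanged.\<close>
  have conj: "restrict (\<lambda>y. F' (\<phi> (G' y))) N' \<in> Hom_CU \<theta> N' N'"
    if \<phi>: "\<phi> \<in> Hom_CU \<theta> M' M'" and N': "submodule_CE \<theta> N'"
      and "\<And>x. x \<in> M' \<Longrightarrow> F' x \<in> N'" "\<And>y. y \<in> N' \<Longrightarrow> G' y \<in> M'"
      and "\<And>x y. F' (x + y) = F' x + F' y" "\<And>c x. F' (c *s x) = c *s F' x"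
        "\<And>x y. G' (x + y) = G' x + G' y" "\<And>c x. G' (c *s x) = c *s G' x"
      and "\<And>g. g \<in> unitri \<Longrightarrow> \<tau>' (\<sigma>' g) = g" "\<And>g. g \<in> unitri \<Longrightarrow> \<sigma>' g \<in> unitri"
      and "\<And>g x. g \<in> unitri \<Longrightarrow> x \<in> M' \<Longrightarrow> F' (act_right \<theta> g x) = act_right \<theta> (\<tau>' g) (F' x)"
        "\<And>g y. g \<in> unitri \<Longrightarrow> y \<in> N' \<Longrightarrow> G' (act_right \<theta> g y) = act_right \<theta> (\<sigma>' g) (G' y)"
    for F' G' M' N' \<tau>' \<sigma>' \<phi>
  proof -
    have \<phi>M: "\<phi> x \<in> M'" if "x \<in> M'" for x using \<phi> that by (auto simp: Hom_CU_iff)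
    have lin: "CU_linear \<theta> M' \<phi>" using \<phi> by (simp add: Hom_CU_iff)
    have Nc: "x + y \<in> N'" "c *s x \<in> N'" "g \<in> unitri \<Longrightarrow> act_right \<theta> g x \<in> N'"
      if "x \<in> N'" "y \<in> N'" for x y c g
      using N' that by (simp_all add: submodule_CE_iff vec.subspace_add vec.subspace_scale)
    show ?thesis using that(3-12) lin \<phi>M
      by (auto simp: Hom_CU_iff CU_linear_def Nc)
  qed
  define h where "h \<phi> = restrict (\<lambda>y. F (\<phi> (G y))) N" for \<phi>
  define k where "k \<phi> = restrict (\<lambda>x. G (\<phi> (F x))) M" for \<phi>
  have h: "h \<phi> \<in> Hom_CU \<theta> N N" if "\<phi> \<in> Hom_CU \<theta> M M" for \<phi>
    unfolding h_def by (rule conj [OF that N, of F G \<tau> \<sigma>]) (use MN lin tau eqv in auto)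
  have k: "k \<phi> \<in> Hom_CU \<theta> M M" if "\<phi> \<in> Hom_CU \<theta> N N" for \<phi>
    unfolding k_def by (rule conj [OF that M, of G F \<sigma> \<tau>]) (use MN lin tau eqv in auto)
  have ext: "\<phi> \<in> extensional M" "x \<in> M \<Longrightarrow> \<phi> x \<in> M" if "\<phi> \<in> Hom_CU \<theta> M M" for \<phi> x
    using that by (auto simp: Hom_CU_iff PiE_def)
  have extN: "\<phi> \<in> extensional N" "x \<in> N \<Longrightarrow> \<phi> x \<in> N" if "\<phi> \<in> Hom_CU \<theta> N N" for \<phi> x
    using that by (auto simp: Hom_CU_iff PiE_def)
  have hk: "h (k \<phi>) = \<phi>" if "\<phi> \<in> Hom_CU \<theta> N N" for \<phi>
    using extN [OF that] by (intro extensionalityI [of _ N]) (simp_all add: h_def k_def MN inv)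
  have kh: "k (h \<phi>) = \<phi>" if "\<phi> \<in> Hom_CU \<theta> M M" for \<phi>
    using ext [OF that] by (intro extensionalityI [of _ M]) (simp_all add: h_def k_def MN inv)
  have "bij_betw h (Hom_CU \<theta> M M) (Hom_CU \<theta> N N)"
    by (rule bij_betw_byWitness [where f' = k]) (use h k hk kh in auto)
  moreover have "h (compose M \<phi> \<psi>) = compose N (h \<phi>) (h \<psi>)"
    if "\<phi> \<in> Hom_CU \<theta> M M" "\<psi> \<in> Hom_CU \<theta> M M" for \<phi> \<psi>
    using ext(2) [OF that(2)] by (auto simp: h_def compose_def fun_eq_iff MN inv)
  moreover have "h (restrict (\<lambda>x. \<phi> x + \<psi> x) M) = restrict (\<lambda>x. h \<phi> x + h \<psi> x) N" for \<phi> \<psi>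
    by (auto simp: h_def fun_eq_iff MN lin)
  moreover have "h (restrict (\<lambda>x. x) M) = restrict (\<lambda>x. x) N"
    by (auto simp: h_def fun_eq_iff MN inv)
  moreover have "h (restrict (\<lambda>x. c *s \<phi> x) M) = restrict (\<lambda>x. c *s h \<phi> x) N" for c \<phi>
    by (auto simp: h_def fun_eq_iff MN lin)
  ultimately have "h \<in> ring_iso (End_CU \<theta> M) (End_CU \<theta> N)"
    "\<forall>c. \<forall>\<phi>\<in>carrier (End_CU \<theta> M). h (c \<odot>\<^bsub>End_CU \<theta> M\<^esub> \<phi>) = c \<odot>\<^bsub>End_CU \<theta> N\<^esub> h \<phi>"
    using h by (auto simp: ring_iso_def ring_hom_def End_CU_def)
  then show ?thesis unfolding algebra_isomorphic_def by blast
qed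

section \<open>Conjugation by diagonal matrices\<close>

definition dconj :: "('n \<Rightarrow> 'f) \<Rightarrow> ('f, 'n) sqmat \<Rightarrow> ('f::{field,finite}, 'n::{finite,linorder}) sqmat" where
  "dconj d M = (\<chi> i j. d i * M $ i $ j / d j)"

text \<open>For nonzero \<open>d\<close> this is the linear map taking \<open>[C]\<close> to
  \<open>[dconj d C]\<close>, see \<open>dperm_axis\<close>; written on coordinates it uses the
  inverse conjugation.\<close>

definition dperm :: "('n \<Rightarrow> 'f) \<Rightarrow> ('f, 'n) evec \<Rightarrow> ('f::{field,finite}, 'n::{finite,linorder}) evec" where
  "dperm d v = (\<chi> C. v $ dconj (\<lambda>i. inverse (d i)) C)"

lemma dconj_inverse:
  assumes "\<And>i. d i \<noteq> 0" shows "dconj d (dconj (\<lambda>i. inverse (d i)) C) = C"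
  using assms by (simp add: dconj_def vec_eq_iff divide_inverse)

lemma dconj_inverse':
  assumes "\<And>i. d i \<noteq> 0" shows "dconj (\<lambda>i. inverse (d i)) (dconj d C) = C"
  using assms by (simp add: dconj_def vec_eq_iff divide_inverse)

lemma dconj_lower: "C \<in> strictly_lower \<Longrightarrow> dconj d C \<in> strictly_lower"
  by (simp add: strictly_lower_nth dconj_def)

lemma dconj_unitri:
  assumes "\<And>i. d i \<noteq> 0" "g \<in> unitri" shows "dconj d g \<in> unitri"
  using assms by (simp add: unitri_nth dconj_def)

text \<open>Moving the diagonal matrix \<open>D\<close> of \<open>d\<close> past a transpose inverts
  it, so conjugating \<open>C\<close> by \<open>D\<close> goes together with conjugating
  \<open>g\<close> by the inverse of \<open>D\<close>.\<close>

lemma dconj_act: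
  assumes d: "\<And>i. d i \<noteq> 0"
  shows "trunc (dconj d C ** transpose (dconj (\<lambda>i. inverse (d i)) g)) = dconj d (trunc (C ** transpose g))"
  using d by (simp add: vec_eq_iff trunc_nth dconj_def mult_nth transpose_def sum_distrib_left
      sum_divide_distrib field_simps)

text \<open>An entry of \<open>dconj d C\<close> carries the factor \<open>d i / d j\<close> and
  that of the conjugated \<open>g\<close> its inverse, so each product in the pairing is
  unchanged.\<close>

lemma chi_dconj:
  assumes d: "\<And>i. d i \<noteq> 0"
  shows "chi \<theta> (dconj d C) (mat 1 - dconj (\<lambda>i. inverse (d i)) g) = chi \<theta> C (mat 1 - g)"
proof -
  have "pairing (dconj d C) (mat 1 - dconj (\<lambda>i. inverse (d i)) g) = pairing C (mat 1 - g)"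
    unfolding pairing_def
  proof (intro sum.cong refl)
    fix i j
    show "dconj d C $ i $ j * (mat 1 - dconj (\<lambda>i. inverse (d i)) g) $ i $ j = C $ i $ j * (mat 1 - g) $ i $ j"
      using d [of i] d [of j] by (simp add: dconj_def mat1_nth field_simps)
  qed
  then show ?thesis by (simp add: chi_pairing)
qed

lemma dperm_axis:
  assumes d: "\<And>i. d i \<noteq> 0" shows "dperm d (axis C 1) = axis (dconj d C) 1"
proof -
  have "dconj (\<lambda>i. inverse (d i)) X = C \<longleftrightarrow> X = dconj d C" for X
    using dconj_inverse [of d X, OF d] dconj_inverse' [of d C, OF d] by auto
  then show ?thesis by (simp add: dperm_def axis_def)
qed

lemma dperm_linear: "dperm d (x + y) = dperm d x + dperm d y" "dperm d (c *s x) = c *s dperm d x"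
  by (simp_all add: dperm_def vec_eq_iff)

lemma dperm_sum: "dperm d (\<Sum>a\<in>S. f a) = (\<Sum>a\<in>S. dperm d (f a))"
  by (simp add: dperm_def vec_eq_iff sum_component)

lemma dperm_inverse:
  assumes "\<And>i. d i \<noteq> 0" shows "dperm d (dperm (\<lambda>i. inverse (d i)) v) = v"
  by (simp add: dperm_def dconj_inverse [OF assms] vec_lambda_eta)

lemma dperm_inverse':
  assumes "\<And>i. d i \<noteq> 0" shows "dperm (\<lambda>i. inverse (d i)) (dperm d v) = v"
  by (simp add: dperm_def dconj_inverse' [OF assms] vec_lambda_eta)

lemma dperm_act_right:
  assumes d: "\<And>i. d i \<noteq> 0"
  shows "dperm d (act_right \<theta> g v) = act_right \<theta> (dconj (\<lambda>i. inverse (d i)) g) (dperm d v)"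
proof -
  let ?e = "\<lambda>i. inverse (d i)"
  have "dperm d (act_right \<theta> g v)
      = (\<Sum>C\<in>strictly_lower. (v $ C * chi \<theta> C (mat 1 - g)) *s axis (dconj d (trunc (C ** transpose g))) 1)"
    by (simp add: act_right_def monomial_def dperm_sum dperm_linear dperm_axis [OF d])
  also have "\<dots> = (\<Sum>C\<in>strictly_lower. (v $ dconj ?e (dconj d C) * chi \<theta> (dconj d C) (mat 1 - dconj ?e g)) *s
      axis (trunc (dconj d C ** transpose (dconj ?e g))) 1)"
    by (simp add: dconj_inverse' [OF d] chi_dconj [OF d] dconj_act [OF d])
  also have "\<dots> = (\<Sum>C\<in>strictly_lower. (v $ dconj ?e C * chi \<theta> C (mat 1 - dconj ?e g)) *s
      axis (trunc (C ** transpose (dconj ?e g))) 1)"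
    by (rule sum.reindex_bij_witness [of _ "dconj ?e" "dconj d"])
      (simp_all add: dconj_inverse [OF d] dconj_inverse' [OF d] dconj_lower)
  finally show ?thesis by (simp add: act_right_def monomial_def dperm_def)
qed

context orbit_setting begin

text \<open>The graph with edges \<open>i \<longrightarrow> j\<close> for \<open>(i, j) \<in> p\<close> is a disjoint union of decreasing paths,
  so the values at the main conditions can be rescaled independently by a diagonal conjugation.\<close>

lemma diagonal_exists:
  assumes A: "A \<in> verges" and B: "B \<in> verges"
  shows "\<exists>d. (\<forall>i. d i \<noteq> 0) \<and> dconj d A = B"
proof -
  have "\<exists>d :: 'n \<Rightarrow> 'f. (\<forall>i. d i \<noteq> 0) \<and> (\<forall>i j. (i, j) \<in> p \<and> i \<in> S \<longrightarrow> d i * A $ i $ j = B $ i $ j * d j)" for S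
    using finite [of S]
  proof (induction S rule: finite_linorder_max_induct)
    case empty show ?case by (rule exI [of _ "\<lambda>i. 1"]) simp
  next
    case (insert m S)
    then obtain d :: "'n \<Rightarrow> 'f" where d: "\<And>i. d i \<noteq> 0"
      "\<And>i j. (i, j) \<in> p \<Longrightarrow> i \<in> S \<Longrightarrow> d i * A $ i $ j = B $ i $ j * d j" by blast
    show ?case
    proof (cases "m \<in> fst ` p")
      case False
      then have "(m, j) \<notin> p" for j by force
      then show ?thesis using d by (intro exI [of _ d]) auto
    next
      case True
      then obtain l where ml: "(m, l) \<in> p" by force
      \<comment> \<open>Indices are added in increasing order. The equation of row \<open>m\<close>
        is solved for \<open>d m\<close> in terms of \<open>d l\<close> with \<open>l < m\<close>,
        and the equations of earlier rows involve only indices below \<open>m\<close>.\<close>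
      define d' where "d' = d(m := B $ m $ l * d l / A $ m $ l)"
      have "d' i \<noteq> 0" for i
        using d(1) ml verges_nz [OF A, of m l] verges_nz [OF B, of m l] by (simp add: d'_def)
      moreover have "d' i * A $ i $ j = B $ i $ j * d' j" if ij: "(i, j) \<in> p" and i: "i \<in> insert m S" for i j
      proof (cases "i = m")
        case True
        then have "j = l" "j \<noteq> m" using arc_row ml ij arc_lower [OF ij] by auto
        then show ?thesis using True verges_nz [OF A, of m l] ml by (simp add: d'_def)
      next
        case False
        then have "i \<in> S" "i < m" using i insert.hyps by auto
        moreover from this have "j \<noteq> m" using arc_lower [OF ij] by auto
        ultimately show ?thesis using d(2) [OF ij] False by (simp add: d'_def)
      qed
      ultimately show ?thesis by blast
    qed
  qed
  from this [of UNIV] obtain d :: "'n \<Rightarrow> 'f" where d: "\<And>i. d i \<noteq> 0"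
    "\<And>i j. (i, j) \<in> p \<Longrightarrow> d i * A $ i $ j = B $ i $ j * d j" by auto
  have "dconj d A $ i $ j = B $ i $ j" for i j
  proof (cases "(i, j) \<in> p")
    case True then show ?thesis using d by (simp add: dconj_def)
  next
    case False then show ?thesis by (simp add: dconj_def verges_0 [OF A] verges_0 [OF B])
  qed
  then show ?thesis using d(1) by (auto simp: vec_eq_iff)
qed

lemma dperm_orbit_module:
  assumes A: "A \<in> verges" and B: "B \<in> verges" and d: "\<And>i. d i \<noteq> 0" and AB: "dconj d A = B"
    and v: "v \<in> orbit_module A"
  shows "dperm d v \<in> orbit_module B"
proof -
  have "dconj (\<lambda>i. inverse (d i)) C \<notin> patch A arms" if C: "C \<notin> patch B arms" for C
  proof
    assume in_A: "dconj (\<lambda>i. inverse (d i)) C \<in> patch A arms"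
    have "dconj d (dconj (\<lambda>i. inverse (d i)) C) \<in> patch B arms"
      using in_A unfolding AB [symmetric] patch_def by (simp add: dconj_def [of d])
    then show False using C dconj_inverse [of d C, OF d] by simp
  qed
  then show ?thesis using v by (simp add: orbit_module_eq A B supported_def dperm_def)
qed

lemma End_orbit_module_isomorphic:
  assumes A: "A \<in> verges" and B: "B \<in> verges"
  shows "algebra_isomorphic (End_CU \<theta> (orbit_module A)) (End_CU \<theta> (orbit_module B))"
proof -
  obtain d :: "'n \<Rightarrow> 'f" where d: "\<And>i. d i \<noteq> 0" and AB: "dconj d A = B"
    using diagonal_exists [OF A B] by blast
  let ?e = "\<lambda>i. inverse (d i)"
  have e: "?e i \<noteq> 0" for i using d by simp
  have BA: "dconj ?e B = A" using dconj_inverse' [of d A, OF d] AB by simp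
  show ?thesis
  proof (rule End_CU_isomorphic [where F = "dperm d" and G = "dperm ?e" and \<tau> = "dconj ?e" and \<sigma> = "dconj d"])
    show "submodule_CE \<theta> (orbit_module A)" "submodule_CE \<theta> (orbit_module B)"
      by (rule orbit_module_submodule A B)+
    show "dperm d x \<in> orbit_module B" if "x \<in> orbit_module A" for x
      by (rule dperm_orbit_module [OF A B d AB that])
    show "dperm ?e y \<in> orbit_module A" if "y \<in> orbit_module B" for y
      by (rule dperm_orbit_module [OF B A e BA that])
    show "dperm ?e (act_right \<theta> g y) = act_right \<theta> (dconj d g) (dperm ?e y)" for g y
      using dperm_act_right [of ?e \<theta> g y] d by simp
  qed (simp_all add: dperm_linear dperm_inverse dperm_inverse' dconj_inverse dconj_inverse'
      dconj_unitri dperm_act_right d)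
qed

end

theorem theorem5p7:
  fixes \<theta> :: "'f::{field,finite} \<Rightarrow> complex"
    and A :: "('f, 'n::{finite,linorder}) sqmat"
    and p :: "('n \<times> 'n) set"
    and q k a b c :: nat
  assumes "nontrivial_add_character \<theta>"
    and "verge A"
    and "q = CARD('f)"
    and "p = main_conditions A"
    and "k = card p"
    and "q ^ a = card (right_orbit A)"
    and "b = card (hook_intersections p)"
    and "c = card (L_hat_minus p - I_set p)"
  shows "(constituents_of_dim \<theta> (orbit_module A) (q ^ (a - b)) \<noteq> {} \<longleftrightarrow> hook_disconnected p) \<and>
    (hook_disconnected p \<longrightarrow>
       num_iso_classes \<theta> (constituents_of_dim \<theta> (orbit_module A) (q ^ (a - b))) = q ^ c \<and>
       (\<forall>S \<in> constituents_of_dim \<theta> (orbit_module A) (q ^ (a - b)).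
          has_multiplicity \<theta> S (orbit_module A) 1) \<and>
       (\<forall>B \<in> strictly_lower. main_conditions B = p \<longrightarrow>
          algebra_isomorphic (End_CU \<theta> (orbit_module A)) (End_CU \<theta> (orbit_module B))) \<and>
       num_iso_classes \<theta>
         (\<Union>B \<in> {B \<in> strictly_lower. main_conditions B = p}.
            constituents_of_dim \<theta> (orbit_module B) (q ^ (a - b))) = (q - 1) ^ k * q ^ c)"
proof -
  interpret orbit_setting \<theta> p
  proof
    show "nontrivial_add_character \<theta>" by fact
    show "j < i" if "(i, j) \<in> p" for i j
      using that assms(2) by (auto simp: assms(4) main_conditions_def verge_def strictly_lower_def Phi_pos_def)
    show "j = j'" if "(i, j) \<in> p" "(i, j') \<in> p" for i j j'
      using that assms(2) unfolding assms(4) main_conditions_def verge_def by blast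
    show "i = i'" if "(i, j) \<in> p" "(i', j) \<in> p" for i i' j
      using that assms(2) unfolding assms(4) main_conditions_def verge_def by blast
  qed
  have A: "A \<in> verges" using assms(2) by (simp add: verges_def verge_def assms(4) [symmetric])
  \<comment> \<open>The exponent \<open>a\<close> is given only through the orbit size
    \<open>q ^ a\<close>; it can be recovered because \<open>q > 1\<close>.\<close>
  have "card {0, 1 :: 'f} \<le> CARD('f)" by (rule card_mono) simp_all
  then have q: "1 < q" by (simp add: assms(3))
  have a: "a = card arms"
    using assms(6) card_right_orbit [OF A] q by (simp add: assms(3)[symmetric])
  have b: "b = card crossings" by (simp add: assms(7) hook_intersections_eq)
  have c: "c = card indec" by (simp add: assms(8) indec_eq)
  have verges: "{B \<in> strictly_lower. main_conditions B = p} = verges" by (simp add: verges_def)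
  have min: "constituents_of_dim \<theta> (orbit_module B) (q ^ (a - b)) = min_constituents B" for B
    by (simp add: assms(3) a b)
  show ?thesis
    unfolding min verges
  proof (intro conjI impI ballI)
    show "min_constituents A \<noteq> {} \<longleftrightarrow> hook_disconnected p" by (rule min_constituents_nonempty_iff [OF A])
    assume dc: "hook_disconnected p"
    have "num_iso_classes \<theta> (min_constituents A) = card (min_constituents A)"
      using min_constituents_submodule min_constituents_iso(2) [OF A A] by (intro card_quotient_iso_CU) blast+
    then show "num_iso_classes \<theta> (min_constituents A) = q ^ c"
      by (simp add: card_min_constituents [OF A dc] assms(3) c)
    show "has_multiplicity \<theta> S (orbit_module A) 1" if S: "S \<in> min_constituents A" for S
      using S eigenspace_multiplicity [OF A] by (auto simp: constituents_eq [OF A])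
    show "algebra_isomorphic (End_CU \<theta> (orbit_module A)) (End_CU \<theta> (orbit_module B))"
      if "B \<in> strictly_lower" "main_conditions B = p" for B
      by (rule End_orbit_module_isomorphic [OF A]) (simp add: verges_def that)
    show "num_iso_classes \<theta> (\<Union>B\<in>verges. min_constituents B) = (q - 1) ^ k * q ^ c"
      using card_all_min_constituents [OF dc] by (simp add: assms(3,5) c)
  qed
qed

end
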